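(* Suppose that $k>2$ is a fixed positive integer and $c=\Theta(n^{-\alpha})$, where $0<\alpha\le\frac{2}{k-1}$ is also fixed. Then there is a randomized algorithm solving $\#(k,2)$-CLIQUE on inputs sampled from $G(n,c)$ with probability $1-n^{-\omega(1)}$ that runs in $$\tilde O\left(n^{\omega\lceil k/3\rceil+\omega-\omega\alpha\binom{\lceil k/3\rceil}{2}}\right)$$ time. (In the runtime exponent, $\omega$ is the matrix multiplication exponent.)
   Context: $\#(k,2)$-CLIQUE is the problem of counting the number of $k$-cliques in a given (simple, undirected) graph. $G(n,c)$ is the Erdős–Rényi random graph on $n$ vertices where each edge is included independently with probability $c$. The success probability is over both the input and the algorithm's random bits; in "$1-n^{-\omega(1)}$", $n^{-\omega(1)}$ denotes a quantity decaying faster than any fixed polynomial in $1/n$. $\tilde O$ hides $\mathrm{polylog}(n)$ factors. *)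

theory Defs
  imports "HOL-Probability.Probability" "HOL-Library.Landau_Symbols" "HOL-Library.Log_Nat"
begin

section \<open>Asymptotic notation\<close>

definition soft_O :: "(nat \<Rightarrow> real) \<Rightarrow> (nat \<Rightarrow> real) set" where
  "soft_O g = {f. \<exists>d::nat. f \<in> O(\<lambda>n. g n * ln (real n) ^ d)}"

text \<open>The functions bounded by \<open>n\<close> to the power \<open>-\<omega>(1)\<close>, where \<open>\<omega>(1)\<close> is the Landau symbol.\<close>

definition superpoly_small :: "(nat \<Rightarrow> real) \<Rightarrow> bool" where
  "superpoly_small f \<longleftrightarrow> (\<forall>a::real. f \<in> o(\<lambda>n. real n powr (-a)))"


section \<open>The matrix multiplication exponent\<close>

text \<open>
  Straight-line programs whose inputs are the entries of two matrices.  Every line performs one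
  arithmetic operation on input entries, scalars and results of earlier lines, so the length of a
  program is its number of arithmetic operations.  There is no division.
\<close>

datatype 'a operand = Left_Entry nat nat | Right_Entry nat nat | Scalar 'a | Line nat

datatype arith_op = Plus | Minus | Times

type_synonym 'a slp = "(arith_op \<times> 'a operand \<times> 'a operand) list"

fun apply_op :: "arith_op \<Rightarrow> 'a::field \<Rightarrow> 'a \<Rightarrow> 'a" where
  "apply_op Plus x y = x + y"
| "apply_op Minus x y = x - y"
| "apply_op Times x y = x * y"

fun operand_val ::
  "(nat \<Rightarrow> nat \<Rightarrow> 'a::field) \<Rightarrow> (nat \<Rightarrow> nat \<Rightarrow> 'a) \<Rightarrow> 'a list \<Rightarrow> 'a operand \<Rightarrow> 'a" where
  "operand_val A B vs (Left_Entry i j) = A i j"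
| "operand_val A B vs (Right_Entry i j) = B i j"
| "operand_val A B vs (Scalar a) = a"
| "operand_val A B vs (Line l) = (if l < length vs then vs ! l else 0)"

definition slp_vals ::
  "(nat \<Rightarrow> nat \<Rightarrow> 'a::field) \<Rightarrow> (nat \<Rightarrow> nat \<Rightarrow> 'a) \<Rightarrow> 'a slp \<Rightarrow> 'a list" where
  "slp_vals A B p =
     foldl (\<lambda>vs (f, x, y). vs @ [apply_op f (operand_val A B vs x) (operand_val A B vs y)]) [] p"

text \<open>
  An \<open>n \<times> n\<close> matrix is a function of two indices, of which only the values at indices below \<open>n\<close>
  matter.  \<open>out i j\<close> tells where the entry \<open>(i, j)\<close> of the product is found.
\<close>

definition multiplies_matrices ::
  "nat \<Rightarrow> 'a::field slp \<Rightarrow> (nat \<Rightarrow> nat \<Rightarrow> 'a operand) \<Rightarrow> bool" where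
  "multiplies_matrices n p out \<longleftrightarrow>
     (\<forall>A B. \<forall>i<n. \<forall>j<n. operand_val A B (slp_vals A B p) (out i j) = (\<Sum>l<n. A i l * B l j))"

definition matmul_ops :: "'a::field itself \<Rightarrow> nat \<Rightarrow> nat" where
  "matmul_ops _ n = (LEAST s. \<exists>(p::'a slp) out. length p = s \<and> multiplies_matrices n p out)"

definition matmul_exponent :: "'a::field itself \<Rightarrow> real" where
  "matmul_exponent K = Inf {\<tau>. (\<lambda>n. real (matmul_ops K n)) \<in> O(\<lambda>n. real n powr \<tau>)}"

text \<open>
  The exponent depends only on the characteristic of the field; counting takes place in
  characteristic \<open>0\<close>.
\<close>

abbreviation mm_omega :: real where
  "mm_omega \<equiv> matmul_exponent TYPE(rat)"


section \<open>Randomized random access machines\<close>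

text \<open>
  The machine has registers and a memory, both holding natural numbers of arbitrary size.  The
  running time is measured by the logarithmic cost criterion, which charges every instruction for
  the number of bits of the numbers and memory addresses it works on; so up to polylogarithmic
  factors it agrees with the running time on a word RAM with words of logarithmic length.
  The finitely many register numbers in a program are constants and are not charged.
  Subtraction is truncated at \<open>0\<close> and division by \<open>0\<close> yields \<open>0\<close>.
\<close>

type_synonym reg = nat

datatype ram_op = Add | Sub | Mul | Div

datatype instr =
    Set_Const reg nat
  | Compute reg ram_op reg reg
  | Load reg reg    \<comment> \<open>destination, register holding the address\<close>
  | Store reg reg   \<comment> \<open>register holding the address, source\<close>
  | Coin reg

datatype program =
    Instr instr
  | Seq program program
  | If_Nonzero reg program program
  | While_Nonzero reg program

type_synonym ram_state = "(reg \<Rightarrow> nat) \<times> (nat \<Rightarrow> nat)"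

fun ram_op_val :: "ram_op \<Rightarrow> nat \<Rightarrow> nat \<Rightarrow> nat" where
  "ram_op_val Add x y = x + y"
| "ram_op_val Sub x y = x - y"
| "ram_op_val Mul x y = x * y"
| "ram_op_val Div x y = x div y"

fun exec_instr :: "instr \<Rightarrow> ram_state \<Rightarrow> ram_state pmf" where
  "exec_instr (Set_Const d a) (R, M) = return_pmf (R(d := a), M)"
| "exec_instr (Compute d f x y) (R, M) = return_pmf (R(d := ram_op_val f (R x) (R y)), M)"
| "exec_instr (Load d x) (R, M) = return_pmf (R(d := M (R x)), M)"
| "exec_instr (Store x s) (R, M) = return_pmf (R, M(R x := R s))"
| "exec_instr (Coin d) (R, M) =
     map_pmf (\<lambda>b. (R(d := if b then 1 else 0), M)) (bernoulli_pmf (1 / 2))"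

abbreviation bits :: "nat \<Rightarrow> nat" where
  "bits x \<equiv> floorlog 2 x"

fun instr_cost :: "instr \<Rightarrow> ram_state \<Rightarrow> nat" where
  "instr_cost (Set_Const d a) (R, M) = 1 + bits a"
| "instr_cost (Compute d f x y) (R, M) = 1 + bits (R x) + bits (R y)"
| "instr_cost (Load d x) (R, M) = 1 + bits (R x) + bits (M (R x))"
| "instr_cost (Store x s) (R, M) = 1 + bits (R x) + bits (R s)"
| "instr_cost (Coin d) (R, M) = 1"

text \<open>
  A configuration consists of the programs still to be executed, in this order, the state, and
  the cost incurred so far.
\<close>

type_synonym config = "program list \<times> ram_state \<times> nat"

fun step :: "config \<Rightarrow> config pmf" where
  "step ([], s, t) = return_pmf ([], s, t)"
| "step (Instr i # ps, s, t) = map_pmf (\<lambda>s'. (ps, s', t + instr_cost i s)) (exec_instr i s)"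
| "step (Seq p q # ps, s, t) = return_pmf (p # q # ps, s, t + 1)"
| "step (If_Nonzero x p q # ps, s, t) =
     return_pmf ((if fst s x \<noteq> 0 then p else q) # ps, s, t + 1 + bits (fst s x))"
| "step (While_Nonzero x p # ps, s, t) =
     return_pmf (if fst s x \<noteq> 0 then p # While_Nonzero x p # ps else ps, s, t + 1 + bits (fst s x))"

primrec run_steps :: "nat \<Rightarrow> config \<Rightarrow> config pmf" where
  "run_steps 0 C = return_pmf C"
| "run_steps (Suc m) C = bind_pmf (step C) (run_steps m)"

definition halted_after :: "program \<Rightarrow> ram_state \<Rightarrow> nat \<Rightarrow> bool" where
  "halted_after P s m \<longleftrightarrow> (\<forall>(ps, s', t) \<in> set_pmf (run_steps m ([P], s, 0)). ps = [])"

text \<open>The time bound is required for all outcomes of the coin tosses.\<close>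

definition runs_in_time :: "program \<Rightarrow> ram_state \<Rightarrow> nat \<Rightarrow> bool" where
  "runs_in_time P s T \<longleftrightarrow>
     (\<exists>m. \<forall>(ps, s', t) \<in> set_pmf (run_steps m ([P], s, 0)). ps = [] \<and> t \<le> T)"

text \<open>
  The output is the final content of register \<open>0\<close>.  Its distribution is meaningful only for
  programs that halt on \<open>s\<close> within a bounded number of steps.
\<close>

definition output_pmf :: "program \<Rightarrow> ram_state \<Rightarrow> nat pmf" where
  "output_pmf P s =
     map_pmf (\<lambda>(ps, (R, M), t). R 0) (run_steps (LEAST m. halted_after P s m) ([P], s, 0))"


section \<open>Graphs, cliques and the Erdos-Renyi model\<close>

text \<open>A simple graph on the vertices \<open>0, \<dots>, n - 1\<close> is given by its set of edges.\<close>

definition all_edges :: "nat \<Rightarrow> nat set set" where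
  "all_edges n = {e. e \<subseteq> {..<n} \<and> card e = 2}"

definition cliques :: "nat \<Rightarrow> nat \<Rightarrow> nat set set \<Rightarrow> nat set set" where
  "cliques k n E = {S. S \<subseteq> {..<n} \<and> card S = k \<and> (\<forall>u\<in>S. \<forall>v\<in>S. u \<noteq> v \<longrightarrow> {u, v} \<in> E)}"

definition erdos_renyi :: "nat \<Rightarrow> real \<Rightarrow> nat set set pmf" where
  "erdos_renyi n p =
     map_pmf (\<lambda>f. {e \<in> all_edges n. f e}) (Pi_pmf (all_edges n) False (\<lambda>_. bernoulli_pmf p))"

text \<open>Register \<open>0\<close> contains \<open>n\<close>, and the memory contains the adjacency matrix row by row.\<close>

definition graph_input :: "nat \<Rightarrow> nat set set \<Rightarrow> ram_state" where
  "graph_input n E =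
     ((\<lambda>_. 0)(0 := n), \<lambda>a. if a < n * n \<and> {a div n, a mod n} \<in> E then 1 else 0)"

text \<open>The probability is over both the graph and the coin tosses of the program.\<close>

definition clique_count_success :: "program \<Rightarrow> nat \<Rightarrow> nat \<Rightarrow> real \<Rightarrow> real" where
  "clique_count_success P k n p =
     pmf (bind_pmf (erdos_renyi n p) (\<lambda>E.
            map_pmf (\<lambda>y. y = card (cliques k n E)) (output_pmf P (graph_input n E)))) True"

end

theory Submission
  imports Defs "HOL-Computational_Algebra.Polynomial"
begin

text \<open>
  Write \<open>m = \<lceil>k / 3\<rceil>\<close>, \<open>j = k - 2m\<close> and \<open>\<mu> = m - \<alpha> (m choose 2)\<close>.  The expected number of \<open>m\<close>-cliques is of
  order at most \<open>n\<^sup>\<mu>\<close>, and so is, up to constants, the \<open>q\<close>-th root of its \<open>q\<close>-th moment, because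
  adding a clique that meets the previous ones in \<open>s \<le> m\<close> vertices costs \<open>n\<close> to the power
  \<open>\<mu> - (s - \<alpha> (s choose 2)) \<le> \<mu>\<close>.  By Markov's inequality for all moments there are at most
  \<open>n\<close> to the power \<open>\<mu> + 1/4\<close> many \<open>m\<close>-cliques and \<open>j\<close>-cliques, with superpolynomially small
  failure probability.  So the program is deterministic: it lists these cliques up to a cutoff \<open>D\<close>, and
  counts the \<open>k\<close>-cliques as the triples of listed cliques that fit together pairwise, which
  is the value \<open>\<Sum> a x y * b y z * c x z\<close> of the trilinear form of \<open>D \<times> D\<close> matrix multiplication.

  For the matrix multiplication one fixed straight-line program for \<open>d \<times> d\<close> matrices, of length close to
  \<open>d\<^sup>\<omega>\<close>, is turned into a trilinear identity with integer coefficients.  Its tensor powers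
  evaluate the form for \<open>D\<close> a power of \<open>d\<close>.  The slack of \<open>n\<^sup>\<omega>\<close> in the claimed bound pays for the
  rounding of \<open>D\<close>, for the loss in the exponent \<open>\<omega>\<close> and for enumerating all \<open>m\<close>-tuples of vertices.
\<close>

section \<open>Executions of random access machines\<close>

text \<open>\<open>mm_omega\<close> is an infimum over straight-line programs that may differ for
  every size and need not attain it, whereas the machine needs one finite program. A single size d,
  fixed before n, resolves this: its program is hardwired, and tensor powers reach the larger sizes.
  Only a number is wanted, so the trilinear form suffices: the three matrices are transformed
  separately and one sum of products remains. Rational coefficients must be fitted to a machine with
  natural numbers: clearing denominators scales the result by a known power of N, and signs are
  handled modulo a number above the scaled count. The hypothesis on \<alpha> enters through \<alpha>
  (m - 1) \<le> 2/3. It makes s - \<alpha> (s choose 2) nonnegative and increasing for s \<le> m,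
  which controls every overlap of cliques, and it gives \<mu> \<ge> 2m/3, so that n^m steps of
  enumeration fit into the bound because \<omega> \<ge> 2. No single moment yields superpolynomial
  decay: each power n^(-a) uses its own moment q, with a factor depending on q but not on n.\<close>

definition Exec :: "program \<Rightarrow> ram_state \<Rightarrow> ram_state \<Rightarrow> nat \<Rightarrow> bool" where
  "Exec P s s' c \<longleftrightarrow> (\<exists>m. \<forall>ps t. \<exists>c'\<le>c. run_steps m (P # ps, s, t) = return_pmf (ps, s', t + c'))"

lemma run_steps_add: "run_steps (a + b) C = bind_pmf (run_steps a C) (run_steps b)"
proof (induction a arbitrary: C)
  case (Suc a)
  have "run_steps (a + b) = (\<lambda>C. bind_pmf (run_steps a C) (run_steps b))"
    using Suc by (intro ext)
  then show ?case by (simp add: bind_assoc_pmf)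
qed (simp add: bind_return_pmf)

lemma run_steps_halted: "run_steps m ([], s, t) = return_pmf ([], s, t)"
  by (induction m) (simp_all add: bind_return_pmf)

lemma Exec_mono: "Exec P s s' c \<Longrightarrow> c \<le> d \<Longrightarrow> Exec P s s' d"
  unfolding Exec_def by (meson order_trans)

lemma Exec_instr:
  assumes "exec_instr i s = return_pmf s'" "instr_cost i s \<le> c"
  shows "Exec (Instr i) s s' c"
  unfolding Exec_def by (rule exI[of _ 1]) (use assms in \<open>auto simp: bind_return_pmf bind_return_pmf'\<close>)

text \<open>\<open>Seq\<close> and a loop whose test succeeds both push two programs on the stack,
  so one rule serves both. Executions compose because \<open>Exec\<close> holds for every rest
  \<open>ps\<close> of the stack and every time \<open>t\<close> already spent, with one number of
  machine steps for all of them.\<close>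

lemma Exec_step2:
  assumes step: "\<And>ps t. step (P # ps, s, t) = return_pmf (p # q # ps, s, t + k)"
    and "Exec p s s1 c1" "Exec q s1 s2 c2" "k + c1 + c2 \<le> c"
  shows "Exec P s s2 c"
proof -
  obtain m1 where m1: "\<And>ps t. \<exists>c'\<le>c1. run_steps m1 (p # ps, s, t) = return_pmf (ps, s1, t + c')"
    using assms(2) unfolding Exec_def by blast
  obtain m2 where m2: "\<And>ps t. \<exists>c'\<le>c2. run_steps m2 (q # ps, s1, t) = return_pmf (ps, s2, t + c')"
    using assms(3) unfolding Exec_def by blast
  show ?thesis unfolding Exec_def
  proof (rule exI[of _ "Suc (m1 + m2)"], intro allI)
    fix ps t
    obtain d1 where d1: "d1 \<le> c1" "run_steps m1 (p # q # ps, s, t + k) = return_pmf (q # ps, s1, t + k + d1)"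
      using m1 by blast
    obtain d2 where d2: "d2 \<le> c2" "run_steps m2 (q # ps, s1, t + k + d1) = return_pmf (ps, s2, t + k + d1 + d2)"
      using m2 by blast
    have "run_steps (Suc (m1 + m2)) (P # ps, s, t) = return_pmf (ps, s2, t + (k + d1 + d2))"
      using d1(2) d2(2) by (simp add: step run_steps_add bind_return_pmf add.assoc)
    moreover have "k + d1 + d2 \<le> c" using d1(1) d2(1) assms(4) by linarith
    ultimately show "\<exists>c'\<le>c. run_steps (Suc (m1 + m2)) (P # ps, s, t) = return_pmf (ps, s2, t + c')"
      by blast
  qed
qed

lemma Exec_Seq:
  "Exec p s s1 c1 \<Longrightarrow> Exec q s1 s2 c2 \<Longrightarrow> 1 + c1 + c2 \<le> c \<Longrightarrow> Exec (Seq p q) s s2 c"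
  by (rule Exec_step2[where k = 1]) auto

lemma Exec_While_True:
  assumes "fst s x \<noteq> 0" "Exec p s s1 c1" "Exec (While_Nonzero x p) s1 s2 c2"
    and "1 + bits (fst s x) + c1 + c2 \<le> c"
  shows "Exec (While_Nonzero x p) s s2 c"
  by (rule Exec_step2[OF _ assms(2-4)]) (use assms(1) in simp)

lemma Exec_While_False:
  assumes "fst s x = 0" "1 \<le> c"
  shows "Exec (While_Nonzero x p) s s c"
  unfolding Exec_def
  by (rule exI[of _ 1]) (use assms in \<open>auto simp: bind_return_pmf bind_return_pmf' floorlog_def\<close>)

lemma Exec_runs_in_time:
  assumes "Exec P s s' c"
  shows "runs_in_time P s c"
proof -
  obtain m c' where "c' \<le> c" "run_steps m ([P], s, 0) = return_pmf ([], s', c')"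
    using assms unfolding Exec_def by (metis add_0)
  then show ?thesis unfolding runs_in_time_def by (intro exI[of _ m]) auto
qed

text \<open>\<open>output_pmf\<close> runs up to the least halting time, \<open>Exec\<close> up to
  some other one. The two agree because a halted configuration never changes again.\<close>

lemma Exec_output_pmf:
  assumes "Exec P s s' c"
  shows "output_pmf P s = return_pmf (fst s' 0)"
proof -
  obtain m c' where m: "run_steps m ([P], s, 0) = return_pmf ([], s', c')"
    using assms unfolding Exec_def by (metis add_0)
  then have h: "halted_after P s m" unfolding halted_after_def by simp
  define l where "l = (LEAST m. halted_after P s m)"
  have hl: "halted_after P s l" unfolding l_def using h by (rule LeastI)
  have "l \<le> m" unfolding l_def using h by (rule Least_le)
  then have "return_pmf ([], s', c') = bind_pmf (run_steps l ([P], s, 0)) (run_steps (m - l))"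
    using m run_steps_add[of l "m - l" "([P], s, 0)"] by simp
  also have "\<dots> = bind_pmf (run_steps l ([P], s, 0)) return_pmf"
  proof (rule bind_pmf_cong[OF refl])
    fix C assume "C \<in> set_pmf (run_steps l ([P], s, 0))"
    with hl have "fst C = []" unfolding halted_after_def by auto
    then show "run_steps (m - l) C = return_pmf C" by (cases C) (simp add: run_steps_halted)
  qed
  finally have "run_steps l ([P], s, 0) = return_pmf ([], s', c')" by (simp add: bind_return_pmf')
  then show ?thesis unfolding output_pmf_def l_def[symmetric] by (simp add: case_prod_beta)
qed

section \<open>A language of counting loops\<close>

datatype expr = Num nat | Var nat | Op ram_op expr expr | Mem expr

text \<open>There are neither conditionals nor unbounded loops. The bound of a \<open>For\<close> is
  evaluated once, on entry, so \<open>sem\<close> is a total function and termination needs no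
  argument; tests become arithmetic in the expressions.\<close>

datatype stmt = Assign nat expr | Write expr expr | Then stmt stmt | For nat expr stmt

primrec eval :: "expr \<Rightarrow> ram_state \<Rightarrow> nat" where
  "eval (Num a) s = a"
| "eval (Var v) s = fst s v"
| "eval (Op f d e) s = ram_op_val f (eval d s) (eval e s)"
| "eval (Mem e) s = snd s (eval e s)"

primrec iterate :: "nat \<Rightarrow> (nat \<Rightarrow> 'a \<Rightarrow> 'a) \<Rightarrow> 'a \<Rightarrow> 'a" where
  "iterate 0 f s = s"
| "iterate (Suc n) f s = f n (iterate n f s)"

definition set_var :: "nat \<Rightarrow> nat \<Rightarrow> ram_state \<Rightarrow> ram_state" where
  "set_var v a s = ((fst s)(v := a), snd s)"

primrec sem :: "stmt \<Rightarrow> ram_state \<Rightarrow> ram_state" where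
  "sem (Assign v e) s = set_var v (eval e s) s"
| "sem (Write d e) s = (fst s, (snd s)(eval d s := eval e s))"
| "sem (Then c d) s = sem d (sem c s)"
| "sem (For v e c) s = iterate (eval e s) (\<lambda>i s. sem c (set_var v i s)) s"

text \<open>A constant counts with its value, so that the value of an expression is at most a bound of
  the state to the power of the size.\<close>

primrec weight :: "expr \<Rightarrow> nat" where
  "weight (Num a) = a + 1"
| "weight (Var v) = 1"
| "weight (Op f d e) = weight d + weight e + 1"
| "weight (Mem e) = weight e + 1"

text \<open>The cost in units of \<open>bits b\<close>, where \<open>b\<close> bounds all stored
  numbers. It is quadratic in the weight because each operation inside an expression works on values
  whose bit length can itself be proportional to the weight.\<close>

primrec work :: "stmt \<Rightarrow> ram_state \<Rightarrow> nat" where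
  "work (Assign v e) s = 5 * (weight e)\<^sup>2 + 5"
| "work (Write d e) s = 5 * (weight d + weight e + 1)\<^sup>2"
| "work (Then c d) s = work c s + work d (sem c s) + 1"
| "work (For v e c) s = 5 * (weight e)\<^sup>2 + 10 +
     (\<Sum>i<eval e s. 20 + work c (set_var v i (iterate i (\<lambda>i s. sem c (set_var v i s)) s)))"

text \<open>Only stored values and loop bounds are restricted. Intermediate values and addresses may
  exceed \<open>b\<close>; \<open>eval_le\<close> controls them.\<close>

primrec writes_below :: "nat \<Rightarrow> stmt \<Rightarrow> ram_state \<Rightarrow> bool" where
  "writes_below b (Assign v e) s \<longleftrightarrow> eval e s \<le> b"
| "writes_below b (Write d e) s \<longleftrightarrow> eval e s \<le> b"
| "writes_below b (Then c d) s \<longleftrightarrow> writes_below b c s \<and> writes_below b d (sem c s)"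
| "writes_below b (For v e c) s \<longleftrightarrow> eval e s \<le> b \<and>
     (\<forall>i<eval e s. writes_below b c (set_var v i (iterate i (\<lambda>i s. sem c (set_var v i s)) s)))"

definition state_below :: "nat \<Rightarrow> ram_state \<Rightarrow> bool" where
  "state_below b s \<longleftrightarrow> (\<forall>x. fst s x \<le> b) \<and> (\<forall>a. snd s a \<le> b)"

primrec expr_vars :: "expr \<Rightarrow> nat set" where
  "expr_vars (Num a) = {}"
| "expr_vars (Var v) = {v}"
| "expr_vars (Op f d e) = expr_vars d \<union> expr_vars e"
| "expr_vars (Mem e) = expr_vars e"

primrec stmt_vars :: "stmt \<Rightarrow> nat set" where
  "stmt_vars (Assign v e) = insert v (expr_vars e)"
| "stmt_vars (Write d e) = expr_vars d \<union> expr_vars e"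
| "stmt_vars (Then c d) = stmt_vars c \<union> stmt_vars d"
| "stmt_vars (For v e c) = insert v (expr_vars e \<union> stmt_vars c)"

text \<open>The machine has no move instruction, so a variable is copied by adding it to a cleared
  register.\<close>

primrec compile_expr :: "nat \<Rightarrow> expr \<Rightarrow> program" where
  "compile_expr d (Num a) = Instr (Set_Const d a)"
| "compile_expr d (Var v) = Seq (Instr (Set_Const d 0)) (Instr (Compute d Add v d))"
| "compile_expr d (Op f e e') =
     Seq (compile_expr d e) (Seq (compile_expr (d + 1) e') (Instr (Compute d f d (d + 1))))"
| "compile_expr d (Mem e) = Seq (compile_expr d e) (Instr (Load d d))"

text \<open>The variables live in the registers below \<open>d\<close>; the registers from \<open>d\<close> on are a stack
  of temporaries.\<close>

primrec compile :: "nat \<Rightarrow> stmt \<Rightarrow> program" where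
  "compile d (Assign v e) = Seq (compile_expr d e) (Seq (Instr (Set_Const v 0)) (Instr (Compute v Add v d)))"
| "compile d (Write e e') = Seq (compile_expr d e) (Seq (compile_expr (d + 1) e') (Instr (Store d (d + 1))))"
| "compile d (Then p q) = Seq (compile d p) (compile d q)"
| "compile d (For v e p) =
     Seq (compile_expr d e) (Seq (Instr (Set_Const (d + 1) 0)) (Seq (Instr (Compute (d + 2) Sub d (d + 1)))
       (While_Nonzero (d + 2)
         (Seq (Instr (Set_Const v 0)) (Seq (Instr (Compute v Add v (d + 1))) (Seq (compile (d + 3) p)
           (Seq (Instr (Set_Const (d + 2) 1)) (Seq (Instr (Compute (d + 1) Add (d + 1) (d + 2)))
             (Instr (Compute (d + 2) Sub d (d + 1)))))))))))"

section \<open>Correctness and logarithmic cost of compiled statements\<close>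

lemma bits_le_iff: "bits x \<le> k \<longleftrightarrow> x < 2 ^ k"
  by (simp add: floorlog_le_iff)

lemma bits_mono: "x \<le> y \<Longrightarrow> bits x \<le> bits y"
  by (rule floorlog_mono)

lemma bits_power_le: "bits (b ^ N) \<le> N * bits b + 1"
proof -
  have "b < 2 ^ bits b" using bits_le_iff[of b "bits b"] by simp
  then have "b ^ N \<le> (2 ^ bits b) ^ N" by (intro power_mono) auto
  also have "\<dots> = 2 ^ (N * bits b)" by (simp add: power_mult[symmetric] mult.commute)
  also have "\<dots> < 2 ^ (N * bits b + 1)" by simp
  finally show ?thesis by (simp only: bits_le_iff)
qed

text \<open>For positive x and y and \<open>2 \<le> b\<close>, both x + y and x * y are at most b *
  x * y; the extra factor b is the 1 that an operation adds to the weight. A memory access returns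
  at most \<open>b\<close> whatever its address is.\<close>

lemma eval_le:
  assumes "state_below b s" "2 \<le> b"
  shows "eval e s \<le> b ^ weight e"
proof (induction e)
  case (Num a)
  have "a \<le> 2 ^ (a + 1)" by (metis less_exp less_imp_le less_trans lessI Suc_eq_plus1)
  also have "\<dots> \<le> b ^ (a + 1)" using assms(2) by (intro power_mono) auto
  finally show ?case by simp
next
  case (Var v)
  then show ?case using assms by (simp add: state_below_def)
next
  case (Op f d e)
  let ?x = "b ^ weight d" and ?y = "b ^ weight e"
  have 1: "?x \<ge> 1" "?y \<ge> 1" using assms(2) by auto
  then have "?x + ?y \<le> 2 * (?x * ?y)"
    by (metis add_mono mult_2 mult_le_mono mult_1 mult_1_right le_refl)
  also have "\<dots> \<le> b * (?x * ?y)" using assms(2) by simp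
  finally have 2: "?x + ?y \<le> b * (?x * ?y)" .
  have 3: "?x * ?y \<le> b * (?x * ?y)" using assms(2) by simp
  have "ram_op_val f (eval d s) (eval e s) \<le> b * (?x * ?y)"
  proof (cases f)
    case Add then show ?thesis using Op.IH 2 by simp
  next
    case Sub then show ?thesis using Op.IH 2 by simp
  next
    case Mul then show ?thesis using mult_le_mono[OF Op.IH] order_trans[OF _ 3] by simp
  next
    case Div
    have "eval d s div eval e s \<le> eval d s" by simp
    then show ?thesis using Op.IH 2 Div by (simp del: div_le_dividend)
  qed
  then show ?case by (simp add: power_add mult.assoc mult.left_commute)
next
  case (Mem e)
  have "snd s (eval e s) \<le> b ^ 1" using assms by (simp add: state_below_def)
  also have "\<dots> \<le> b ^ (weight e + 1)" using assms(2) by (intro power_increasing) auto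
  finally show ?case by simp
qed

lemma bits_ge_2: "2 \<le> b \<Longrightarrow> 2 \<le> bits b"
  using bits_mono[of 2 b] by (simp add: floorlog_eq_if[of 2 2 2] compute_floorlog)

lemma bits_eval_le:
  assumes "state_below b s" "2 \<le> b"
  shows "bits (eval e s) \<le> weight e * bits b + 1"
  using bits_mono[OF eval_le[OF assms]] bits_power_le by (rule order_trans)

lemma bits_simps: "bits 0 = 0" "bits (Suc 0) = 1"
  by (simp_all add: floorlog_def)

lemma Exec_compile_expr:
  assumes "expr_vars e \<subseteq> {..<nv}" "nv \<le> d" "\<forall>x<nv. R x = fst s x" "state_below b s" "2 \<le> b"
  shows "\<exists>R'. Exec (compile_expr d e) (R, snd s) (R', snd s) (5 * (weight e)\<^sup>2 * bits b) \<and>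
    (\<forall>x<d. R' x = R x) \<and> R' d = eval e s"
  using assms(1,2,3)
proof (induction e arbitrary: d R)
  case (Num a)
  have "1 + bits a \<le> 5 * (a + 1)\<^sup>2 * bits b"
  proof -
    have "bits a \<le> (a + 1) * bits b + 1" using bits_eval_le[OF assms(4,5), of "Num a"] by simp
    moreover have "(a + 1) * bits b \<le> (a + 1)\<^sup>2 * bits b"
      by (intro mult_right_mono) (auto simp: power2_eq_square)
    moreover have "2 \<le> (a + 1)\<^sup>2 * bits b"
      using bits_ge_2[OF assms(5)] by (metis add.commute add_leD1 le_add1 mult.commute mult_le_mono nat_mult_1_right one_le_power)
    ultimately show ?thesis by linarith
  qed
  then have "Exec (compile_expr d (Num a)) (R, snd s) (R(d := a), snd s) (5 * (weight (Num a))\<^sup>2 * bits b)"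
    by (auto intro: Exec_instr)
  then show ?case by (intro exI[of _ "R(d := a)"]) (auto simp: fun_upd_def)
next
  case (Var v)
  have v: "v < d" "R v = fst s v" using Var by auto
  have "bits (R v) \<le> bits b" using v(2) assms(4) by (intro bits_mono) (auto simp: state_below_def)
  then have "Exec (compile_expr d (Var v)) (R, snd s) (R(d := R v), snd s) (5 * (weight (Var v))\<^sup>2 * bits b)"
    unfolding compile_expr.simps using v(1) bits_ge_2[OF assms(5)]
    by (intro Exec_Seq[of _ _ _ 1 _ _ "1 + bits (R v)"] Exec_instr) (auto simp: bits_simps)
  then show ?case using v by (intro exI[of _ "R(d := R v)"]) (auto simp: fun_upd_def)
next
  case (Op f e1 e2)
  let ?B = "bits b" and ?c1 = "5 * (weight e1)\<^sup>2 * bits b" and ?c2 = "5 * (weight e2)\<^sup>2 * bits b"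
  obtain R1 where R1: "Exec (compile_expr d e1) (R, snd s) (R1, snd s) ?c1"
    "\<forall>x<d. R1 x = R x" "R1 d = eval e1 s" using Op.IH(1)[of d R] Op.prems by auto
  obtain R2 where R2: "Exec (compile_expr (d + 1) e2) (R1, snd s) (R2, snd s) ?c2"
    "\<forall>x<d + 1. R2 x = R1 x" "R2 (d + 1) = eval e2 s"
    using Op.IH(2)[of "d + 1" R1] Op.prems R1(2) by auto
  let ?R3 = "R2(d := ram_op_val f (eval e1 s) (eval e2 s))"
  let ?c3 = "1 + (weight e1 * ?B + 1) + (weight e2 * ?B + 1)"
  have *: "bits (eval e1 s) \<le> weight e1 * ?B + 1" "bits (eval e2 s) \<le> weight e2 * ?B + 1"
    using bits_eval_le[OF assms(4,5)] by auto
  have 3: "Exec (Instr (Compute d f d (d + 1))) (R2, snd s) (?R3, snd s) ?c3"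
    by (rule Exec_instr) (use R1 R2 * in auto)
  \<comment> \<open>Expanding the square leaves, beside the costs of the two operands, terms linear
    in each weight; they pay for the bit lengths in the last instruction.\<close>
  have "1 + ?c1 + (1 + ?c2 + ?c3) \<le> 5 * (weight e1 + weight e2 + 1)\<^sup>2 * ?B"
  proof -
    have "5 * (weight e1 + weight e2 + 1)\<^sup>2 * ?B = ?c1 + ?c2 + 5 * ?B + 10 * (weight e1 * weight e2 * ?B)
      + 10 * (weight e1 * ?B) + 10 * (weight e2 * ?B)"
      by (simp add: power2_eq_square algebra_simps)
    then show ?thesis using bits_ge_2[OF assms(5)] by linarith
  qed
  then have "Exec (compile_expr d (Op f e1 e2)) (R, snd s) (?R3, snd s) (5 * (weight (Op f e1 e2))\<^sup>2 * ?B)"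
    unfolding compile_expr.simps weight.simps by (intro Exec_Seq[OF R1(1) Exec_Seq[OF R2(1) 3 order_refl]])
  then show ?case using R1 R2 by (intro exI[of _ ?R3]) (auto simp: fun_upd_def)
next
  case (Mem e)
  let ?B = "bits b"
  obtain R1 where R1: "Exec (compile_expr d e) (R, snd s) (R1, snd s) (5 * (weight e)\<^sup>2 * ?B)"
    "\<forall>x<d. R1 x = R x" "R1 d = eval e s" using Mem.IH[of d R] Mem.prems by auto
  let ?R2 = "R1(d := snd s (eval e s))" and ?c = "1 + (weight e * ?B + 1) + ?B"
  have "bits (snd s (eval e s)) \<le> ?B" using assms(4) by (intro bits_mono) (auto simp: state_below_def)
  then have 2: "Exec (Instr (Load d d)) (R1, snd s) (?R2, snd s) ?c"
    using bits_eval_le[OF assms(4,5), of e] R1 by (intro Exec_instr) auto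
  have "1 + 5 * (weight e)\<^sup>2 * ?B + ?c \<le> 5 * (weight e + 1)\<^sup>2 * ?B"
  proof -
    have "5 * (weight e + 1)\<^sup>2 * ?B = 5 * (weight e)\<^sup>2 * ?B + 10 * (weight e * ?B) + 5 * ?B"
      by (simp add: power2_eq_square algebra_simps)
    then show ?thesis using bits_ge_2[OF assms(5)] by linarith
  qed
  then have "Exec (compile_expr d (Mem e)) (R, snd s) (?R2, snd s) (5 * (weight (Mem e))\<^sup>2 * ?B)"
    unfolding compile_expr.simps weight.simps by (intro Exec_Seq[OF R1(1) 2])
  then show ?case using R1 by (intro exI[of _ ?R2]) (auto simp: fun_upd_def)
qed

lemma state_below_set_var: "state_below b s \<Longrightarrow> a \<le> b \<Longrightarrow> state_below b (set_var v a s)"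
  by (auto simp: state_below_def set_var_def)

lemma state_below_sem:
  assumes "writes_below b c s" "state_below b s"
  shows "state_below b (sem c s)"
  using assms
proof (induction c arbitrary: s)
  case (For v e c)
  let ?f = "\<lambda>i s. sem c (set_var v i s)"
  have "i \<le> eval e s \<Longrightarrow> state_below b (iterate i ?f s)" for i
  proof (induction i)
    case (Suc i)
    have "state_below b (set_var v i (iterate i ?f s))"
      using Suc For.prems by (intro state_below_set_var) auto
    then show ?case using For.IH For.prems(1) Suc.prems by auto
  qed (use For.prems in simp)
  then show ?case by simp
qed (auto simp: state_below_def set_var_def)

text \<open>The registers from \<open>nv\<close> up to \<open>d\<close> hold the loop control of the
  enclosing \<open>For\<close> statements. That they survive is what lets the induction pass through
  nested loops.\<close>

lemma Exec_compile:
  assumes "stmt_vars c \<subseteq> {..<nv}" "nv \<le> d" "\<forall>x<nv. R x = fst s x" "state_below b s" "2 \<le> b"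
    "writes_below b c s"
  shows "\<exists>R'. Exec (compile d c) (R, snd s) (R', snd (sem c s)) (work c s * bits b) \<and>
    (\<forall>x<nv. R' x = fst (sem c s) x) \<and> (\<forall>x. nv \<le> x \<and> x < d \<longrightarrow> R' x = R x)"
  using assms
proof (induction c arbitrary: d R s)
  case (Assign v e)
  let ?B = "bits b"
  have v: "v < d" "v < nv" using Assign.prems by auto
  obtain R1 where R1: "Exec (compile_expr d e) (R, snd s) (R1, snd s) (5 * (weight e)\<^sup>2 * ?B)"
    "\<forall>x<d. R1 x = R x" "R1 d = eval e s" using Exec_compile_expr[of e nv d R s b] Assign.prems by auto
  have "bits (eval e s) \<le> ?B" using Assign.prems by (intro bits_mono) auto
  then have 2: "Exec (Seq (Instr (Set_Const v 0)) (Instr (Compute v Add v d))) (R1, snd s)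
      (R1(v := eval e s), snd s) (1 + 1 + (1 + ?B))"
    using v(1) R1(3) by (intro Exec_Seq[OF Exec_instr Exec_instr order_refl]) (auto simp: bits_simps)
  have "1 + 5 * (weight e)\<^sup>2 * ?B + (1 + 1 + (1 + ?B)) \<le> work (Assign v e) s * ?B"
    using bits_ge_2[OF \<open>2 \<le> b\<close>] by (simp add: algebra_simps)
  then have "Exec (compile d (Assign v e)) (R, snd s) (R1(v := eval e s), snd s) (work (Assign v e) s * ?B)"
    unfolding compile.simps by (intro Exec_Seq[OF R1(1) 2])
  then show ?case using R1(2) v Assign.prems
    by (intro exI[of _ "R1(v := eval e s)"]) (auto simp: set_var_def fun_upd_def)
next
  case (Write e1 e2)
  let ?B = "bits b" and ?c1 = "5 * (weight e1)\<^sup>2 * bits b" and ?c2 = "5 * (weight e2)\<^sup>2 * bits b"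
  obtain R1 where R1: "Exec (compile_expr d e1) (R, snd s) (R1, snd s) ?c1"
    "\<forall>x<d. R1 x = R x" "R1 d = eval e1 s" using Exec_compile_expr[of e1 nv d R s b] Write.prems by auto
  obtain R2 where R2: "Exec (compile_expr (d + 1) e2) (R1, snd s) (R2, snd s) ?c2"
    "\<forall>x<d + 1. R2 x = R1 x" "R2 (d + 1) = eval e2 s"
    using Exec_compile_expr[of e2 nv "d + 1" R1 s b] Write.prems R1(2) by auto
  let ?c3 = "1 + (weight e1 * ?B + 1) + (weight e2 * ?B + 1)"
  have 3: "Exec (Instr (Store d (d + 1))) (R2, snd s) (R2, snd (sem (Write e1 e2) s)) ?c3"
    using R1 R2 bits_eval_le[OF \<open>state_below b s\<close> \<open>2 \<le> b\<close>, of e1]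
      bits_eval_le[OF \<open>state_below b s\<close> \<open>2 \<le> b\<close>, of e2] by (intro Exec_instr) auto
  have "1 + ?c1 + (1 + ?c2 + ?c3) \<le> 5 * (weight e1 + weight e2 + 1)\<^sup>2 * ?B"
  proof -
    have "5 * (weight e1 + weight e2 + 1)\<^sup>2 * ?B = ?c1 + ?c2 + 5 * ?B + 10 * (weight e1 * weight e2 * ?B)
      + 10 * (weight e1 * ?B) + 10 * (weight e2 * ?B)"
      by (simp add: power2_eq_square algebra_simps)
    then show ?thesis using bits_ge_2[OF \<open>2 \<le> b\<close>] by linarith
  qed
  then have "Exec (compile d (Write e1 e2)) (R, snd s) (R2, snd (sem (Write e1 e2) s)) (work (Write e1 e2) s * ?B)"
    unfolding compile.simps work.simps by (intro Exec_Seq[OF R1(1) Exec_Seq[OF R2(1) 3 order_refl]])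
  then show ?case using R1 R2 Write.prems by (intro exI[of _ R2]) (auto simp: fun_upd_def)
next
  case (Then p q)
  let ?B = "bits b"
  obtain R1 where R1: "Exec (compile d p) (R, snd s) (R1, snd (sem p s)) (work p s * ?B)"
    "\<forall>x<nv. R1 x = fst (sem p s) x" "\<forall>x. nv \<le> x \<and> x < d \<longrightarrow> R1 x = R x"
    using Then.IH(1)[of d R s] Then.prems by auto
  obtain R2 where R2: "Exec (compile d q) (R1, snd (sem p s)) (R2, snd (sem q (sem p s))) (work q (sem p s) * ?B)"
    "\<forall>x<nv. R2 x = fst (sem q (sem p s)) x" "\<forall>x. nv \<le> x \<and> x < d \<longrightarrow> R2 x = R1 x"
    using Then.IH(2)[of d R1 "sem p s"] Then.prems R1 state_below_sem[of b p s] by auto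
  have "Exec (compile d (Then p q)) (R, snd s) (R2, snd (sem (Then p q) s)) (work (Then p q) s * ?B)"
    unfolding compile.simps sem.simps using bits_ge_2[OF \<open>2 \<le> b\<close>]
    by (intro Exec_Seq[OF R1(1) R2(1)]) (simp add: algebra_simps)
  then show ?case using R1 R2 by (intro exI[of _ R2]) auto
next
  case (For v e c)
  let ?B = "bits b" and ?N = "eval e s" and ?f = "\<lambda>i s. sem c (set_var v i s)"
  define st where "st i = iterate i ?f s" for i
  define body where "body = (Seq (Instr (Set_Const v 0)) (Seq (Instr (Compute v Add v (d + 1))) (Seq (compile (d + 3) c)
           (Seq (Instr (Set_Const (d + 2) 1)) (Seq (Instr (Compute (d + 1) Add (d + 1) (d + 2)))
             (Instr (Compute (d + 2) Sub d (d + 1))))))))"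
  define wk where "wk i = 20 + work c (set_var v i (st i))" for i
  have v: "v < d" "v < nv" and cv: "stmt_vars c \<subseteq> {..<nv}" using For.prems by auto
  have N: "?N \<le> b" using For.prems by simp
  have B: "?B \<ge> 2" using bits_ge_2[OF \<open>2 \<le> b\<close>] .
  have st_Suc: "st (Suc i) = sem c (set_var v i (st i))" for i by (simp add: st_def)
  have wb: "i < ?N \<Longrightarrow> writes_below b c (set_var v i (st i))" for i
    using For.prems by (simp add: st_def)
  have sb: "i \<le> ?N \<Longrightarrow> state_below b (st i)" for i
  proof (induction i)
    case (Suc i)
    then show ?case unfolding st_Suc using wb N by (intro state_below_sem state_below_set_var) auto
  qed (use For.prems in \<open>simp add: st_def\<close>)
  \<comment> \<open>Register \<open>d\<close> keeps the loop bound, \<open>d + 1\<close> the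
    counter, and \<open>d + 2\<close> the number of rounds left, which is what
    \<open>While_Nonzero\<close> tests. The body works from \<open>d + 3\<close> on;
    \<open>d + 2\<close> is also borrowed for the constant 1 when the counter is advanced, and then
    recomputed.\<close>
  define good where "good R i \<longleftrightarrow> (\<forall>x<nv. R x = fst (st i) x) \<and> R d = ?N \<and> R (d + 1) = i \<and> R (d + 2) = ?N - i"
    for R i
  have iter: "\<exists>R'. Exec body (R, snd (st i)) (R', snd (st (Suc i))) ((15 + work c (set_var v i (st i))) * ?B)
    \<and> good R' (Suc i) \<and> (\<forall>x. nv \<le> x \<and> x < d \<longrightarrow> R' x = R x)"
    if i: "i < ?N" and g: "good R i" for R i
  proof -
    let ?s = "set_var v i (st i)" and ?R1 = "R(v := 0)" and ?R2 = "R(v := i)"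
    have vs: "v \<noteq> d" "v \<noteq> d + 1" "v \<noteq> d + 2" using v by auto
    have sm: "snd ?s = snd (st i)" by (simp add: set_var_def)
    have bi: "bits i \<le> ?B" "bits (i + 1) \<le> ?B" "bits ?N \<le> ?B" using i N by (auto intro!: bits_mono)
    obtain R3 where R3: "Exec (compile (d + 3) c) (?R2, snd ?s) (R3, snd (sem c ?s)) (work c ?s * ?B)"
      "\<forall>x<nv. R3 x = fst (sem c ?s) x" "\<forall>x. nv \<le> x \<and> x < d + 3 \<longrightarrow> R3 x = ?R2 x"
    proof -
      have "\<forall>x<nv. ?R2 x = fst ?s x" using g by (auto simp: good_def set_var_def)
      moreover have "state_below b ?s" using i N sb[of i] by (intro state_below_set_var) auto
      ultimately show ?thesis
        using For.IH[of "d + 3" ?R2 ?s] cv For.prems(2,5) wb[OF i] that by (auto simp: fun_upd_def)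
    qed
    have d3: "R3 d = ?N" "R3 (d + 1) = i"
      using R3(3)[rule_format, of d] R3(3)[rule_format, of "d + 1"] vs g For.prems(2) by (auto simp: good_def)
    let ?R4 = "R3(d + 2 := 1)" let ?R5 = "?R4(d + 1 := i + 1)" let ?R6 = "?R5(d + 2 := ?N - (i + 1))"
    let ?M = "snd (st (Suc i))"
    have M: "snd (sem c ?s) = ?M" by (simp add: st_Suc)
    have e1: "Exec (Instr (Set_Const v 0)) (R, snd (st i)) (?R1, snd (st i)) 1"
      by (rule Exec_instr) (auto simp: bits_simps)
    have e2: "Exec (Instr (Compute v Add v (d + 1))) (?R1, snd (st i)) (?R2, snd (st i)) (1 + ?B)"
      by (rule Exec_instr) (use g vs bi in \<open>auto simp: bits_simps good_def\<close>)
    have e4: "Exec (Instr (Set_Const (d + 2) 1)) (R3, ?M) (?R4, ?M) 2"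
      by (rule Exec_instr) (auto simp: bits_simps)
    have e5: "Exec (Instr (Compute (d + 1) Add (d + 1) (d + 2))) (?R4, ?M) (?R5, ?M) (2 + ?B)"
      by (rule Exec_instr) (use d3 bi in \<open>auto simp: bits_simps\<close>)
    have e6: "Exec (Instr (Compute (d + 2) Sub d (d + 1))) (?R5, ?M) (?R6, ?M) (1 + ?B + ?B)"
      by (rule Exec_instr) (use d3 bi in \<open>auto simp: bits_simps\<close>)
    have "Exec body (R, snd (st i)) (?R6, ?M) (1 + 1 + (1 + (1 + ?B) + (1 + work c ?s * ?B + (1 + 2 + (1 + (2 + ?B) + (1 + ?B + ?B))))))"
      unfolding body_def
      by (rule Exec_Seq[OF e1 Exec_Seq[OF e2 Exec_Seq[OF R3(1)[unfolded sm M] Exec_Seq[OF e4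
        Exec_Seq[OF e5 e6 order_refl] order_refl] order_refl] order_refl] order_refl])
    then have "Exec body (R, snd (st i)) (?R6, ?M) ((15 + work c ?s) * ?B)"
      by (rule Exec_mono) (use B in \<open>simp add: algebra_simps\<close>)
    moreover have "good ?R6 (Suc i)" using R3(2) d3 For.prems(2) by (auto simp: good_def st_Suc)
    moreover have "\<forall>x. nv \<le> x \<and> x < d \<longrightarrow> ?R6 x = R x" using R3(3) v by auto
    ultimately show ?thesis by blast
  qed
  have loop: "i \<le> ?N \<Longrightarrow> good R i \<Longrightarrow> \<exists>R'. Exec (While_Nonzero (d + 2) body) (R, snd (st i)) (R', snd (st ?N)) (1 + (\<Sum>j\<in>{i..<?N}. wk j * ?B))
      \<and> good R' ?N \<and> (\<forall>x. nv \<le> x \<and> x < d \<longrightarrow> R' x = R x)" for R i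
  proof (induction "?N - i" arbitrary: i R)
    case 0
    then have "i = ?N" by simp
    then show ?case using 0 by (intro exI[of _ R]) (auto simp: good_def intro!: Exec_While_False)
  next
    case (Suc l)
    then have i: "i < ?N" by simp
    obtain R1 where R1: "Exec body (R, snd (st i)) (R1, snd (st (Suc i))) ((15 + work c (set_var v i (st i))) * ?B)"
      "good R1 (Suc i)" "\<forall>x. nv \<le> x \<and> x < d \<longrightarrow> R1 x = R x" using iter[OF i Suc.prems(2)] by blast
    have "l = ?N - Suc i" "Suc i \<le> ?N" using Suc.hyps(2) by auto
    from Suc.hyps(1)[OF this R1(2)] obtain R2 where R2:
      "Exec (While_Nonzero (d + 2) body) (R1, snd (st (Suc i))) (R2, snd (st ?N)) (1 + (\<Sum>j\<in>{Suc i..<?N}. wk j * ?B))"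
      "good R2 ?N" "\<forall>x. nv \<le> x \<and> x < d \<longrightarrow> R2 x = R1 x" by blast
    have s: "(\<Sum>j\<in>{i..<?N}. wk j * ?B) = wk i * ?B + (\<Sum>j\<in>{Suc i..<?N}. wk j * ?B)"
      using i by (simp add: sum.atLeast_Suc_lessThan)
    have "R (d + 2) = ?N - i" using Suc.prems by (simp add: good_def)
    then have "bits (R (d + 2)) \<le> ?B" using N by (intro bits_mono) auto
    then have "1 + bits (R (d + 2)) + ((15 + work c (set_var v i (st i))) * ?B) + (1 + (\<Sum>j\<in>{Suc i..<?N}. wk j * ?B))
       \<le> 1 + (\<Sum>j\<in>{i..<?N}. wk j * ?B)"
    proof -
      have "wk i * ?B = (15 + work c (set_var v i (st i))) * ?B + 5 * ?B" by (simp add: wk_def algebra_simps)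
      then show ?thesis unfolding s using B \<open>bits (R (d + 2)) \<le> ?B\<close> by linarith
    qed
    moreover have "R (d + 2) \<noteq> 0" using \<open>R (d + 2) = ?N - i\<close> i by simp
    ultimately have "Exec (While_Nonzero (d + 2) body) (R, snd (st i)) (R2, snd (st ?N)) (1 + (\<Sum>j\<in>{i..<?N}. wk j * ?B))"
      by (intro Exec_While_True[OF _ R1(1) R2(1)]) auto
    then show ?case using R1(3) R2 by (intro exI[of _ R2]) auto
  qed
  obtain R1 where R1: "Exec (compile_expr d e) (R, snd s) (R1, snd s) (5 * (weight e)\<^sup>2 * ?B)"
    "\<forall>x<d. R1 x = R x" "R1 d = ?N" using Exec_compile_expr[of e nv d R s b] For.prems by auto
  let ?R2 = "R1(d + 1 := 0)" let ?R3 = "?R2(d + 2 := ?N)"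
  have e2: "Exec (Instr (Set_Const (d + 1) 0)) (R1, snd s) (?R2, snd s) 1"
    by (rule Exec_instr) (auto simp: bits_simps)
  have e3: "Exec (Instr (Compute (d + 2) Sub d (d + 1))) (?R2, snd s) (?R3, snd s) (1 + ?B)"
    by (rule Exec_instr) (use R1 bits_mono[OF N] in \<open>auto simp: bits_simps\<close>)
  have g: "good ?R3 0" using R1 For.prems(2,3) by (auto simp: good_def st_def)
  from loop[OF _ g] obtain R4 where R4: "Exec (While_Nonzero (d + 2) body) (?R3, snd s) (R4, snd (st ?N))
      (1 + (\<Sum>j\<in>{0..<?N}. wk j * ?B))"
      "good R4 ?N" "\<forall>x. nv \<le> x \<and> x < d \<longrightarrow> R4 x = ?R3 x" by (auto simp: st_def)
  have "1 + 5 * (weight e)\<^sup>2 * ?B + (1 + 1 + (1 + (1 + ?B) + (1 + (\<Sum>j\<in>{0..<?N}. wk j * ?B)))) \<le> work (For v e c) s * ?B"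
  proof -
    have "work (For v e c) s = 5 * (weight e)\<^sup>2 + 10 + (\<Sum>j\<in>{0..<?N}. wk j)"
      by (simp add: wk_def st_def lessThan_atLeast0)
    then have "work (For v e c) s * ?B = 5 * (weight e)\<^sup>2 * ?B + 10 * ?B + (\<Sum>j\<in>{0..<?N}. wk j * ?B)"
      by (simp add: algebra_simps sum_distrib_left)
    then show ?thesis using B by linarith
  qed
  then have "Exec (compile d (For v e c)) (R, snd s) (R4, snd (st ?N)) (work (For v e c) s * ?B)"
    unfolding compile.simps body_def[symmetric]
    by (intro Exec_Seq[OF R1(1) Exec_Seq[OF e2 Exec_Seq[OF e3 R4(1) order_refl] order_refl]])
  moreover have "st ?N = sem (For v e c) s" by (simp add: st_def)
  moreover have "\<forall>x. nv \<le> x \<and> x < d \<longrightarrow> R4 x = R x" using R4(3) R1(2) by auto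
  ultimately show ?case using R4(2) by (intro exI[of _ R4]) (auto simp: good_def)
qed

section \<open>Counting steps, and a calculus of total correctness\<close>

primrec steps :: "stmt \<Rightarrow> ram_state \<Rightarrow> nat" where
  "steps (Assign v e) s = 1"
| "steps (Write d e) s = 1"
| "steps (Then c d) s = steps c s + steps d (sem c s)"
| "steps (For v e c) s = 1 + (\<Sum>i<eval e s. 1 + steps c (set_var v i (iterate i (\<lambda>i s. sem c (set_var v i s)) s)))"

primrec stmt_weight :: "stmt \<Rightarrow> nat" where
  "stmt_weight (Assign v e) = 5 * (weight e)\<^sup>2 + 5"
| "stmt_weight (Write d e) = 5 * (weight d + weight e + 1)\<^sup>2"
| "stmt_weight (Then c d) = stmt_weight c + stmt_weight d + 1"
| "stmt_weight (For v e c) = 5 * (weight e)\<^sup>2 + 30 + stmt_weight c"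

lemma steps_pos: "1 \<le> steps c s"
  by (induction c arbitrary: s) (auto simp: add_increasing2)

text \<open>The expressions of a fixed statement have fixed weights, so their cost is a factor that
  does not depend on the input. Afterwards only \<open>steps\<close> has to be estimated.\<close>

lemma work_le_steps: "work c s \<le> stmt_weight c * steps c s"
proof (induction c arbitrary: s)
  case (Then c d)
  let ?s = "sem c s"
  have "work (Then c d) s \<le> stmt_weight c * steps c s + stmt_weight d * steps d ?s + steps c s"
    using Then.IH(1)[of s] Then.IH(2)[of ?s] steps_pos[of c s] by simp
  also have "\<dots> \<le> (stmt_weight c + stmt_weight d + 1) * (steps c s + steps d ?s)"
    by (simp add: algebra_simps)
  finally show ?case by simp
next
  case (For v e c)
  let ?st = "\<lambda>i. set_var v i (iterate i (\<lambda>i s. sem c (set_var v i s)) s)"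
  let ?w = "5 * (weight e)\<^sup>2 + 30 + stmt_weight c"
  have "(\<Sum>i<eval e s. 20 + work c (?st i)) \<le> (\<Sum>i<eval e s. ?w * (1 + steps c (?st i)))"
  proof (rule sum_mono)
    fix i
    have "work c (?st i) \<le> stmt_weight c * steps c (?st i)" by (rule For.IH)
    then show "20 + work c (?st i) \<le> ?w * (1 + steps c (?st i))" by (simp add: algebra_simps)
  qed
  also have "\<dots> = ?w * (\<Sum>i<eval e s. 1 + steps c (?st i))" by (simp only: sum_distrib_left)
  finally have "work (For v e c) s \<le> ?w + ?w * (\<Sum>i<eval e s. 1 + steps c (?st i))" by simp
  then show ?case by (simp add: distrib_left)
qed auto

lemma writes_below_mono: "writes_below b c s \<Longrightarrow> b \<le> b' \<Longrightarrow> writes_below b' c s"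
  by (induction c arbitrary: s) (auto intro: order_trans)

text \<open>Gives termination for inputs to which no explicit bound applies: counting loops perform
  finitely many writes, and any common bound will do.\<close>

lemma ex_writes_below: "\<exists>b. writes_below b c s"
proof (induction c arbitrary: s)
  case (Then c d)
  obtain b1 b2 where "writes_below b1 c s" "writes_below b2 d (sem c s)" using Then.IH by blast
  then show ?case by (intro exI[of _ "max b1 b2"]) (auto intro: writes_below_mono)
next
  case (For v e c)
  let ?st = "\<lambda>i. set_var v i (iterate i (\<lambda>i s. sem c (set_var v i s)) s)"
  have "\<forall>i. \<exists>b. writes_below b c (?st i)" using For.IH by blast
  then obtain b where b: "\<And>i. writes_below (b i) c (?st i)" by metis
  show ?case
  proof (intro exI[of _ "eval e s + (\<Sum>i<eval e s. b i)"])
    have "b i \<le> eval e s + (\<Sum>i<eval e s. b i)" if "i < eval e s" for i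
      using that member_le_sum[of i "{..<eval e s}" b] by simp
    then show "writes_below (eval e s + (\<Sum>i<eval e s. b i)) (For v e c) s"
      using writes_below_mono[OF b] by simp
  qed
qed auto

lemma compile_correct:
  assumes "stmt_vars c \<subseteq> {..<nv}" "0 < nv" "state_below b s" "2 \<le> b" "writes_below b c s"
  shows "runs_in_time (compile nv c) s (stmt_weight c * steps c s * bits b)"
    and "output_pmf (compile nv c) s = return_pmf (fst (sem c s) 0)"
proof -
  obtain R' where R: "Exec (compile nv c) s (R', snd (sem c s)) (work c s * bits b)" "R' 0 = fst (sem c s) 0"
    using Exec_compile[of c nv nv "fst s" s b] assms by auto
  have "Exec (compile nv c) s (R', snd (sem c s)) (stmt_weight c * steps c s * bits b)"
    by (rule Exec_mono[OF R(1)]) (intro mult_right_mono work_le_steps, simp)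
  then show "runs_in_time (compile nv c) s (stmt_weight c * steps c s * bits b)"
    by (rule Exec_runs_in_time)
  show "output_pmf (compile nv c) s = return_pmf (fst (sem c s) 0)"
    using Exec_output_pmf[OF R(1)] R(2) by simp
qed

text \<open>A total correctness statement for one initial state, bundled with the two quantities
  that \<open>compile_correct\<close> asks for, so that a single pass over the program proves all
  three.\<close>

definition spec :: "nat \<Rightarrow> stmt \<Rightarrow> ram_state \<Rightarrow> nat \<Rightarrow> (ram_state \<Rightarrow> bool) \<Rightarrow> bool" where
  "spec b c s T Q \<longleftrightarrow> writes_below b c s \<and> steps c s \<le> T \<and> Q (sem c s)"

lemma spec_Assign:
  "eval e s \<le> b \<Longrightarrow> 1 \<le> T \<Longrightarrow> Q (set_var v (eval e s) s) \<Longrightarrow> spec b (Assign v e) s T Q"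
  by (simp add: spec_def)

lemma spec_Write:
  "eval e s \<le> b \<Longrightarrow> 1 \<le> T \<Longrightarrow> Q (fst s, (snd s)(eval d s := eval e s)) \<Longrightarrow> spec b (Write d e) s T Q"
  by (simp add: spec_def)

lemma spec_Then:
  assumes "spec b c s T1 R" "\<And>s'. R s' \<Longrightarrow> spec b d s' T2 Q" "T1 + T2 \<le> T"
  shows "spec b (Then c d) s T Q"
  using assms(1,3) assms(2)[of "sem c s"] by (auto simp: spec_def)

lemma spec_Assign_Then:
  assumes "eval e s \<le> b" "spec b d (set_var v (eval e s) s) T2 Q" "1 + T2 \<le> T"
  shows "spec b (Then (Assign v e) d) s T Q"
  using assms by (auto simp: spec_def)

lemma spec_weaken:
  "spec b c s T Q \<Longrightarrow> T \<le> T' \<Longrightarrow> (\<And>s'. Q s' \<Longrightarrow> Q' s') \<Longrightarrow> spec b c s T' Q'"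
  by (auto simp: spec_def)

lemma spec_For:
  assumes "eval e s = n" "n \<le> b" "I 0 s"
    and body: "\<And>i s'. i < n \<Longrightarrow> I i s' \<Longrightarrow> spec b c (set_var v i s') (T i) (I (Suc i))"
    and "\<And>s'. I n s' \<Longrightarrow> Q s'" "1 + (\<Sum>i<n. 1 + T i) \<le> T'"
  shows "spec b (For v e c) s T' Q"
proof -
  let ?st = "\<lambda>i. iterate i (\<lambda>i s. sem c (set_var v i s)) s"
  have I: "i \<le> n \<Longrightarrow> I i (?st i)" for i
  proof (induction i)
    case (Suc i)
    then show ?case using body[of i "?st i"] by (simp add: spec_def)
  qed (use assms(3) in simp)
  then have b: "spec b c (set_var v i (?st i)) (T i) (I (Suc i))" if "i < n" for i
    using body[of i] that by simp
  have "(\<Sum>i<n. 1 + steps c (set_var v i (?st i))) \<le> (\<Sum>i<n. 1 + T i)"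
    using b by (intro sum_mono) (auto simp: spec_def)
  then show ?thesis using assms(1,2,5,6) I[of n] b by (auto simp: spec_def)
qed

lemma spec_For_const:
  assumes "eval e s = n" "n \<le> b" "I 0 s"
    and "\<And>i s'. i < n \<Longrightarrow> I i s' \<Longrightarrow> spec b c (set_var v i s') T (I (Suc i))"
    and "\<And>s'. I n s' \<Longrightarrow> Q s'" "1 + n * (1 + T) \<le> T'"
  shows "spec b (For v e c) s T' Q"
  by (rule spec_For[where n = n and I = I and T = "\<lambda>_. T"]) (use assms in auto)

lemma fst_set_var: "fst (set_var v a s) = (fst s)(v := a)"
  and snd_set_var: "snd (set_var v a s) = snd s"
  by (simp_all add: set_var_def)

section \<open>From straight-line programs to trilinear forms\<close>

lemma slp_vals_snoc:
  "slp_vals A B (p @ [(f, x, y)]) = slp_vals A B p @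
     [apply_op f (operand_val A B (slp_vals A B p) x) (operand_val A B (slp_vals A B p) y)]"
  by (simp add: slp_vals_def)

lemma slp_vals_Nil: "slp_vals A B [] = []"
  by (simp add: slp_vals_def)

lemma length_slp_vals [simp]: "length (slp_vals A B p) = length p"
proof (induction p rule: rev_induct)
  case (snoc q p)
  then show ?case by (cases q) (auto simp: slp_vals_snoc)
qed (simp add: slp_vals_Nil)

lemma sum_unit:
  fixes g :: "nat \<Rightarrow> nat \<Rightarrow> 'a::comm_semiring_1"
  assumes "i < n" "j < n"
  shows "(\<Sum>a<n. \<Sum>b<n. (if a = i \<and> b = j then 1 else 0) * g a b) = g i j"
proof -
  have "(\<Sum>a<n. \<Sum>b<n. (if a = i \<and> b = j then 1 else 0) * g a b) = (\<Sum>a<n. if a = i then g i j else 0)"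
  proof (rule sum.cong)
    fix a assume "a \<in> {..<n}"
    have "(\<Sum>b<n. (if a = i \<and> b = j then 1 else 0) * g a b) = (\<Sum>b<n. if b = j then (if a = i then g i j else 0) else 0)"
      by (rule sum.cong) auto
    then show "(\<Sum>b<n. (if a = i \<and> b = j then 1 else 0) * g a b) = (if a = i then g i j else 0)"
      using assms by simp
  qed simp
  then show ?thesis using assms by simp
qed

text \<open>The Frobenius inner product. With \<open>f\<close> fixed it is the general linear form
  in the entries of an n by n matrix.\<close>

definition frob :: "nat \<Rightarrow> (nat \<Rightarrow> nat \<Rightarrow> 'a::comm_semiring_1) \<Rightarrow> (nat \<Rightarrow> nat \<Rightarrow> 'a) \<Rightarrow> 'a" where
  "frob n f g = (\<Sum>i<n. \<Sum>j<n. f i j * g i j)"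

lemma frob_add_left: "frob n (\<lambda>i j. f i j + g i j) h = frob n f h + frob n g h"
  by (simp add: frob_def sum.distrib algebra_simps)

lemma frob_diff_left:
  fixes f :: "nat \<Rightarrow> nat \<Rightarrow> 'a::comm_ring_1"
  shows "frob n (\<lambda>i j. f i j - g i j) h = frob n f h - frob n g h"
  by (simp add: frob_def sum_subtractf algebra_simps)

lemma frob_scale_left: "frob n (\<lambda>i j. c * f i j) h = c * frob n f h"
  by (simp add: frob_def sum_distrib_left algebra_simps)

text \<open>A straight-line program may read entries outside the n by n block. Making them zero
  turns every entry into a linear form \<open>frob n\<close>.\<close>

definition supported :: "nat \<Rightarrow> (nat \<Rightarrow> nat \<Rightarrow> 'a::zero) \<Rightarrow> bool" where
  "supported n A \<longleftrightarrow> (\<forall>i j. n \<le> i \<or> n \<le> j \<longrightarrow> A i j = 0)"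

lemma frob_unit:
  assumes "supported n A"
  shows "frob n (\<lambda>a b. if a = i \<and> b = j then 1 else 0) A = A i j"
proof (cases "i < n \<and> j < n")
  case True
  then show ?thesis unfolding frob_def by (intro sum_unit) auto
next
  case False
  then have "frob n (\<lambda>a b. if a = i \<and> b = j then 1 else 0) A = 0"
    unfolding frob_def by (intro sum.neutral ballI) auto
  moreover have "A i j = 0" using False assms unfolding supported_def by (meson not_less)
  ultimately show ?thesis by simp
qed

text \<open>Strassen's elimination of the terms of degree other than two: the value of a line on the
  matrices \<open>sA\<close> and \<open>tB\<close> is a polynomial in \<open>s\<close> and \<open>t\<close>, of which only the coefficients of
  \<open>1\<close>, \<open>s\<close>, \<open>t\<close> and \<open>st\<close> are tracked.  A multiplication contributes two products of
  linear forms to the coefficient of \<open>st\<close>.\<close>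

definition expansion ::
  "nat \<Rightarrow> (nat \<Rightarrow> nat \<Rightarrow> rat) \<Rightarrow> (nat \<Rightarrow> nat \<Rightarrow> rat) \<Rightarrow> nat \<Rightarrow> (nat \<Rightarrow> nat \<Rightarrow> nat \<Rightarrow> rat) \<Rightarrow> (nat \<Rightarrow> nat \<Rightarrow> nat \<Rightarrow> rat) \<Rightarrow>
   rat \<times> (nat \<Rightarrow> nat \<Rightarrow> rat) \<times> (nat \<Rightarrow> nat \<Rightarrow> rat) \<times> (nat \<Rightarrow> rat) \<Rightarrow> rat poly poly \<Rightarrow> bool" where
  "expansion n A B r u v F P \<longleftrightarrow> (case F of (c, \<alpha>, \<beta>, G) \<Rightarrow>
     coeff (coeff P 0) 0 = c \<and> coeff (coeff P 1) 0 = frob n \<alpha> A \<and> coeff (coeff P 0) 1 = frob n \<beta> B \<and>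
     coeff (coeff P 1) 1 = (\<Sum>h<r. G h * (frob n (u h) A * frob n (v h) B)))"

text \<open>The outer variable is \<open>s\<close> and the inner one \<open>t\<close>:
  \<open>coeff (coeff P a) b\<close> is the coefficient of s^a t^b.\<close>

definition poly2 :: "rat poly poly \<Rightarrow> rat \<Rightarrow> rat \<Rightarrow> rat" where
  "poly2 P s t = poly (poly P [:s:]) t"

lemma poly2_simps:
  "poly2 (P + Q) s t = poly2 P s t + poly2 Q s t"
  "poly2 (P - Q) s t = poly2 P s t - poly2 Q s t"
  "poly2 (P * Q) s t = poly2 P s t * poly2 Q s t"
  by (simp_all add: poly2_def)

text \<open>The rationals are infinite: \<open>P - Q\<close>, a polynomial over the domain
  \<open>rat poly\<close>, has every constant \<open>[:s:]\<close> as a root.\<close>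

lemma poly2_eqI:
  assumes "\<And>s t. poly2 P s t = poly2 Q s t"
  shows "P = Q"
proof -
  have "poly P [:s:] = poly Q [:s:]" for s
    using assms[of s] by (simp add: poly2_def poly_eq_poly_eq_iff[symmetric] fun_eq_iff)
  then have z: "poly (P - Q) [:s:] = 0" for s by simp
  show ?thesis
  proof (rule ccontr)
    assume "P \<noteq> Q"
    then have "finite {x. poly (P - Q) x = 0}" by (intro poly_roots_finite) simp
    then have "finite (range (\<lambda>s::rat. [:s:]))" by (rule rev_finite_subset) (use z in auto)
    moreover have "infinite (range (\<lambda>s::rat. [:s:]))"
      by (simp add: finite_image_iff inj_on_def infinite_UNIV_char_0)
    ultimately show False by blast
  qed
qed

lemma coeff_mult_0: "coeff (P * Q) 0 = coeff P 0 * (coeff Q 0 :: 'a::comm_semiring_0)"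
  by (simp add: coeff_mult)

lemma coeff_mult_1: "coeff (P * Q) 1 = coeff P 0 * coeff Q 1 + coeff P 1 * (coeff Q 0 :: 'a::comm_semiring_0)"
  by (simp add: coeff_mult)

text \<open>Later lines append new products behind the first \<open>r\<close>; the coefficients of
  earlier lines vanish there.\<close>

lemma expansion_extend:
  assumes "expansion n A B r u v F P" "\<And>h. h < r \<Longrightarrow> u' h = u h \<and> v' h = v h" "r \<le> r'"
    "\<And>h. r \<le> h \<Longrightarrow> snd (snd (snd F)) h = 0"
  shows "expansion n A B r' u' v' F P"
proof -
  obtain c \<alpha> \<beta> G where F: "F = (c, \<alpha>, \<beta>, G)" by (cases F)
  have "(\<Sum>h<r'. G h * (frob n (u' h) A * frob n (v' h) B)) = (\<Sum>h<r. G h * (frob n (u' h) A * frob n (v' h) B))"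
    by (rule sum.mono_neutral_right) (use assms F in auto)
  also have "\<dots> = (\<Sum>h<r. G h * (frob n (u h) A * frob n (v h) B))"
    by (rule sum.cong) (use assms(2) in auto)
  finally show ?thesis using assms(1) by (simp add: expansion_def F)
qed

abbreviation scaled :: "rat \<Rightarrow> (nat \<Rightarrow> nat \<Rightarrow> rat) \<Rightarrow> nat \<Rightarrow> nat \<Rightarrow> rat" where
  "scaled s A \<equiv> (\<lambda>i j. s * A i j)"

text \<open>\<open>u\<close>, \<open>v\<close> and \<open>F\<close> are chosen once for the program,
  and only the polynomials \<open>Ps\<close> depend on the matrices. Without this order of
  quantifiers no identity valid for all matrices would result.\<close>

definition tracked where
  "tracked n A B r u v F Ps vs \<longleftrightarrow> (\<forall>s t. length (vs s t) = length Ps) \<and>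
     (\<forall>l<length Ps. expansion n A B r u v (F l) (Ps ! l) \<and> (\<forall>s t. poly2 (Ps ! l) s t = vs s t ! l))"

lemma operand_expansion:
  assumes "\<And>h l. r \<le> h \<Longrightarrow> snd (snd (snd (F l))) h = 0"
  shows "\<exists>X. (\<forall>h\<ge>r. snd (snd (snd X)) h = 0) \<and>
    (\<forall>A B Ps vs. supported n A \<longrightarrow> supported n B \<longrightarrow> length Ps = L \<longrightarrow> tracked n A B r u v F Ps vs \<longrightarrow>
      (\<exists>P. expansion n A B r u v X P \<and> (\<forall>s t. poly2 P s t = operand_val (scaled s A) (scaled t B) (vs s t) x)))"
proof (cases x)
  case (Left_Entry i j)
  let ?X = "(0, \<lambda>a b. if a = i \<and> b = j then 1 else 0, \<lambda>_ _. 0, \<lambda>_. 0) :: rat \<times> (nat \<Rightarrow> nat \<Rightarrow> rat) \<times> (nat \<Rightarrow> nat \<Rightarrow> rat) \<times> (nat \<Rightarrow> rat)"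
  show ?thesis unfolding Left_Entry
    by (intro exI[of _ ?X] conjI allI impI exI[of _ "[:0, [:_:]:]"])
      (auto simp: expansion_def poly2_def frob_unit, simp_all add: frob_def)
next
  case (Right_Entry i j)
  let ?X = "(0, \<lambda>_ _. 0, \<lambda>a b. if a = i \<and> b = j then 1 else 0, \<lambda>_. 0) :: rat \<times> (nat \<Rightarrow> nat \<Rightarrow> rat) \<times> (nat \<Rightarrow> nat \<Rightarrow> rat) \<times> (nat \<Rightarrow> rat)"
  show ?thesis unfolding Right_Entry
    by (intro exI[of _ ?X] conjI allI impI exI[of _ "[:[:0, _:]:]"])
      (auto simp: expansion_def poly2_def frob_unit, simp_all add: frob_def)
next
  case (Scalar a)
  let ?X = "(a, \<lambda>_ _. 0, \<lambda>_ _. 0, \<lambda>_. 0) :: rat \<times> (nat \<Rightarrow> nat \<Rightarrow> rat) \<times> (nat \<Rightarrow> nat \<Rightarrow> rat) \<times> (nat \<Rightarrow> rat)"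
  show ?thesis unfolding Scalar
    by (intro exI[of _ ?X] conjI allI impI exI[of _ "[:[:a:]:]"])
      (auto simp: expansion_def poly2_def frob_def)
next
  case (Line l)
  show ?thesis
  proof (cases "l < L")
    case True
    show ?thesis unfolding Line
      by (intro exI[of _ "F l"] conjI allI impI) (use True assms in \<open>auto simp: tracked_def\<close>)
  next
    \<comment> \<open>A reference to a line that has not been computed has value 0.\<close>
    case False
    let ?X = "(0, \<lambda>_ _. 0, \<lambda>_ _. 0, \<lambda>_. 0) :: rat \<times> (nat \<Rightarrow> nat \<Rightarrow> rat) \<times> (nat \<Rightarrow> nat \<Rightarrow> rat) \<times> (nat \<Rightarrow> rat)"
    show ?thesis unfolding Line
      by (intro exI[of _ ?X] conjI allI impI exI[of _ 0])
        (use False in \<open>auto simp: tracked_def expansion_def poly2_def frob_def\<close>)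
  qed
qed

lemma expansion_apply_op:
  assumes "\<forall>h\<ge>r. snd (snd (snd X)) h = 0" "\<forall>h\<ge>r. snd (snd (snd Y)) h = 0"
  shows "\<exists>u' v' Z. (\<forall>h<r. u' h = u h \<and> v' h = v h) \<and> (\<forall>h\<ge>r + 2. snd (snd (snd Z)) h = 0) \<and>
    (\<forall>A B P Q. expansion n A B r u v X P \<longrightarrow> expansion n A B r u v Y Q \<longrightarrow>
      (\<exists>R. expansion n A B (r + 2) u' v' Z R \<and>
        (\<forall>s t. poly2 R s t = apply_op f (poly2 P s t) (poly2 Q s t))))"
proof -
  obtain c \<alpha> \<beta> G where X: "X = (c, \<alpha>, \<beta>, G)" by (cases X)
  obtain c' \<alpha>' \<beta>' G' where Y: "Y = (c', \<alpha>', \<beta>', G')" by (cases Y)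
  have G0: "h \<ge> r \<Longrightarrow> G h = 0" "h \<ge> r \<Longrightarrow> G' h = 0" for h using assms by (auto simp: X Y)
  show ?thesis
  proof (cases f)
    case Plus
    let ?Z = "(c + c', \<lambda>i j. \<alpha> i j + \<alpha>' i j, \<lambda>i j. \<beta> i j + \<beta>' i j, \<lambda>h. G h + G' h)"
    show ?thesis
    proof (rule exI[of _ u], rule exI[of _ v], rule exI[of _ ?Z], intro conjI allI impI)
      fix A B P Q assume 1: "expansion n A B r u v X P" "expansion n A B r u v Y Q"
      show "\<exists>R. expansion n A B (r + 2) u v ?Z R \<and> (\<forall>s t. poly2 R s t = apply_op f (poly2 P s t) (poly2 Q s t))"
        using 1 G0 by (intro exI[of _ "P + Q"])
          (simp add: Plus poly2_simps expansion_def X Y frob_add_left sum.distrib algebra_simps)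
    qed (use G0 in auto)
  next
    case Minus
    let ?Z = "(c - c', \<lambda>i j. \<alpha> i j - \<alpha>' i j, \<lambda>i j. \<beta> i j - \<beta>' i j, \<lambda>h. G h - G' h)"
    show ?thesis
    proof (rule exI[of _ u], rule exI[of _ v], rule exI[of _ ?Z], intro conjI allI impI)
      fix A B P Q assume 1: "expansion n A B r u v X P" "expansion n A B r u v Y Q"
      show "\<exists>R. expansion n A B (r + 2) u v ?Z R \<and> (\<forall>s t. poly2 R s t = apply_op f (poly2 P s t) (poly2 Q s t))"
        using 1 G0 by (intro exI[of _ "P - Q"])
          (simp add: Minus poly2_simps expansion_def X Y frob_diff_left sum_subtractf algebra_simps)
    qed (use G0 in auto)
  next
    case Times
    let ?u = "u(r := \<alpha>, r + 1 := \<alpha>')" and ?v = "v(r := \<beta>', r + 1 := \<beta>)"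
    let ?Z = "(c * c', \<lambda>i j. c * \<alpha>' i j + c' * \<alpha> i j, \<lambda>i j. c * \<beta>' i j + c' * \<beta> i j,
      (\<lambda>h. c * G' h + c' * G h)(r := 1, r + 1 := 1))"
    show ?thesis
    proof (rule exI[of _ ?u], rule exI[of _ ?v], rule exI[of _ ?Z], intro conjI allI impI)
      fix A B P Q assume 1: "expansion n A B r u v X P" "expansion n A B r u v Y Q"
      have "(\<Sum>h<r. ((\<lambda>h. c * G' h + c' * G h)(r := 1, r + 1 := 1)) h * (frob n (?u h) A * frob n (?v h) B))
        = (\<Sum>h<r. c * (G' h * (frob n (u h) A * frob n (v h) B)) + c' * (G h * (frob n (u h) A * frob n (v h) B)))"
        by (rule sum.cong) (auto simp: algebra_simps)
      then show "\<exists>R. expansion n A B (r + 2) ?u ?v ?Z R \<and> (\<forall>s t. poly2 R s t = apply_op f (poly2 P s t) (poly2 Q s t))"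
        using 1 by (intro exI[of _ "P * Q"])
          (simp add: Times poly2_simps expansion_def X Y frob_add_left frob_scale_left sum.distrib
            sum_distrib_left[symmetric] coeff_mult_0 coeff_mult_1[unfolded One_nat_def] algebra_simps)
    qed (use G0 in auto)
  qed
qed

lemma slp_expansion:
  "\<exists>u v F. (\<forall>l. \<forall>h\<ge>2 * length p. snd (snd (snd (F l))) h = 0) \<and>
    (\<forall>A B. supported n A \<longrightarrow> supported n B \<longrightarrow> (\<exists>Ps. length Ps = length p \<and>
      tracked n A B (2 * length p) u v F Ps (\<lambda>s t. slp_vals (scaled s A) (scaled t B) p)))"
proof (induction p rule: rev_induct)
  case Nil
  show ?case by (intro exI[of _ "\<lambda>_ _ _. 0"] exI[of _ "\<lambda>_. (0, \<lambda>_ _. 0, \<lambda>_ _. 0, \<lambda>_. 0)"])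
    (auto simp: tracked_def)
next
  case (snoc q p)
  obtain f x y where q: "q = (f, x, y)" by (cases q)
  let ?r = "2 * length p"
  obtain u v F where F: "\<And>l h. ?r \<le> h \<Longrightarrow> snd (snd (snd (F l))) h = 0"
    and IH: "\<And>A B. supported n A \<Longrightarrow> supported n B \<Longrightarrow> \<exists>Ps. length Ps = length p \<and>
      tracked n A B ?r u v F Ps (\<lambda>s t. slp_vals (scaled s A) (scaled t B) p)"
    using snoc.IH by blast
  obtain X where X: "\<forall>h\<ge>?r. snd (snd (snd X)) h = 0"
    and X': "\<And>A B Ps vs. supported n A \<Longrightarrow> supported n B \<Longrightarrow> length Ps = length p \<Longrightarrow> tracked n A B ?r u v F Ps vs \<Longrightarrow>
      (\<exists>P. expansion n A B ?r u v X P \<and> (\<forall>s t. poly2 P s t = operand_val (scaled s A) (scaled t B) (vs s t) x))"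
    using operand_expansion[of ?r F n "length p" u v x, OF F] by blast
  obtain Y where Y: "\<forall>h\<ge>?r. snd (snd (snd Y)) h = 0"
    and Y': "\<And>A B Ps vs. supported n A \<Longrightarrow> supported n B \<Longrightarrow> length Ps = length p \<Longrightarrow> tracked n A B ?r u v F Ps vs \<Longrightarrow>
      (\<exists>P. expansion n A B ?r u v Y P \<and> (\<forall>s t. poly2 P s t = operand_val (scaled s A) (scaled t B) (vs s t) y))"
    using operand_expansion[of ?r F n "length p" u v y, OF F] by blast
  obtain u' v' Z where uv: "\<forall>h<?r. u' h = u h \<and> v' h = v h" and Z: "\<forall>h\<ge>?r + 2. snd (snd (snd Z)) h = 0"
    and Z': "\<And>A B P Q. expansion n A B ?r u v X P \<Longrightarrow> expansion n A B ?r u v Y Q \<Longrightarrow>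
      (\<exists>R. expansion n A B (?r + 2) u' v' Z R \<and> (\<forall>s t. poly2 R s t = apply_op f (poly2 P s t) (poly2 Q s t)))"
    using expansion_apply_op[OF X Y, of u v n f] by blast
  have r: "2 * length (p @ [q]) = ?r + 2" by simp
  show ?case unfolding r
  proof (rule exI[of _ u'], rule exI[of _ v'], rule exI[of _ "F(length p := Z)"], intro conjI allI impI)
    fix l h assume "?r + 2 \<le> h"
    then show "snd (snd (snd ((F(length p := Z)) l))) h = 0" using F Z by auto
  next
    fix A B :: "nat \<Rightarrow> nat \<Rightarrow> rat" assume AB: "supported n A" "supported n B"
    let ?vs = "\<lambda>s t. slp_vals (scaled s A) (scaled t B) p"
    obtain Ps where Ps: "length Ps = length p" "tracked n A B ?r u v F Ps ?vs" using IH[OF AB] by blast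
    obtain P where P: "expansion n A B ?r u v X P"
      "\<forall>s t. poly2 P s t = operand_val (scaled s A) (scaled t B) (?vs s t) x"
      using X'[OF AB Ps] by auto
    obtain Q where Q: "expansion n A B ?r u v Y Q"
      "\<forall>s t. poly2 Q s t = operand_val (scaled s A) (scaled t B) (?vs s t) y"
      using Y'[OF AB Ps] by auto
    obtain R where R: "expansion n A B (?r + 2) u' v' Z R"
      "\<forall>s t. poly2 R s t = apply_op f (poly2 P s t) (poly2 Q s t)" using Z'[OF P(1) Q(1)] by blast
    have "expansion n A B (?r + 2) u' v' ((F(length p := Z)) l) ((Ps @ [R]) ! l)" if l: "l < length (p @ [q])" for l
    proof (cases "l = length p")
      case False
      then have "l < length p" using l by simp
      then have e: "expansion n A B ?r u v (F l) (Ps ! l)" using Ps by (simp add: tracked_def)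
      have "expansion n A B (?r + 2) u' v' (F l) (Ps ! l)"
      proof (rule expansion_extend[OF e])
        show "?r \<le> h \<Longrightarrow> snd (snd (snd (F l))) h = 0" for h by (rule F)
      qed (use uv in auto)
      then show ?thesis using \<open>l < length p\<close> Ps(1) by (simp add: nth_append)
    qed (use R Ps in \<open>simp add: nth_append\<close>)
    moreover have "poly2 ((Ps @ [R]) ! l) s t = slp_vals (scaled s A) (scaled t B) (p @ [q]) ! l"
      if "l < length (p @ [q])" for l s t
      using that Ps R P Q by (cases "l = length p") (auto simp: tracked_def nth_append q slp_vals_snoc)
    ultimately show "\<exists>Ps. length Ps = length (p @ [q]) \<and> tracked n A B (?r + 2) u' v' (F(length p := Z)) Ps
        (\<lambda>s t. slp_vals (scaled s A) (scaled t B) (p @ [q]))"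
      using Ps(1) by (intro exI[of _ "Ps @ [R]"]) (simp add: tracked_def)
  qed
qed

text \<open>On the matrices sA and tB the output is st times an entry of AB, for all s and t. Hence
  its polynomial is this single monomial, and the tracked coefficient of st is the entry itself. At
  most two products per line give the factor 2.\<close>

lemma slp_bilinear:
  assumes "multiplies_matrices n (p :: rat slp) out"
  shows "\<exists>u v G. \<forall>i<n. \<forall>j<n. \<forall>A B :: nat \<Rightarrow> nat \<Rightarrow> rat. supported n A \<longrightarrow> supported n B \<longrightarrow>
    (\<Sum>l<n. A i l * B l j) = (\<Sum>h<2 * length p. G i j h * (frob n (u h) A * frob n (v h) B))"
proof -
  let ?r = "2 * length p"
  obtain u v F where F: "\<And>l h. ?r \<le> h \<Longrightarrow> snd (snd (snd (F l))) h = 0"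
    and Ps: "\<And>A B. supported n A \<Longrightarrow> supported n B \<Longrightarrow> \<exists>Ps. length Ps = length p \<and>
      tracked n A B ?r u v F Ps (\<lambda>s t. slp_vals (scaled s A) (scaled t B) p)"
    using slp_expansion[of p n] by blast
  define Q where "Q i j g \<longleftrightarrow> (\<forall>A B. supported n A \<longrightarrow> supported n B \<longrightarrow>
    (\<Sum>l<n. A i l * B l j) = (\<Sum>h<?r. g h * (frob n (u h) A * frob n (v h) B)))" for i j g
  have "\<exists>g. Q i j g" if ij: "i < n" "j < n" for i j
  proof -
    obtain X where X: "\<And>A B Ps vs. supported n A \<Longrightarrow> supported n B \<Longrightarrow> length Ps = length p \<Longrightarrow> tracked n A B ?r u v F Ps vs \<Longrightarrow>
      (\<exists>P. expansion n A B ?r u v X P \<and>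
        (\<forall>s t. poly2 P s t = operand_val (scaled s A) (scaled t B) (vs s t) (out i j)))"
      using operand_expansion[of ?r F n "length p" u v "out i j", OF F] by blast
    obtain c \<alpha> \<beta> g where g: "X = (c, \<alpha>, \<beta>, g)" by (cases X)
    show ?thesis unfolding Q_def
    proof (intro exI[of _ g] allI impI)
      fix A B :: "nat \<Rightarrow> nat \<Rightarrow> rat" assume AB: "supported n A" "supported n B"
      let ?vs = "\<lambda>s t. slp_vals (scaled s A) (scaled t B) p"
      let ?c = "\<Sum>l<n. A i l * B l j"
      obtain Qs where Qs: "length Qs = length p" "tracked n A B ?r u v F Qs ?vs" using Ps[OF AB] by blast
      obtain P where P: "expansion n A B ?r u v X P"
        "\<forall>s t. poly2 P s t = operand_val (scaled s A) (scaled t B) (?vs s t) (out i j)"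
        using X[OF AB Qs] by auto
      have "P = [:0, [:0, ?c:]:]"
      proof (rule poly2_eqI)
        fix s t
        have "poly2 P s t = (\<Sum>l<n. (s * A i l) * (t * B l j))"
          using P(2) assms ij unfolding multiplies_matrices_def by simp
        also have "\<dots> = poly2 [:0, [:0, ?c:]:] s t"
          by (simp add: poly2_def sum_distrib_left algebra_simps)
        finally show "poly2 P s t = poly2 [:0, [:0, ?c:]:] s t" .
      qed
      then show "?c = (\<Sum>h<?r. g h * (frob n (u h) A * frob n (v h) B))"
        using P(1) by (simp add: expansion_def g)
    qed
  qed
  then have "\<exists>g. i < n \<longrightarrow> j < n \<longrightarrow> Q i j g" for i j by (auto simp: Q_def)
  then obtain G where "\<And>i j. i < n \<longrightarrow> j < n \<longrightarrow> Q i j (G i j)" by metis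
  then have "\<forall>i<n. \<forall>j<n. Q i j (G i j)" by blast
  then show ?thesis unfolding Q_def
    by - (rule exI[of _ u], rule exI[of _ v], rule exI[of _ G])
qed

section \<open>Integer coefficients\<close>

lemma common_denominator:
  assumes "finite S"
  shows "\<exists>N::nat. N > 0 \<and> (\<forall>x\<in>S. \<exists>z::int. of_nat N * (f x :: rat) = of_int z)"
  using assms
proof (induction S rule: finite_induct)
  case (insert y S)
  then obtain N :: nat where N: "N > 0" "\<forall>x\<in>S. \<exists>z::int. of_nat N * f x = of_int z" by blast
  obtain a b where ab: "f y = Fract a b" "b > 0" by (cases "f y") auto
  have "\<exists>z::int. of_nat (N * nat b) * f x = of_int z" if "x \<in> insert y S" for x
  proof (cases "x = y")
    case True
    have "of_nat (N * nat b) * f y = of_int (int N * a)"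
      using ab by (simp add: Fract_of_int_quotient)
    then show ?thesis using True by blast
  next
    case False
    then have "x \<in> S" using that by simp
    then obtain z :: int where z: "of_nat N * f x = of_int z" using N(2) by blast
    have "of_nat (N * nat b) * f x = of_int b * (of_nat N * f x)" using ab(2) by simp
    then have "of_nat (N * nat b) * f x = of_int (b * z)" unfolding z by simp
    then show ?thesis by blast
  qed
  then show ?case using N(1) ab(2) by (intro exI[of _ "N * nat b"]) auto
qed (auto intro: exI[of _ 1])

lemma integer_forms:
  fixes u :: "nat \<Rightarrow> nat \<Rightarrow> nat \<Rightarrow> rat" and r n :: nat
  shows "\<exists>N::nat. N > 0 \<and> (\<exists>U. \<forall>h<r. \<forall>f. of_int (frob n (U h) f) = of_nat N * frob n (u h) (\<lambda>i j. of_int (f i j) :: rat))"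
proof -
  have "finite ({..<r} \<times> {..<n} \<times> {..<n})" by simp
  from common_denominator[OF this, of "\<lambda>(h, i, j). u h i j"]
  obtain N :: nat where N: "N > 0" "\<forall>x\<in>{..<r} \<times> {..<n} \<times> {..<n}. \<exists>z::int. of_nat N * (case x of (h, i, j) \<Rightarrow> u h i j) = of_int z"
    by blast
  define U where "U h i j = (SOME z::int. of_nat N * u h i j = of_int z)" for h i j
  have U: "of_int (U h i j) = of_nat N * u h i j" if "h < r" "i < n" "j < n" for h i j
  proof -
    have "\<exists>z::int. of_nat N * u h i j = of_int z" using N(2)[rule_format, of "(h, i, j)"] that by simp
    then have "of_nat N * u h i j = of_int (U h i j)" unfolding U_def by (rule someI_ex)
    then show ?thesis by simp
  qed
  have "\<forall>h<r. \<forall>f. of_int (frob n (U h) f) = of_nat N * frob n (u h) (\<lambda>i j. of_int (f i j) :: rat)"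
    by (auto simp: frob_def sum_distrib_left U mult.assoc intro!: sum.cong)
  then show ?thesis using N(1) by blast
qed

lemma frob_cong: "(\<And>i j. i < n \<Longrightarrow> j < n \<Longrightarrow> f i j = f' i j) \<Longrightarrow> (\<And>i j. i < n \<Longrightarrow> j < n \<Longrightarrow> g i j = g' i j) \<Longrightarrow> frob n f g = frob n f' g'"
  by (auto simp: frob_def intro!: sum.cong)

text \<open>Weighting the entry (i, l) of the product by \<open>e i l\<close> and summing turns the
  output coefficients \<open>G i l h\<close> into a third family of linear forms. Each family is
  scaled by its own common denominator, and \<open>N\<close> is the product of the three.\<close>

lemma slp_trilinear_int:
  assumes "multiplies_matrices n (p :: rat slp) out"
  shows "\<exists>(U :: nat \<Rightarrow> nat \<Rightarrow> nat \<Rightarrow> int) V W (N::nat). N > 0 \<and> (\<forall>f g e.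
    (\<Sum>h<2 * length p. frob n (U h) f * frob n (V h) g * frob n (W h) e) =
    int N * (\<Sum>i<n. \<Sum>j<n. \<Sum>l<n. f i j * g j l * e i l))"
proof -
  let ?r = "2 * length p"
  obtain u v G where G: "\<And>i j (A :: nat \<Rightarrow> nat \<Rightarrow> rat) B. i < n \<Longrightarrow> j < n \<Longrightarrow> supported n A \<Longrightarrow> supported n B \<Longrightarrow>
    (\<Sum>l<n. A i l * B l j) = (\<Sum>h<?r. G i j h * (frob n (u h) A * frob n (v h) B))"
    using slp_bilinear[OF assms] by blast
  obtain U M1 where U: "M1 > 0" "\<And>h f. h < ?r \<Longrightarrow> of_int (frob n (U h) f) = of_nat M1 * frob n (u h) (\<lambda>i j. of_int (f i j) :: rat)"
    using integer_forms[of ?r n u] by blast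
  obtain V M2 where V: "M2 > 0" "\<And>h f. h < ?r \<Longrightarrow> of_int (frob n (V h) f) = of_nat M2 * frob n (v h) (\<lambda>i j. of_int (f i j) :: rat)"
    using integer_forms[of ?r n v] by blast
  obtain W M3 where W: "M3 > 0" "\<And>h f. h < ?r \<Longrightarrow> of_int (frob n (W h) f) = of_nat M3 * frob n (\<lambda>i l. G i l h) (\<lambda>i j. of_int (f i j) :: rat)"
    using integer_forms[of ?r n "\<lambda>h i l. G i l h"] by blast
  have "(\<Sum>h<?r. frob n (U h) f * frob n (V h) g * frob n (W h) e) =
    int (M1 * M2 * M3) * (\<Sum>i<n. \<Sum>j<n. \<Sum>l<n. f i j * g j l * e i l)" for f g e
  proof -
    define A :: "nat \<Rightarrow> nat \<Rightarrow> rat" where "A i j = (if i < n \<and> j < n then of_int (f i j) else 0)" for i j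
    define B :: "nat \<Rightarrow> nat \<Rightarrow> rat" where "B i j = (if i < n \<and> j < n then of_int (g i j) else 0)" for i j
    have AB: "supported n A" "supported n B" by (auto simp: supported_def A_def B_def)
    have fA: "frob n x (\<lambda>i j. of_int (f i j)) = frob n x A" for x by (rule frob_cong) (auto simp: A_def)
    have gB: "frob n x (\<lambda>i j. of_int (g i j)) = frob n x B" for x by (rule frob_cong) (auto simp: B_def)
    let ?e = "\<lambda>i l. of_int (e i l) :: rat"
    have "of_int (\<Sum>h<?r. frob n (U h) f * frob n (V h) g * frob n (W h) e) =
      (\<Sum>h<?r. of_nat (M1 * M2 * M3) * (frob n (u h) A * frob n (v h) B * frob n (\<lambda>i l. G i l h) ?e))"
      unfolding of_int_sum of_int_mult by (rule sum.cong) (auto simp: U(2) V(2) W(2) fA gB)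
    also have "\<dots> = of_nat (M1 * M2 * M3) * (\<Sum>h<?r. \<Sum>i<n. \<Sum>l<n. G i l h * (frob n (u h) A * frob n (v h) B) * ?e i l)"
      by (simp only: sum_distrib_left[symmetric] frob_def[of n "\<lambda>i l. G i l _"])
        (simp add: sum_distrib_left algebra_simps)
    also have "(\<Sum>h<?r. \<Sum>i<n. \<Sum>l<n. G i l h * (frob n (u h) A * frob n (v h) B) * ?e i l) =
      (\<Sum>i<n. \<Sum>l<n. \<Sum>h<?r. G i l h * (frob n (u h) A * frob n (v h) B) * ?e i l)"
      by (subst sum.swap, rule sum.cong[OF refl], rule sum.swap)
    also have "\<dots> = (\<Sum>i<n. \<Sum>l<n. (\<Sum>j<n. A i j * B j l) * ?e i l)"
      by (intro sum.cong refl) (simp add: G[OF _ _ AB] sum_distrib_right)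
    also have "\<dots> = (\<Sum>i<n. \<Sum>j<n. \<Sum>l<n. A i j * B j l * ?e i l)"
      by (rule sum.cong[OF refl]) (subst sum.swap, simp add: sum_distrib_right)
    also have "\<dots> = of_int (\<Sum>i<n. \<Sum>j<n. \<Sum>l<n. f i j * g j l * e i l)"
      by (simp add: A_def B_def)
    finally have "(of_int (\<Sum>h<?r. frob n (U h) f * frob n (V h) g * frob n (W h) e) :: rat) =
      of_int (int (M1 * M2 * M3) * (\<Sum>i<n. \<Sum>j<n. \<Sum>l<n. f i j * g j l * e i l))" by simp
    then show ?thesis by (simp only: of_int_eq_iff)
  qed
  then show ?thesis using U(1) V(1) W(1)
    by - (rule exI[of _ U], rule exI[of _ V], rule exI[of _ W], rule exI[of _ "M1 * M2 * M3"], auto)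
qed

section \<open>Bounds for the number of operations and for the exponent\<close>

lemma slp_length_ge:
  assumes "multiplies_matrices n (p :: 'a::field_char_0 slp) out" "n > 0"
  shows "n\<^sup>2 \<le> length p"
proof -
  have val: "operand_val A B (slp_vals A B p) (out i j) = (\<Sum>l<n. A i l * B l j)" if "i < n" "j < n" for A B i j
    using assms(1) that by (auto simp: multiplies_matrices_def)
  \<comment> \<open>No input entry and no constant equals an entry of AB for all matrices; the
    matrices with all entries 0 or all entries 1 show this. A reference to a missing line reads 0
    and fails as well.\<close>
  have line: "\<exists>l<length p. out i j = Line l" if ij: "i < n" "j < n" for i j
  proof (cases "out i j")
    case (Left_Entry a b)
    then show ?thesis using val[OF ij, of "\<lambda>_ _. 1" "\<lambda>_ _. 0"] by simp
  next
    case (Right_Entry a b)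
    then show ?thesis using val[OF ij, of "\<lambda>_ _. 0" "\<lambda>_ _. 1"] by simp
  next
    case (Scalar a)
    then show ?thesis using val[OF ij, of "\<lambda>_ _. 0" "\<lambda>_ _. 0"] val[OF ij, of "\<lambda>_ _. 1" "\<lambda>_ _. 1"] assms(2) by simp
  next
    case (Line l)
    then show ?thesis using val[OF ij, of "\<lambda>_ _. 1" "\<lambda>_ _. 1"] assms(2) by (cases "l < length p") auto
  qed
  \<comment> \<open>The product of \<open>?A\<close> and \<open>?B\<close> is the matrix unit at (i,
    j), which separates this entry from every other one. So the outputs occupy pairwise different
    lines.\<close>
  have inj: "i = i' \<and> j = j'" if ij: "i < n" "j < n" "i' < n" "j' < n" and eq: "out i j = out i' j'" for i j i' j'
  proof -
    let ?A = "\<lambda>a l. if a = i \<and> l = 0 then 1 else 0 :: 'a" and ?B = "\<lambda>l b. if l = 0 \<and> b = j then 1 else 0 :: 'a"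
    have s: "(\<Sum>l<n. ?A a l * ?B l b) = (if a = i \<and> b = j then 1 else 0)" for a b
    proof -
      have "(\<Sum>l<n. ?A a l * ?B l b) = (\<Sum>l<n. if l = 0 then (if a = i \<and> b = j then 1 else 0) else 0)"
        by (rule sum.cong) auto
      then show ?thesis using assms(2) by simp
    qed
    have "(\<Sum>l<n. ?A i l * ?B l j) = (\<Sum>l<n. ?A i' l * ?B l j')"
      using val[OF ij(1,2), of ?A ?B] val[OF ij(3,4), of ?A ?B] eq by simp
    then show ?thesis unfolding s by (auto split: if_splits)
  qed
  have "inj_on (\<lambda>(i, j). out i j) ({..<n} \<times> {..<n})"
    unfolding inj_on_def using inj by auto
  then have "card ({..<n} \<times> {..<n}) = card ((\<lambda>(i, j). out i j) ` ({..<n} \<times> {..<n}))"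
    by (simp add: card_image)
  also have "\<dots> \<le> card ((Line :: nat \<Rightarrow> 'a operand) ` {..<length p})" using line by (intro card_mono) auto
  also have "\<dots> \<le> length p" using card_image_le[of "{..<length p}"] by (metis card_lessThan finite_lessThan)
  finally show ?thesis by (simp add: power2_eq_square)
qed

text \<open>A reference beyond the end of a program reads 0 but may acquire another value when the
  program is extended. This predicate excludes such references.\<close>

fun line_below :: "nat \<Rightarrow> 'a operand \<Rightarrow> bool" where
  "line_below L (Line l) \<longleftrightarrow> l < L"
| "line_below L _ \<longleftrightarrow> True"

lemma operand_val_append:
  "line_below (length vs) x \<Longrightarrow> operand_val A B (vs @ ws) x = operand_val A B vs x"
  by (cases x) (auto simp: nth_append)

lemma slp_vals_append: "\<exists>ws. slp_vals A B (p @ q) = slp_vals A B p @ ws"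
proof (induction q rule: rev_induct)
  case (snoc z q)
  obtain f x y where z: "z = (f, x, y)" by (cases z)
  obtain ws where "slp_vals A B (p @ q) = slp_vals A B p @ ws" using snoc.IH by blast
  then show ?case using slp_vals_snoc[of A B "p @ q" f x y] by (simp add: z)
qed simp

lemma operand_val_slp_append:
  assumes "line_below (length p) x"
  shows "operand_val A B (slp_vals A B (p @ q)) x = operand_val A B (slp_vals A B p) x"
  using slp_vals_append[of A B p q] operand_val_append[of "slp_vals A B p" x A B] assms by auto

lemma slp_entry:
  "\<exists>q x. length q = 2 * m \<and> line_below (length (p @ q)) x \<and>
    (\<forall>A B. operand_val A B (slp_vals A B (p @ q)) x = (\<Sum>l<m. A i l * (B l j :: 'a::field)))"
proof (induction m)
  case 0
  show ?case by (intro exI[of _ "[]"] exI[of _ "Scalar 0"]) auto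
next
  case (Suc m)
  then obtain q x where q: "length q = 2 * m" "line_below (length (p @ q)) x"
    "\<And>A B. operand_val A B (slp_vals A B (p @ q)) x = (\<Sum>l<m. A i l * (B l j :: 'a))" by blast
  let ?q1 = "q @ [(Times, Left_Entry i m, Right_Entry m j)]"
  let ?q = "?q1 @ [(Plus, x, Line (length p + 2 * m))]"
  show ?case
  proof (intro exI[of _ ?q] exI[of _ "Line (length p + 2 * m + 1)"] conjI allI)
    fix A B :: "nat \<Rightarrow> nat \<Rightarrow> 'a"
    have 1: "slp_vals A B (p @ ?q1) = slp_vals A B (p @ q) @ [A i m * B m j]"
      using slp_vals_snoc[of A B "p @ q"] by simp
    have "slp_vals A B (p @ ?q) = slp_vals A B (p @ q) @ [A i m * B m j, (\<Sum>l<m. A i l * B l j) + A i m * B m j]"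
      using slp_vals_snoc[of A B "p @ ?q1" Plus x "Line (length p + 2 * m)"]
        operand_val_append[of "slp_vals A B (p @ q)" x A B "[A i m * B m j]"] q
      unfolding 1 by (simp add: nth_append)
    then show "operand_val A B (slp_vals A B (p @ ?q)) (Line (length p + 2 * m + 1)) = (\<Sum>l<Suc m. A i l * B l j)"
      using q(1) by (simp add: nth_append)
  qed (use q in auto)
qed

lemma slp_entries:
  "\<exists>q out. length q = 2 * n * length ijs \<and> (\<forall>(i, j)\<in>set ijs. line_below (length q) (out i j) \<and>
    (\<forall>A B. operand_val A B (slp_vals A B q) (out i j) = (\<Sum>l<n. A i l * (B l j :: 'a::field))))"
proof (induction ijs)
  case Nil
  show ?case by (intro exI[of _ "[]"]) auto
next
  case (Cons a ijs)
  obtain i j where a: "a = (i, j)" by (cases a)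
  obtain p out where p: "length p = 2 * n * length ijs" "\<And>i j. (i, j)\<in>set ijs \<Longrightarrow> line_below (length p) (out i j) \<and>
    (\<forall>A B. operand_val A B (slp_vals A B p) (out i j) = (\<Sum>l<n. A i l * (B l j :: 'a::field)))"
    using Cons.IH by blast
  obtain q x where q: "length q = 2 * n" "line_below (length (p @ q)) x"
    "\<And>A B. operand_val A B (slp_vals A B (p @ q)) x = (\<Sum>l<n. A i l * (B l j :: 'a))"
    using slp_entry[of n p i j] by blast
  let ?out = "\<lambda>i' j'. if i' = i \<and> j' = j then x else out i' j'"
  have lb: "line_below (length p) y \<Longrightarrow> line_below (length (p @ q)) y" for y :: "'a operand" by (cases y) auto
  show ?case
  proof (intro exI[of _ "p @ q"] exI[of _ ?out] conjI ballI)
    fix ab assume "ab \<in> set (a # ijs)"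
    then show "case ab of (i, j) \<Rightarrow> line_below (length (p @ q)) (?out i j) \<and>
      (\<forall>A B. operand_val A B (slp_vals A B (p @ q)) (?out i j) = (\<Sum>l<n. A i l * B l j))"
      using q p(2) lb operand_val_slp_append[of p] by (cases ab) (auto simp: a)
  qed (use p q in \<open>simp add: algebra_simps\<close>)
qed

text \<open>The school method. It ensures that the minimum in \<open>matmul_ops\<close> is attained
  and, by its cubic length, that the infimum defining the exponent is taken over a nonempty
  set.\<close>

lemma ex_slp: "\<exists>(p :: 'a::field slp) out. length p = 2 * n ^ 3 \<and> multiplies_matrices n p out"
proof -
  obtain q out where q: "length q = 2 * n * length (List.product [0..<n] [0..<n])"
    "\<forall>(i, j)\<in>set (List.product [0..<n] [0..<n]). line_below (length q) (out i j) \<and>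
    (\<forall>A B. operand_val A B (slp_vals A B q) (out i j) = (\<Sum>l<n. A i l * (B l j :: 'a::field)))"
    using slp_entries[of n "List.product [0..<n] [0..<n]"] by blast
  have "multiplies_matrices n q out" using q(2) by (auto simp: multiplies_matrices_def)
  moreover have "length q = 2 * n ^ 3" using q(1) by (simp add: length_product power3_eq_cube)
  ultimately show ?thesis by blast
qed

lemma matmul_ops_slp:
  obtains p :: "'a::field slp" and out where "length p = matmul_ops TYPE('a) n" "multiplies_matrices n p out"
proof -
  have "\<exists>s. \<exists>(p::'a slp) out. length p = s \<and> multiplies_matrices n p out" using ex_slp by blast
  from LeastI_ex[OF this] show ?thesis using that unfolding matmul_ops_def by blast
qed

lemma matmul_ops_le: "matmul_ops TYPE('a::field) n \<le> 2 * n ^ 3"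
  unfolding matmul_ops_def by (rule Least_le) (use ex_slp in blast)

lemma matmul_ops_ge: "n\<^sup>2 \<le> matmul_ops TYPE('a::field_char_0) n"
proof (cases "n = 0")
  case False
  then show ?thesis using slp_length_ge matmul_ops_slp by (metis gr0I)
qed simp

lemma matmul_ops_bigo_3: "(\<lambda>n. real (matmul_ops TYPE(rat) n)) \<in> O(\<lambda>n. real n powr 3)"
proof (rule bigoI[of _ 2], rule eventually_sequentiallyI[of 1])
  fix n :: nat assume "1 \<le> n"
  have "real (matmul_ops TYPE(rat) n) \<le> real (2 * n ^ 3)"
    using matmul_ops_le[where 'a = rat, of n] by (simp only: of_nat_le_iff)
  also have "\<dots> = 2 * real n powr 3" using \<open>1 \<le> n\<close> by (simp add: powr_numeral)
  finally show "norm (real (matmul_ops TYPE(rat) n)) \<le> 2 * norm (real n powr 3)" by simp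
qed

lemma powr_eventually_dominates:
  fixes C :: real
  assumes "a < b"
  shows "\<forall>\<^sub>F n in sequentially. C * real n powr a \<le> real n powr b"
proof -
  have "\<forall>\<^sub>F n in sequentially. C \<le> real n powr (b - a)"
  proof (rule eventually_sequentiallyI)
    fix n assume "nat \<lceil>\<bar>C\<bar> powr (1 / (b - a))\<rceil> \<le> n"
    then have "\<bar>C\<bar> powr (1 / (b - a)) \<le> real n" by linarith
    then have "(\<bar>C\<bar> powr (1 / (b - a))) powr (b - a) \<le> real n powr (b - a)"
      using assms by (intro powr_mono2) auto
    then show "C \<le> real n powr (b - a)" using assms by (simp add: powr_powr split: if_splits)
  qed
  then show ?thesis
  proof eventually_elim
    case (elim n)
    then have "C * real n powr a \<le> real n powr (b - a) * real n powr a" by (intro mult_right_mono) auto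
    then show ?case by (simp add: powr_add[symmetric])
  qed
qed

lemma matmul_ops_exponent_ge_2:
  assumes "(\<lambda>n. real (matmul_ops TYPE(rat) n)) \<in> O(\<lambda>n. real n powr \<tau>)"
  shows "2 \<le> \<tau>"
proof (rule ccontr)
  assume "\<not> 2 \<le> \<tau>"
  then have t: "\<tau> < 2" by simp
  obtain C where C: "\<forall>\<^sub>F n in sequentially. norm (real (matmul_ops TYPE(rat) n)) \<le> C * norm (real n powr \<tau>)"
    using assms by (auto elim: landau_o.bigE)
  have "\<forall>\<^sub>F n in sequentially. False"
    using C powr_eventually_dominates[OF t, of "2 * C"] eventually_gt_at_top[of 0]
  proof eventually_elim
    case (elim n)
    have "real n powr 2 = real (n\<^sup>2)" using elim(3) by (simp add: powr_numeral)
    also have "\<dots> \<le> real (matmul_ops TYPE(rat) n)"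
      using matmul_ops_ge[where 'a = rat, of n] by (simp only: of_nat_le_iff)
    finally have "real n powr 2 \<le> real (matmul_ops TYPE(rat) n)" .
    moreover have "real (matmul_ops TYPE(rat) n) \<le> C * real n powr \<tau>" using elim(1) by simp
    moreover have "0 < real n powr 2" using elim(3) by simp
    ultimately show False using elim(2) by linarith
  qed
  then show False by simp
qed

text \<open>Needed to absorb the enumeration of all vertex tuples, whose cost does not come from
  matrix multiplication.\<close>

lemma mm_omega_ge_2: "2 \<le> mm_omega"
  unfolding matmul_exponent_def
proof (rule cInf_greatest)
  show "{\<tau>. (\<lambda>n. real (matmul_ops TYPE(rat) n)) \<in> O(\<lambda>n. real n powr \<tau>)} \<noteq> {}"
    using matmul_ops_bigo_3 by blast
qed (use matmul_ops_exponent_ge_2 in blast)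

text \<open>The infimum need not be attained, but some admissible \<tau> lies below
  \<open>mm_omega + \<epsilon>\<close>. A large \<open>n\<close> then absorbs the constant of the
  O-bound and the factor 2.\<close>

lemma ex_small_matmul_ops:
  assumes "\<epsilon> > 0"
  shows "\<exists>n\<ge>2. real (2 * matmul_ops TYPE(rat) n) \<le> real n powr (mm_omega + \<epsilon>)"
proof -
  have "mm_omega < mm_omega + \<epsilon>" using assms by simp
  then obtain \<tau> where t: "(\<lambda>n. real (matmul_ops TYPE(rat) n)) \<in> O(\<lambda>n. real n powr \<tau>)" "\<tau> < mm_omega + \<epsilon>"
    unfolding matmul_exponent_def
    using cInf_lessD[of "{\<tau>. (\<lambda>n. real (matmul_ops TYPE(rat) n)) \<in> O(\<lambda>n. real n powr \<tau>)}"] matmul_ops_bigo_3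
    by blast
  obtain C where C: "\<forall>\<^sub>F n in sequentially. norm (real (matmul_ops TYPE(rat) n)) \<le> C * norm (real n powr \<tau>)"
    using t(1) by (auto elim: landau_o.bigE)
  have "\<forall>\<^sub>F n in sequentially. n \<ge> 2 \<and> real (2 * matmul_ops TYPE(rat) n) \<le> real n powr (mm_omega + \<epsilon>)"
    using C powr_eventually_dominates[OF t(2), of "2 * C"] eventually_ge_at_top[of 2]
    by eventually_elim auto
  then show ?thesis by (auto simp: eventually_sequentially)
qed

text \<open>The condition \<open>d\<^sup>2 \<le> r\<close> is recorded because it makes the total
  size of the data nondecreasing from one tensor factor to the next.\<close>

lemma ex_fast_trilinear:
  assumes "\<epsilon> > 0"
  obtains d r N :: nat and U V W :: "nat \<Rightarrow> nat \<Rightarrow> nat \<Rightarrow> int"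
  where "d \<ge> 2" "N > 0" "d\<^sup>2 \<le> r" "real r \<le> real d powr (mm_omega + \<epsilon>)"
    "\<And>f g e. (\<Sum>h<r. frob d (U h) f * frob d (V h) g * frob d (W h) e) =
      int N * (\<Sum>i<d. \<Sum>j<d. \<Sum>l<d. f i j * g j l * e i l)"
proof -
  obtain d where d: "d \<ge> 2" "real (2 * matmul_ops TYPE(rat) d) \<le> real d powr (mm_omega + \<epsilon>)"
    using ex_small_matmul_ops[OF assms] by blast
  obtain p :: "rat slp" and out where p: "length p = matmul_ops TYPE(rat) d" "multiplies_matrices d p out"
    by (rule matmul_ops_slp)
  obtain U V W :: "nat \<Rightarrow> nat \<Rightarrow> nat \<Rightarrow> int" and N :: nat where
    "N > 0" "\<And>f g e. (\<Sum>h<2 * length p. frob d (U h) f * frob d (V h) g * frob d (W h) e) =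
    int N * (\<Sum>i<d. \<Sum>j<d. \<Sum>l<d. f i j * g j l * e i l)"
    using slp_trilinear_int[OF p(2)] by blast
  moreover have "d\<^sup>2 \<le> 2 * length p" using matmul_ops_ge[where 'a = rat, of d] p(1) by simp
  ultimately show ?thesis using d p(1) by (intro that[of d N "2 * length p" U V W]) auto
qed

text \<open>One tensor factor is applied to \<open>r\<^sup>t\<close> matrices indexed by \<open>h\<close>: every block of size \<open>d \<times> d\<close>
  shrinks to a single entry, and the number of matrices grows by the factor \<open>r\<close>.\<close>

definition pass :: "nat \<Rightarrow> nat \<Rightarrow> (nat \<Rightarrow> nat \<Rightarrow> nat \<Rightarrow> 'a) \<Rightarrow> (nat \<Rightarrow> nat \<Rightarrow> nat \<Rightarrow> 'a::comm_semiring_1) \<Rightarrow> nat \<Rightarrow> nat \<Rightarrow> nat \<Rightarrow> 'a" where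
  "pass d r U a h x y = frob d (U (h mod r)) (\<lambda>i j. a (h div r) (x * d + i) (y * d + j))"

primrec passes :: "nat \<Rightarrow> nat \<Rightarrow> (nat \<Rightarrow> nat \<Rightarrow> nat \<Rightarrow> 'a) \<Rightarrow> nat \<Rightarrow> (nat \<Rightarrow> nat \<Rightarrow> 'a::comm_semiring_1) \<Rightarrow> nat \<Rightarrow> nat \<Rightarrow> nat \<Rightarrow> 'a" where
  "passes d r U 0 A = (\<lambda>_. A)"
| "passes d r U (Suc t) A = pass d r U (passes d r U t A)"

definition tri :: "nat \<Rightarrow> (nat \<Rightarrow> nat \<Rightarrow> 'a::comm_semiring_1) \<Rightarrow> (nat \<Rightarrow> nat \<Rightarrow> 'a) \<Rightarrow> (nat \<Rightarrow> nat \<Rightarrow> 'a) \<Rightarrow> 'a" where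
  "tri n a b c = (\<Sum>x<n. \<Sum>y<n. \<Sum>z<n. a x y * b y z * c x z)"

lemma sum_lessThan_add:
  fixes f :: "nat \<Rightarrow> 'a::comm_monoid_add"
  shows "(\<Sum>x<m + d. f x) = (\<Sum>x<m. f x) + (\<Sum>i<d. f (m + i))"
  by (induction d) (simp_all add: add.assoc)

lemma sum_lessThan_mult:
  fixes f :: "nat \<Rightarrow> 'a::comm_monoid_add"
  shows "(\<Sum>x<m * d. f x) = (\<Sum>q<m. \<Sum>i<d. f (q * d + i))"
proof (induction m)
  case (Suc m)
  have "(\<Sum>x<Suc m * d. f x) = (\<Sum>x<m * d + d. f x)" by (simp add: add.commute)
  also have "\<dots> = (\<Sum>x<m * d. f x) + (\<Sum>i<d. f (m * d + i))" by (rule sum_lessThan_add)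
  finally show ?case using Suc by simp
qed simp

lemma sum_swap_front4:
  "(\<Sum>h\<in>R. \<Sum>x\<in>A. \<Sum>y\<in>B. \<Sum>z\<in>C. f h x y z) = (\<Sum>x\<in>A. \<Sum>y\<in>B. \<Sum>z\<in>C. \<Sum>h\<in>R. f h x y z)"
  by (subst sum.swap, rule sum.cong[OF refl], subst sum.swap, rule sum.cong[OF refl], rule sum.swap)

lemma tri_mult:
  "tri (n * d) a b c = (\<Sum>x<n. \<Sum>y<n. \<Sum>z<n. \<Sum>i<d. \<Sum>j<d. \<Sum>l<d.
     a (x * d + i) (y * d + j) * b (y * d + j) (z * d + l) * c (x * d + i) (z * d + l))"
proof -
  let ?g = "\<lambda>x i y j z l. a (x * d + i) (y * d + j) * b (y * d + j) (z * d + l) * c (x * d + i) (z * d + l)"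
  have "tri (n * d) a b c = (\<Sum>x<n. \<Sum>i<d. \<Sum>y<n. \<Sum>j<d. \<Sum>z<n. \<Sum>l<d. ?g x i y j z l)"
    by (simp add: tri_def sum_lessThan_mult)
  also have "\<dots> = (\<Sum>x<n. \<Sum>y<n. \<Sum>i<d. \<Sum>j<d. \<Sum>z<n. \<Sum>l<d. ?g x i y j z l)"
    by (rule sum.cong[OF refl], rule sum.swap)
  also have "\<dots> = (\<Sum>x<n. \<Sum>y<n. \<Sum>i<d. \<Sum>z<n. \<Sum>j<d. \<Sum>l<d. ?g x i y j z l)"
    by (rule sum.cong[OF refl], rule sum.cong[OF refl], rule sum.cong[OF refl], rule sum.swap)
  also have "\<dots> = (\<Sum>x<n. \<Sum>y<n. \<Sum>z<n. \<Sum>i<d. \<Sum>j<d. \<Sum>l<d. ?g x i y j z l)"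
    by (rule sum.cong[OF refl], rule sum.cong[OF refl], rule sum.swap)
  finally show ?thesis .
qed

text \<open>An index \<open>h * r + q\<close> stands for the matrix \<open>h\<close> and the product
  \<open>q\<close>. For each triple of block positions, summing over \<open>q\<close> is the given
  identity applied to three d by d blocks.\<close>

lemma sum_tri_pass:
  fixes U V W :: "nat \<Rightarrow> nat \<Rightarrow> nat \<Rightarrow> int"
  assumes tri: "\<And>f g e. (\<Sum>h<r. frob d (U h) f * frob d (V h) g * frob d (W h) e) =
      int N * (\<Sum>i<d. \<Sum>j<d. \<Sum>l<d. f i j * g j l * e i l)"
  shows "(\<Sum>h<R * r. tri n (pass d r U a h) (pass d r V b h) (pass d r W c h)) =
    int N * (\<Sum>h<R. tri (n * d) (a h) (b h) (c h))"
proof -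
  have "(\<Sum>q<r. tri n (pass d r U a (h * r + q)) (pass d r V b (h * r + q)) (pass d r W c (h * r + q))) =
    int N * tri (n * d) (a h) (b h) (c h)" for h
  proof -
    let ?P = "\<lambda>U a q x y. frob d (U q) (\<lambda>i j. a h (x * d + i) (y * d + j))"
    have "(\<Sum>q<r. tri n (pass d r U a (h * r + q)) (pass d r V b (h * r + q)) (pass d r W c (h * r + q))) =
      (\<Sum>q<r. \<Sum>x<n. \<Sum>y<n. \<Sum>z<n. ?P U a q x y * ?P V b q y z * ?P W c q x z)"
      by (rule sum.cong) (auto simp: tri_def pass_def)
    also have "\<dots> = (\<Sum>x<n. \<Sum>y<n. \<Sum>z<n. \<Sum>q<r. ?P U a q x y * ?P V b q y z * ?P W c q x z)"
      by (rule sum_swap_front4)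
    also have "\<dots> = int N * tri (n * d) (a h) (b h) (c h)"
      unfolding tri tri_mult by (simp only: sum_distrib_left)
    finally show ?thesis .
  qed
  then show ?thesis by (simp add: sum_lessThan_mult sum_distrib_left)
qed

text \<open>The induction keeps an arbitrary remaining size \<open>d ^ s\<close>. For
  \<open>s = 0\<close> the matrices have a single entry, and each form is one product of three
  numbers.\<close>

lemma sum_passes:
  fixes U V W :: "nat \<Rightarrow> nat \<Rightarrow> nat \<Rightarrow> int"
  assumes tri: "\<And>f g e. (\<Sum>h<r. frob d (U h) f * frob d (V h) g * frob d (W h) e) =
      int N * (\<Sum>i<d. \<Sum>j<d. \<Sum>l<d. f i j * g j l * e i l)"
  shows "(\<Sum>h<r ^ K. passes d r U K A h 0 0 * passes d r V K B h 0 0 * passes d r W K C h 0 0) =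
    int N ^ K * tri (d ^ K) A B C"
proof -
  have "(\<Sum>h<r ^ t. tri (d ^ s) (passes d r U t A h) (passes d r V t B h) (passes d r W t C h)) =
    int N ^ t * tri (d ^ (t + s)) A B C" for t s
  proof (induction t arbitrary: s)
    case (Suc t)
    then show ?case using sum_tri_pass[OF tri, where R = "r ^ t" and n = "d ^ s"] Suc[of "Suc s"] by (simp add: mult.commute)
  qed simp
  from this[of 0 K] show ?thesis by (simp add: tri_def)
qed

text \<open>The machine has no negative numbers, so a negative coefficient is replaced by a congruent one.
  No intermediate result is reduced modulo \<open>Q\<close>: without reduction the numbers still have only
  polylogarithmically many bits.\<close>

definition residue :: "nat \<Rightarrow> (nat \<Rightarrow> nat \<Rightarrow> nat \<Rightarrow> int) \<Rightarrow> nat \<Rightarrow> nat \<Rightarrow> nat \<Rightarrow> nat" where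
  "residue Q U h i j = nat (U h i j) + nat (- U h i j) * (Q - 1)"

lemma residue_cong:
  assumes "1 \<le> Q"
  shows "int Q dvd int (residue Q U h i j) - U h i j"
proof (cases "0 \<le> U h i j")
  case False
  then have "int (residue Q U h i j) - U h i j = int Q * (- U h i j)"
    using assms by (simp add: residue_def of_nat_diff algebra_simps)
  then show ?thesis by simp
qed (simp add: residue_def)

lemma dvd_diff_mult:
  fixes Q :: int
  assumes "Q dvd a - b" "Q dvd c - e"
  shows "Q dvd a * c - b * e"
proof -
  have "a * c - b * e = (a - b) * c + b * (c - e)" by (simp add: algebra_simps)
  then show ?thesis using assms by simp
qed

lemma dvd_diff_sum:
  fixes Q :: int
  assumes "\<And>x. x \<in> S \<Longrightarrow> Q dvd f x - g x"
  shows "Q dvd sum f S - sum g S"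
  unfolding sum_subtractf[symmetric] using assms by (rule dvd_sum)

lemma passes_residue_cong:
  assumes "1 \<le> Q"
  shows "int Q dvd int (passes d r (residue Q U) t A h x y) - passes d r U t (\<lambda>x y. int (A x y)) h x y"
proof (induction t arbitrary: h x y)
  case (Suc t)
  show ?case unfolding passes.simps pass_def frob_def of_nat_sum of_nat_mult
    by (intro dvd_diff_sum dvd_diff_mult residue_cong[OF assms] Suc.IH)
qed simp

text \<open>Each pass costs a factor \<open>d * d * g\<close>. With logarithmically many passes and
  polynomial \<open>g\<close> this means polylogarithmically many bits, which is why reductions can
  be avoided.\<close>

lemma passes_le:
  fixes U :: "nat \<Rightarrow> nat \<Rightarrow> nat \<Rightarrow> nat"
  assumes "\<And>h i j. h < r \<Longrightarrow> i < d \<Longrightarrow> j < d \<Longrightarrow> U h i j \<le> g" "\<And>x y. A x y \<le> 1" "0 < r"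
  shows "passes d r U t A h x y \<le> (d * d * g) ^ t"
proof (induction t arbitrary: h x y)
  case (Suc t)
  have "passes d r U (Suc t) A h x y \<le> (\<Sum>i<d. \<Sum>j<d. g * (d * d * g) ^ t)"
    unfolding passes.simps pass_def frob_def
    by (intro sum_mono mult_le_mono Suc.IH assms(1)) (use assms(3) in auto)
  also have "\<dots> = (d * d * g) ^ Suc t" by simp
  finally show ?case .
qed (use assms(2) in simp)

section \<open>The number of cliques in a random graph\<close>

definition edges_of :: "nat set \<Rightarrow> nat set set" where
  "edges_of S = {e. e \<subseteq> S \<and> card e = 2}"

lemma all_edges_eq: "all_edges n = edges_of {..<n}"
  by (simp add: all_edges_def edges_of_def)

lemma finite_edges_of: "finite S \<Longrightarrow> finite (edges_of S)"
  unfolding edges_of_def by (rule finite_subset[of _ "Pow S"]) auto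

lemma card_edges_of: "finite S \<Longrightarrow> card (edges_of S) = card S choose 2"
  unfolding edges_of_def by (rule n_subsets)

lemma edges_of_mono: "S \<subseteq> T \<Longrightarrow> edges_of S \<subseteq> edges_of T"
  by (auto simp: edges_of_def)

lemma edges_of_Int: "edges_of S \<inter> edges_of T = edges_of (S \<inter> T)"
  by (auto simp: edges_of_def)

definition vertex_sets :: "nat \<Rightarrow> nat \<Rightarrow> nat set set" where
  "vertex_sets j n = {S. S \<subseteq> {..<n} \<and> card S = j}"

lemma finite_vertex_sets: "finite (vertex_sets j n)"
  unfolding vertex_sets_def by (rule finite_subset[of _ "Pow {..<n}"]) auto

lemma cliques_eq: "cliques j n E = {S \<in> vertex_sets j n. edges_of S \<subseteq> E}"
proof -
  have "(\<forall>u\<in>S. \<forall>v\<in>S. u \<noteq> v \<longrightarrow> {u, v} \<in> E) \<longleftrightarrow> edges_of S \<subseteq> E" for S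
  proof
    assume h: "edges_of S \<subseteq> E"
    show "\<forall>u\<in>S. \<forall>v\<in>S. u \<noteq> v \<longrightarrow> {u, v} \<in> E"
    proof (intro ballI impI)
      fix u v assume "u \<in> S" "v \<in> S" "u \<noteq> v"
      then have "{u, v} \<in> edges_of S" by (simp add: edges_of_def)
      then show "{u, v} \<in> E" using h by blast
    qed
  qed (auto simp: edges_of_def card_2_iff)
  then show ?thesis by (simp add: cliques_def vertex_sets_def)
qed

lemma card_cliques_eq: "real (card (cliques j n E)) = (\<Sum>S\<in>vertex_sets j n. of_bool (edges_of S \<subseteq> E))"
  unfolding cliques_eq using finite_vertex_sets[of j n] by (simp add: sum.If_cases of_bool_def Int_def)

lemma set_pmf_erdos_renyi: "set_pmf (erdos_renyi n p) \<subseteq> Pow (all_edges n)"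
  by (auto simp: erdos_renyi_def)

lemma finite_set_pmf_erdos_renyi: "finite (set_pmf (erdos_renyi n p))"
  by (rule finite_subset[OF set_pmf_erdos_renyi]) (simp add: all_edges_eq finite_edges_of)

lemma integrable_erdos_renyi: "integrable (measure_pmf (erdos_renyi n p)) (f :: _ \<Rightarrow> real)"
  by (rule integrable_measure_pmf_finite[OF finite_set_pmf_erdos_renyi])

section \<open>Moments of the number of cliques\<close>

lemma prob_edges_present:
  assumes "F \<subseteq> all_edges n" "0 \<le> p" "p \<le> 1"
  shows "measure_pmf.expectation (erdos_renyi n p) (\<lambda>E. of_bool (F \<subseteq> E)) = p ^ card F"
proof -
  have fin: "finite (all_edges n)" by (simp add: all_edges_eq finite_edges_of)
  have "measure_pmf.expectation (erdos_renyi n p) (\<lambda>E. of_bool (F \<subseteq> E)) =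
    measure_pmf.expectation (erdos_renyi n p) (indicator {E. F \<subseteq> E})"
    by (intro arg_cong[where f = "measure_pmf.expectation (erdos_renyi n p)"] ext) (simp add: indicator_def)
  also have "\<dots> = measure (measure_pmf (erdos_renyi n p)) {E. F \<subseteq> E}" by simp
  also have "\<dots> = measure (Pi_pmf (all_edges n) False (\<lambda>_. bernoulli_pmf p)) {f. \<forall>e\<in>F. f e}"
    using assms(1) by (auto simp: erdos_renyi_def vimage_def intro!: arg_cong2[where f = measure])
  also have "{f. \<forall>e\<in>F. f e} = Pi (all_edges n) (\<lambda>e. if e \<in> F then {True} else UNIV)"
    using assms(1) by (auto simp: Pi_def)
  also have "measure (Pi_pmf (all_edges n) False (\<lambda>_. bernoulli_pmf p)) \<dots> =
    (\<Prod>e\<in>all_edges n. measure (bernoulli_pmf p) (if e \<in> F then {True} else UNIV))"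
    by (rule measure_Pi_pmf_Pi[OF fin])
  also have "\<dots> = (\<Prod>e\<in>all_edges n. if e \<in> F then p else 1)"
    using assms by (intro prod.cong) (auto simp: measure_pmf_single)
  also have "\<dots> = p ^ card F"
    using fin assms(1) by (simp add: prod.If_cases Int_absorb1)
  finally show ?thesis .
qed

text \<open>Edges of \<open>S\<close> that are already planted lie inside
  \<open>S \<inter> V\<close>.\<close>

lemma card_edges_of_Diff:
  assumes "finite S" "F \<subseteq> edges_of V"
  shows "(card S choose 2) - (card (S \<inter> V) choose 2) \<le> card (edges_of S - F)"
proof -
  have "card (edges_of S) - card (edges_of (S \<inter> V)) \<le> card (edges_of S - edges_of (S \<inter> V))"
    using assms(1) by (intro diff_card_le_card_Diff finite_edges_of) auto
  also have "\<dots> \<le> card (edges_of S - F)"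
    using assms edges_of_Int[of S V] by (intro card_mono) (auto simp: finite_edges_of)
  finally show ?thesis using assms(1) by (simp add: card_edges_of)
qed

text \<open>Once the intersection with \<open>V\<close> is prescribed, a set is determined by its
  part outside \<open>V\<close>.\<close>

lemma card_vertex_sets_Int_le: "card {S \<in> vertex_sets j n. S \<inter> V = T} \<le> (if card T \<le> j then n ^ (j - card T) else 0)"
proof (cases "card T \<le> j")
  case True
  have "card {S \<in> vertex_sets j n. S \<inter> V = T} \<le> card (vertex_sets (j - card T) n)"
  proof (rule card_inj_on_le[of "\<lambda>S. S - V"])
    show "inj_on (\<lambda>S. S - V) {S \<in> vertex_sets j n. S \<inter> V = T}"
      by (rule inj_onI) blast
    show "(\<lambda>S. S - V) ` {S \<in> vertex_sets j n. S \<inter> V = T} \<subseteq> vertex_sets (j - card T) n"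
    proof safe
      fix S assume "S \<in> vertex_sets j n" "T = S \<inter> V"
      then have "S \<subseteq> {..<n}" "card S = j" "finite S" by (auto simp: vertex_sets_def finite_subset)
      then show "S - V \<in> vertex_sets (j - card (S \<inter> V)) n"
        using card_Diff_subset_Int[of S V] by (auto simp: vertex_sets_def)
    qed
  qed (rule finite_vertex_sets)
  also have "\<dots> = n choose (j - card T)" unfolding vertex_sets_def by (simp add: n_subsets)
  also have "\<dots> \<le> n ^ (j - card T)"
    by (cases "j - card T \<le> n") (auto simp: binomial_le_pow binomial_eq_0)
  finally show ?thesis using True by simp
next
  case False
  have "S \<inter> V \<noteq> T" if "S \<in> vertex_sets j n" for S
    using False that card_mono[of S "S \<inter> V"] by (auto simp: vertex_sets_def finite_subset)
  then have "{S \<in> vertex_sets j n. S \<inter> V = T} = {}" by blast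
  then show ?thesis by (simp only: card.empty)
qed

text \<open>The sets \<open>S\<close> are grouped by their intersection with \<open>V\<close>. There
  are \<open>2 ^ card V\<close> groups, and the hypothesis bounds the total of each by
  \<open>B\<close>, whatever the size of the intersection.\<close>

lemma sum_vertex_sets_le:
  assumes "0 \<le> p" "p \<le> 1" "finite V" "F \<subseteq> edges_of V"
    and B: "\<And>s. s \<le> j \<Longrightarrow> real n ^ (j - s) * p ^ ((j choose 2) - (s choose 2)) \<le> B"
  shows "(\<Sum>S\<in>vertex_sets j n. p ^ card (edges_of S - F)) \<le> 2 ^ card V * B"
proof -
  define g where "g s = p ^ ((j choose 2) - (s choose 2))" for s
  have B0: "0 \<le> B" using B[of 0] assms(1) by (meson le0 mult_nonneg_nonneg of_nat_0_le_iff order_trans zero_le_power)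
  have "(\<Sum>S\<in>vertex_sets j n. p ^ card (edges_of S - F)) \<le> (\<Sum>S\<in>vertex_sets j n. g (card (S \<inter> V)))"
  proof (rule sum_mono)
    fix S assume "S \<in> vertex_sets j n"
    then have "finite S" "card S = j" by (auto simp: vertex_sets_def finite_subset)
    then show "p ^ card (edges_of S - F) \<le> g (card (S \<inter> V))"
      unfolding g_def using card_edges_of_Diff[OF _ assms(4), of S] assms(1,2) by (intro power_decreasing) auto
  qed
  also have "\<dots> = (\<Sum>T\<in>Pow V. \<Sum>S\<in>{S \<in> vertex_sets j n. S \<inter> V = T}. g (card (S \<inter> V)))"
    by (rule sum.group[symmetric]) (use assms(3) finite_vertex_sets in auto)
  also have "\<dots> = (\<Sum>T\<in>Pow V. real (card {S \<in> vertex_sets j n. S \<inter> V = T}) * g (card T))"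
    by (intro sum.cong refl) simp
  also have "\<dots> \<le> (\<Sum>T\<in>Pow V. B)"
  proof (rule sum_mono)
    fix T
    let ?c = "card {S \<in> vertex_sets j n. S \<inter> V = T}"
    show "real ?c * g (card T) \<le> B"
    proof (cases "card T \<le> j")
      case True
      then have "?c \<le> n ^ (j - card T)" using card_vertex_sets_Int_le[of j n V T] by simp
      then have "real ?c \<le> real n ^ (j - card T)" by (metis of_nat_le_iff of_nat_power)
      then have "real ?c * g (card T) \<le> real n ^ (j - card T) * g (card T)"
        unfolding g_def using assms(1) by (intro mult_right_mono) auto
      also have "\<dots> \<le> B" unfolding g_def by (rule B[OF True])
      finally show ?thesis .
    next
      case False
      then have "?c = 0" using card_vertex_sets_Int_le[of j n V T] by simp
      then show ?thesis using B0 by simp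
    qed
  qed
  also have "\<dots> = 2 ^ card V * B" using assms(3) by (simp add: card_Pow)
  finally show ?thesis .
qed

text \<open>The planted edges \<open>F\<close> make the induction on \<open>q\<close> possible: they absorb the cliques chosen so far.\<close>

lemma clique_moment_le:
  assumes "0 \<le> p" "p \<le> 1" "finite V" "V \<subseteq> {..<n}" "F \<subseteq> edges_of V"
    and B: "\<And>s. s \<le> j \<Longrightarrow> real n ^ (j - s) * p ^ ((j choose 2) - (s choose 2)) \<le> B"
  shows "measure_pmf.expectation (erdos_renyi n p)
      (\<lambda>E. of_bool (F \<subseteq> E) * real (card (cliques j n E)) ^ q)
    \<le> p ^ card F * (\<Prod>i<q. 2 ^ (card V + j * i) * B)"
  using assms(3-5)
proof (induction q arbitrary: V F)
  case 0
  then have "F \<subseteq> all_edges n" using edges_of_mono[of V "{..<n}"] by (auto simp: all_edges_eq)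
  from prob_edges_present[OF this assms(1,2)] show ?case by simp
next
  case (Suc q)
  let ?X = "\<lambda>E. real (card (cliques j n E))" and ?M = "erdos_renyi n p"
  have B0: "0 \<le> B" using B[of 0] assms(1) by (meson le0 mult_nonneg_nonneg of_nat_0_le_iff order_trans zero_le_power)
  \<comment> \<open>One factor of the power is written as a sum over vertex sets; each summand
    plants the edges of one more clique, which leaves the \<open>q\<close>-th power to the induction
    hypothesis.\<close>
  have "measure_pmf.expectation ?M (\<lambda>E. of_bool (F \<subseteq> E) * ?X E ^ Suc q) =
    measure_pmf.expectation ?M (\<lambda>E. \<Sum>S\<in>vertex_sets j n. of_bool (F \<union> edges_of S \<subseteq> E) * ?X E ^ q)"
    by (intro arg_cong[where f = "measure_pmf.expectation ?M"] ext)
      (simp add: card_cliques_eq[of j n] sum_distrib_left sum_distrib_right of_bool_conj algebra_simps)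
  also have "\<dots> = (\<Sum>S\<in>vertex_sets j n. measure_pmf.expectation ?M (\<lambda>E. of_bool (F \<union> edges_of S \<subseteq> E) * ?X E ^ q))"
    by (rule Bochner_Integration.integral_sum) (rule integrable_erdos_renyi)
  also have "\<dots> \<le> (\<Sum>S\<in>vertex_sets j n. p ^ card F * (\<Prod>i<q. 2 ^ (card V + j * Suc i) * B) * p ^ card (edges_of S - F))"
  proof (rule sum_mono)
    fix S assume "S \<in> vertex_sets j n"
    then have S: "finite S" "card S = j" "S \<subseteq> {..<n}" by (auto simp: vertex_sets_def finite_subset)
    have "F \<union> edges_of S \<subseteq> edges_of (V \<union> S)"
      using Suc.prems(3) edges_of_mono[of V "V \<union> S"] edges_of_mono[of S "V \<union> S"] by blast
    then have "measure_pmf.expectation ?M (\<lambda>E. of_bool (F \<union> edges_of S \<subseteq> E) * ?X E ^ q)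
      \<le> p ^ card (F \<union> edges_of S) * (\<Prod>i<q. 2 ^ (card (V \<union> S) + j * i) * B)"
      using Suc.IH[of "V \<union> S" "F \<union> edges_of S"] Suc.prems S by auto
    also have "\<dots> \<le> p ^ card (F \<union> edges_of S) * (\<Prod>i<q. 2 ^ (card V + j * Suc i) * B)"
    proof (intro mult_left_mono prod_mono conjI)
      fix i
      have "card (V \<union> S) + j * i \<le> card V + j * Suc i" using card_Un_le[of V S] S(2) by simp
      then show "2 ^ (card (V \<union> S) + j * i) * B \<le> 2 ^ (card V + j * Suc i) * B"
        using B0 by (intro mult_right_mono power_increasing) auto
    qed (use B0 assms(1) in auto)
    also have "card (F \<union> edges_of S) = card F + card (edges_of S - F)"
      using Suc.prems S card_Un_disjoint[of F "edges_of S - F"] finite_edges_of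
      by (metis Diff_disjoint Un_Diff_cancel finite_Diff finite_subset)
    finally show "measure_pmf.expectation ?M (\<lambda>E. of_bool (F \<union> edges_of S \<subseteq> E) * ?X E ^ q)
      \<le> p ^ card F * (\<Prod>i<q. 2 ^ (card V + j * Suc i) * B) * p ^ card (edges_of S - F)"
      by (simp add: power_add algebra_simps)
  qed
  also have "\<dots> = p ^ card F * (\<Prod>i<q. 2 ^ (card V + j * Suc i) * B) * (\<Sum>S\<in>vertex_sets j n. p ^ card (edges_of S - F))"
    by (simp add: sum_distrib_left)
  also have "\<dots> \<le> p ^ card F * (\<Prod>i<q. 2 ^ (card V + j * Suc i) * B) * (2 ^ card V * B)"
    using Suc.prems B0 assms(1) sum_vertex_sets_le[OF assms(1,2) Suc.prems(1,3) B]
    by (intro mult_left_mono mult_nonneg_nonneg prod_nonneg) auto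
  also have "\<dots> = p ^ card F * (\<Prod>i<Suc q. 2 ^ (card V + j * i) * B)"
    by (subst prod.lessThan_Suc_shift) (simp add: algebra_simps)
  finally show ?case .
qed

text \<open>Markov's inequality for the \<open>q\<close>-th power, with no planted edges. The
  factors \<open>2 ^ (j * i)\<close> are crudely replaced by the largest possible one; they depend
  on \<open>q\<close> but not on \<open>n\<close>.\<close>

lemma prob_many_cliques_le:
  assumes "0 \<le> p" "p \<le> 1" "0 < D"
    and B: "\<And>s. s \<le> j \<Longrightarrow> real n ^ (j - s) * p ^ ((j choose 2) - (s choose 2)) \<le> B"
  shows "measure (erdos_renyi n p) {E. D < real (card (cliques j n E))} \<le> 2 ^ (j * q * q) * (B / D) ^ q"
proof -
  let ?X = "\<lambda>E. real (card (cliques j n E))" and ?M = "erdos_renyi n p"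
  have B0: "0 \<le> B" using B[of 0] assms(1) by (meson le0 mult_nonneg_nonneg of_nat_0_le_iff order_trans zero_le_power)
  have "measure ?M {E. D < ?X E} = measure_pmf.expectation ?M (indicator {E. D < ?X E})" by simp
  also have "\<dots> \<le> measure_pmf.expectation ?M (\<lambda>E. ?X E ^ q / D ^ q)"
  proof (rule integral_mono[OF integrable_erdos_renyi integrable_erdos_renyi])
    fix E
    have "1 \<le> ?X E ^ q / D ^ q" if "D < ?X E"
      using that assms(3) by (simp add: power_mono)
    then show "indicator {E. D < ?X E} E \<le> ?X E ^ q / D ^ q" using assms(3) by (auto simp: indicator_def)
  qed
  also have "\<dots> = measure_pmf.expectation ?M (\<lambda>E. of_bool ({} \<subseteq> E) * ?X E ^ q) / D ^ q" by simp
  also have "\<dots> \<le> (p ^ card ({} :: nat set set) * (\<Prod>i<q. 2 ^ (card ({} :: nat set) + j * i) * B)) / D ^ q"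
    using assms(3) by (intro divide_right_mono clique_moment_le[OF assms(1,2) _ _ _ B]) auto
  also have "\<dots> = (\<Prod>i<q. 2 ^ (j * i) * B) / D ^ q" by simp
  also have "\<dots> \<le> (\<Prod>i<q. 2 ^ (j * q) * B) / D ^ q"
    using B0 assms(3) by (intro divide_right_mono prod_mono conjI mult_right_mono power_increasing) auto
  also have "\<dots> = 2 ^ (j * q * q) * (B / D) ^ q"
    by (simp add: power_mult_distrib power_divide power_mult[symmetric])
  finally show ?thesis .
qed

text \<open>The exponent of n in the expected number of s-cliques, up to a constant factor, at edge
  probability n to the power -\<alpha>.\<close>

definition clique_exponent :: "real \<Rightarrow> nat \<Rightarrow> real" where
  "clique_exponent \<alpha> s = real s - \<alpha> * real (s choose 2)"

lemma choose_2_real: "real (s choose 2) = real s * (real s - 1) / 2"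
proof (cases s)
  case (Suc t)
  have "2 * (s choose 2) = s * (s - 1)"
    unfolding choose_two by (rule dvd_mult_div_cancel) (cases s; auto)
  then have "2 * real (s choose 2) = real s * real (s - 1)" by (metis of_nat_mult of_nat_numeral)
  then show ?thesis using Suc by simp
qed simp

text \<open>The difference factors as (j - s) (1 - \<alpha> (j + s - 1) / 2), and j + s - 1 \<le> 2
  (j - 1) when s < j.\<close>

lemma clique_exponent_mono:
  assumes "s \<le> j" "0 \<le> \<alpha>" "\<alpha> * (real j - 1) \<le> 1"
  shows "clique_exponent \<alpha> s \<le> clique_exponent \<alpha> j"
proof (cases "s = j")
  case False
  have "clique_exponent \<alpha> j - clique_exponent \<alpha> s = (real j - real s) * (1 - \<alpha> * (real j + real s - 1) / 2)"
    unfolding clique_exponent_def choose_2_real by (simp add: field_simps)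
  moreover have "\<alpha> * (real j + real s - 1) \<le> \<alpha> * (2 * (real j - 1))"
    using assms(1,2) False by (intro mult_left_mono) auto
  then have "\<alpha> * (real j + real s - 1) \<le> 2" using assms(3) by (simp add: algebra_simps)
  then have "0 \<le> (real j - real s) * (1 - \<alpha> * (real j + real s - 1) / 2)"
    using assms(1) by (intro mult_nonneg_nonneg) auto
  ultimately show ?thesis by simp
qed simp

lemma clique_exponent_nonneg:
  assumes "0 \<le> \<alpha>" "\<alpha> * (real j - 1) \<le> 1"
  shows "0 \<le> clique_exponent \<alpha> j"
  using clique_exponent_mono[of 0 j \<alpha>] assms by (simp add: clique_exponent_def numeral_2_eq_2)

text \<open>The power of n that arises is the exponent of j minus that of s, and the latter is
  nonnegative. Taking \<open>1 \<le> C\<close> allows one constant for all s.\<close>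

lemma expected_extensions_le:
  assumes "s \<le> j" "0 \<le> \<alpha>" "\<alpha> * (real j - 1) \<le> 1" "1 \<le> C" "0 \<le> p" "p \<le> C * real n powr (-\<alpha>)" "1 \<le> n"
  shows "real n ^ (j - s) * p ^ ((j choose 2) - (s choose 2)) \<le> C ^ (j choose 2) * real n powr clique_exponent \<alpha> j"
proof -
  let ?e = "(j choose 2) - (s choose 2)"
  have e: "real ?e = real (j choose 2) - real (s choose 2)"
    using assms(1) by (simp add: of_nat_diff binomial_right_mono)
  have "p ^ ?e \<le> (C * real n powr (-\<alpha>)) ^ ?e" using assms by (intro power_mono) auto
  also have "\<dots> = C ^ ?e * real n powr (-\<alpha> * real ?e)"
    using assms(7) by (simp add: power_mult_distrib powr_realpow[symmetric] powr_powr)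
  also have "\<dots> \<le> C ^ (j choose 2) * real n powr (-\<alpha> * real ?e)"
    using assms(4) by (intro mult_right_mono power_increasing) auto
  finally have "real n ^ (j - s) * p ^ ?e \<le> real n ^ (j - s) * (C ^ (j choose 2) * real n powr (-\<alpha> * real ?e))"
    by (rule mult_left_mono) simp
  also have "\<dots> = C ^ (j choose 2) * (real n powr real (j - s) * real n powr (-\<alpha> * real ?e))"
    using assms(7) by (simp add: powr_realpow)
  also have "\<dots> = C ^ (j choose 2) * real n powr (clique_exponent \<alpha> j - clique_exponent \<alpha> s)"
    unfolding powr_add[symmetric] e clique_exponent_def using assms(1) by (simp add: of_nat_diff algebra_simps)
  also have "\<dots> \<le> C ^ (j choose 2) * real n powr clique_exponent \<alpha> j"
  proof -
    have "\<alpha> * (real s - 1) \<le> \<alpha> * (real j - 1)" using assms by (intro mult_left_mono) auto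
    then have "0 \<le> clique_exponent \<alpha> s" using assms by (intro clique_exponent_nonneg) auto
    then show ?thesis using assms(4,7) by (intro mult_left_mono powr_mono) auto
  qed
  finally show ?thesis .
qed

section \<open>Superpolynomial decay of the failure probability\<close>

lemma superpoly_smallI:
  assumes "\<And>a. \<exists>K. \<forall>\<^sub>F n in sequentially. \<bar>f n\<bar> \<le> K * real n powr (-a)"
  shows "superpoly_small f"
  unfolding superpoly_small_def
proof
  fix a :: real
  obtain K where "\<forall>\<^sub>F n in sequentially. \<bar>f n\<bar> \<le> K * real n powr (-(a + 1))" using assms by blast
  then have "f \<in> O(\<lambda>n. real n powr (-(a + 1)))" by (intro bigoI[of _ K]) simp
  also have "(\<lambda>n. real n powr (-(a + 1))) \<in> o(\<lambda>n. real n powr (-a))"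
  proof (rule smalloI_tendsto)
    show "((\<lambda>n. real n powr (-(a + 1)) / real n powr (-a)) \<longlongrightarrow> 0) sequentially"
    proof (rule Lim_transform_eventually)
      show "(\<lambda>n. 1 / real n) \<longlonglongrightarrow> 0" by (rule lim_1_over_n)
      show "\<forall>\<^sub>F n in sequentially. 1 / real n = real n powr (-(a + 1)) / real n powr (-a)"
        using eventually_gt_at_top[of 0]
      proof eventually_elim
        case (elim n)
        have "real n powr (-(a + 1)) / real n powr (-a) = real n powr (-1)"
          by (simp add: powr_diff[symmetric])
        then show ?case using elim by (simp add: powr_minus_divide)
      qed
    qed
    show "\<forall>\<^sub>F n in sequentially. real n powr (-a) \<noteq> 0"
      using eventually_gt_at_top[of 0] by eventually_elim simp
  qed
  finally show "f \<in> o(\<lambda>n. real n powr (-a))" .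
qed

lemma superpoly_small_mono:
  assumes "superpoly_small g" "\<forall>\<^sub>F n in sequentially. \<bar>f n\<bar> \<le> \<bar>g n\<bar>"
  shows "superpoly_small f"
proof -
  have "f \<in> O(g)" using assms(2) by (intro bigoI[of _ 1]) simp
  then show ?thesis using assms(1) unfolding superpoly_small_def by (meson landau_o.big_small_trans)
qed

lemma superpoly_small_add:
  "superpoly_small f \<Longrightarrow> superpoly_small g \<Longrightarrow> superpoly_small (\<lambda>n. f n + g n)"
  unfolding superpoly_small_def by (auto intro: sum_in_smallo)

lemma many_cliques_superpoly_small:
  fixes D :: "nat \<Rightarrow> real"
  assumes "0 \<le> \<alpha>" "\<alpha> * (real j - 1) \<le> 1" "\<And>n. 0 \<le> c n \<and> c n \<le> 1"
    and "c \<in> O(\<lambda>n. real n powr (-\<alpha>))"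
    and D: "\<forall>\<^sub>F n in sequentially. real n powr (clique_exponent \<alpha> j + \<delta>) \<le> D n" and "0 < \<delta>"
  shows "superpoly_small (\<lambda>n. measure (erdos_renyi n (c n)) {E. D n < real (card (cliques j n E))})"
proof (rule superpoly_smallI)
  fix a :: real
  obtain C0 where C0: "\<forall>\<^sub>F n in sequentially. norm (c n) \<le> C0 * norm (real n powr (-\<alpha>))"
    using assms(4) by (auto elim: landau_o.bigE)
  define C where "C = max 1 C0"
  define K where "K = C ^ (j choose 2)"
  \<comment> \<open>The \<open>q\<close>-th moment gives n to the power -\<delta> q, so
    \<open>q\<close> is chosen from \<open>a\<close> alone. Since it is fixed before n, the factor
    exponential in \<open>q\<close> is a constant.\<close>
  obtain q :: nat where q: "a / \<delta> \<le> real q" using real_arch_simple by blast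
  then have q': "a \<le> \<delta> * real q" using assms(6) by (simp add: field_simps)
  have "\<forall>\<^sub>F n in sequentially. \<bar>measure (erdos_renyi n (c n)) {E. D n < real (card (cliques j n E))}\<bar>
    \<le> 2 ^ (j * q * q) * K ^ q * real n powr (-a)"
    using C0 D eventually_ge_at_top[of 1]
  proof eventually_elim
    case (elim n)
    let ?\<mu> = "clique_exponent \<alpha> j"
    have "c n \<le> C * real n powr (-\<alpha>)"
      using elim(1) assms(3)[of n] mult_right_mono[of C0 C "real n powr (-\<alpha>)"] by (auto simp: C_def)
    then have B: "real n ^ (j - s) * c n ^ ((j choose 2) - (s choose 2)) \<le> K * real n powr ?\<mu>" if "s \<le> j" for s
      unfolding K_def using that assms elim(3) by (intro expected_extensions_le) (auto simp: C_def)
    have pos: "0 < real n powr (?\<mu> + \<delta>)" using elim(3) by simp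
    then have Dpos: "0 < D n" using elim(2) by linarith
    have K: "0 \<le> K" by (simp add: K_def C_def)
    have "measure (erdos_renyi n (c n)) {E. D n < real (card (cliques j n E))} \<le>
      2 ^ (j * q * q) * (K * real n powr ?\<mu> / D n) ^ q"
      using assms(3)[of n] Dpos B by (intro prob_many_cliques_le) auto
    also have "\<dots> \<le> 2 ^ (j * q * q) * (K * real n powr ?\<mu> / real n powr (?\<mu> + \<delta>)) ^ q"
      using K elim(2) pos Dpos by (intro mult_left_mono power_mono divide_left_mono) auto
    also have "K * real n powr ?\<mu> / real n powr (?\<mu> + \<delta>) = K * real n powr (-\<delta>)"
      using pos by (simp add: powr_add powr_minus field_simps)
    also have "(K * real n powr (-\<delta>)) ^ q = K ^ q * real n powr (-(\<delta> * real q))"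
      using elim(3) by (simp add: power_mult_distrib powr_realpow[symmetric] powr_powr)
    also have "2 ^ (j * q * q) * (K ^ q * real n powr (-(\<delta> * real q))) \<le> 2 ^ (j * q * q) * (K ^ q * real n powr (-a))"
      using K q' elim(3) by (intro mult_left_mono powr_mono) auto
    finally show ?case by simp
  qed
  then show "\<exists>K. \<forall>\<^sub>F n in sequentially. \<bar>measure (erdos_renyi n (c n)) {E. D n < real (card (cliques j n E))}\<bar>
    \<le> K * real n powr (-a)" by blast
qed

section \<open>Codes of cliques\<close>

definition digit :: "nat \<Rightarrow> nat \<Rightarrow> nat \<Rightarrow> nat" where
  "digit n t x = x div n ^ t mod n"

text \<open>The digits in base n, least significant first, are the vertices. Demanding that they
  increase gives every clique exactly one code, so that no division by permutations is needed in the
  count.\<close>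

definition clique_code :: "(nat \<Rightarrow> nat \<Rightarrow> bool) \<Rightarrow> nat \<Rightarrow> nat \<Rightarrow> nat \<Rightarrow> bool" where
  "clique_code R n j x \<longleftrightarrow> (\<forall>t<j. \<forall>s<t. digit n s x < digit n t x \<and> R (digit n s x) (digit n t x))"

primrec encode :: "nat \<Rightarrow> nat list \<Rightarrow> nat" where
  "encode n [] = 0"
| "encode n (a # as) = a + n * encode n as"

lemma encode_less: "set as \<subseteq> {..<n} \<Longrightarrow> encode n as < n ^ length as"
proof (induction as)
  case (Cons a as)
  then have "a < n" "encode n as + 1 \<le> n ^ length as" by auto
  then have "a + n * encode n as < n * (encode n as + 1)" by simp
  also have "\<dots> \<le> n * n ^ length as" using \<open>encode n as + 1 \<le> _\<close> by (rule mult_le_mono2)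
  finally show ?case by simp
qed simp

lemma digit_encode: "set as \<subseteq> {..<n} \<Longrightarrow> t < length as \<Longrightarrow> digit n t (encode n as) = as ! t"
proof (induction as arbitrary: t)
  case (Cons a as)
  then have "a < n" by simp
  show ?case
  proof (cases t)
    case 0
    then show ?thesis using \<open>a < n\<close> by (simp add: digit_def)
  next
    case (Suc u)
    have "(a + n * encode n as) div n ^ t = (a + n * encode n as) div n div n ^ u"
      by (simp add: Suc div_mult2_eq)
    also have "(a + n * encode n as) div n = encode n as" using \<open>a < n\<close> by simp
    finally show ?thesis using Cons Suc by (simp add: digit_def)
  qed
qed simp

lemma encode_digits: "x < n ^ j \<Longrightarrow> encode n (map (\<lambda>t. digit n t x) [0..<j]) = x"
proof (induction j arbitrary: x)
  case (Suc j)
  have x: "x div n < n ^ j" using Suc.prems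
    by (metis less_mult_imp_div_less mult.commute power_Suc)
  have "map (\<lambda>t. digit n t x) [0..<Suc j] = digit n 0 x # map (\<lambda>t. digit n t (x div n)) [0..<j]"
    by (simp del: upt_Suc add: upt_conv_Cons map_Suc_upt[symmetric] digit_def div_mult2_eq[symmetric])
  then have "encode n (map (\<lambda>t. digit n t x) [0..<Suc j]) = digit n 0 x + n * (x div n)"
    using Suc.IH[OF x] by simp
  then show ?case by (simp add: digit_def)
qed simp

lemma digit_less: "0 < n \<Longrightarrow> digit n t x < n"
  by (simp add: digit_def)

lemma digit_add_mult:
  assumes "x < n ^ m"
  shows "digit n t (x + n ^ m * w) = (if t < m then digit n t x else digit n (t - m) w)"
proof (cases "t < m")
  case True
  then have nm: "n ^ m = n ^ t * (n * n ^ (m - t - 1))"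
    by (metis Suc_diff_Suc add_diff_inverse_nat diff_Suc_eq_diff_pred diff_zero less_imp_not_less power_Suc power_add
      Suc_eq_plus1 diff_diff_left)
  have n0: "0 < n ^ t" using assms True by (cases "n = 0") (auto simp: power_0_left)
  have "(x + n ^ m * w) div n ^ t = x div n ^ t + n * (n ^ (m - t - 1) * w)"
    unfolding nm using n0 by (simp add: mult.assoc)
  then show ?thesis using True by (simp add: digit_def)
next
  case False
  have "(x + n ^ m * w) div n ^ t = (x + n ^ m * w) div n ^ m div n ^ (t - m)"
    using False by (metis div_mult2_eq le_add_diff_inverse linorder_not_less power_add)
  also have "(x + n ^ m * w) div n ^ m = w" using assms by (metis add.right_neutral div_less div_mult_self2 less_nat_zero_code add.commute)
  finally show ?thesis using False by (simp add: digit_def)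
qed

lemma clique_code_cong:
  assumes "\<And>u v. u < n \<Longrightarrow> v < n \<Longrightarrow> R u v = R' u v" "0 < n"
  shows "clique_code R n j x = clique_code R' n j x"
  unfolding clique_code_def using assms digit_less[of n] by auto

abbreviation adjacent :: "nat set set \<Rightarrow> nat \<Rightarrow> nat \<Rightarrow> bool" where
  "adjacent E u v \<equiv> {u, v} \<in> E"

lemma card_clique_codes:
  assumes "0 < n"
  shows "card {x. x < n ^ j \<and> clique_code (adjacent E) n j x} = card (cliques j n E)"
proof -
  let ?d = "\<lambda>x. map (\<lambda>t. digit n t x) [0..<j]"
  have sorted: "sorted_wrt (<) (?d x)" if "clique_code (adjacent E) n j x" for x
    using that by (auto simp: sorted_wrt_iff_nth_less clique_code_def)
  have "bij_betw (\<lambda>x. set (?d x)) {x. x < n ^ j \<and> clique_code (adjacent E) n j x} (cliques j n E)"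
    unfolding bij_betw_def
  proof
    show "inj_on (\<lambda>x. set (?d x)) {x. x < n ^ j \<and> clique_code (adjacent E) n j x}"
    proof (rule inj_onI)
      fix x y assume x: "x \<in> {x. x < n ^ j \<and> clique_code (adjacent E) n j x}"
        and y: "y \<in> {x. x < n ^ j \<and> clique_code (adjacent E) n j x}" and eq: "set (?d x) = set (?d y)"
      have "?d x = ?d y"
        using sorted[of x] sorted[of y] x y eq strict_sorted_equal by blast
      moreover have "encode n (?d x) = x" "encode n (?d y) = y" using x y by (auto intro: encode_digits)
      ultimately show "x = y" by metis
    qed
    show "(\<lambda>x. set (?d x)) ` {x. x < n ^ j \<and> clique_code (adjacent E) n j x} = cliques j n E"
    proof (intro equalityI subsetI)
      fix S assume "S \<in> (\<lambda>x. set (?d x)) ` {x. x < n ^ j \<and> clique_code (adjacent E) n j x}"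
      then obtain x where S: "S = set (?d x)" and x: "clique_code (adjacent E) n j x" by blast
      have "distinct (?d x)" using sorted[OF x] by (simp only: strict_sorted_iff)
      then have "card S = j" unfolding S by (simp only: distinct_card) simp
      moreover have "S \<subseteq> {..<n}" using digit_less[OF assms] by (auto simp: S)
      moreover have "{u, v} \<in> E" if uv: "u \<in> S" "v \<in> S" "u \<noteq> v" for u v
      proof -
        obtain s t where st: "s < j" "t < j" "u = digit n s x" "v = digit n t x" using uv by (auto simp: S)
        then have "s \<noteq> t" using uv(3) by auto
        then consider "s < t" | "t < s" by linarith
        then show ?thesis using x st by cases (auto simp: clique_code_def insert_commute)
      qed
      ultimately show "S \<in> cliques j n E" by (simp add: cliques_def)
    next
      fix S assume S: "S \<in> cliques j n E"
      define xs where "xs = sorted_list_of_set S"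
      have fin: "finite S" using S by (auto simp: cliques_def finite_subset)
      have xs: "set xs = S" "length xs = j" "sorted_wrt (<) xs"
        using fin S by (auto simp: xs_def cliques_def)
      have sub: "set xs \<subseteq> {..<n}" using S xs by (simp add: cliques_def)
      have d: "?d (encode n xs) = xs"
        by (rule nth_equalityI) (use xs digit_encode[OF sub] in auto)
      have "clique_code (adjacent E) n j (encode n xs)"
        unfolding clique_code_def
      proof (intro allI impI)
        fix t s assume st: "t < j" "s < t"
        have lt: "xs ! s < xs ! t" using xs st by (simp add: sorted_wrt_iff_nth_less)
        have "xs ! s \<in> S" "xs ! t \<in> S" using xs st by (auto simp flip: xs(1))
        then have "{xs ! s, xs ! t} \<in> E" using S lt by (auto simp: cliques_def)
        then show "digit n s (encode n xs) < digit n t (encode n xs) \<and>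
          {digit n s (encode n xs), digit n t (encode n xs)} \<in> E"
          using lt digit_encode[OF sub] xs(2) st by simp
      qed
      moreover have "encode n xs < n ^ j" using encode_less[OF sub] xs(2) by simp
      ultimately show "S \<in> (\<lambda>x. set (?d x)) ` {x. x < n ^ j \<and> clique_code (adjacent E) n j x}"
        using d xs(1) by (intro image_eqI[of _ _ "encode n xs"]) auto
    qed
  qed
  then show ?thesis by (rule bij_betw_same_card)
qed

lemma clique_code_parts:
  assumes "clique_code R n (m + j) (x + n ^ m * y)" "x < n ^ m"
  shows "clique_code R n m x" "clique_code R n j y"
proof -
  show "clique_code R n m x"
    unfolding clique_code_def
  proof (intro allI impI)
    fix t s assume "t < m" "s < t"
    then show "digit n s x < digit n t x \<and> R (digit n s x) (digit n t x)"
      using assms(1)[unfolded clique_code_def digit_add_mult[OF assms(2)], rule_format, of t s] by auto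
  qed
  show "clique_code R n j y"
    unfolding clique_code_def
  proof (intro allI impI)
    fix t s assume "t < j" "s < t"
    then show "digit n s y < digit n t y \<and> R (digit n s y) (digit n t y)"
      using assms(1)[unfolded clique_code_def digit_add_mult[OF assms(2)], rule_format, of "m + t" "m + s"] by auto
  qed
qed

text \<open>A code is a conjunction of conditions on pairs of positions, and any two positions of
  xyz lie in one of the pairs xy, yz, xz.\<close>

lemma clique_code_split3:
  assumes "x < n ^ m" "y < n ^ m" "0 < m"
  shows "clique_code R n (m + (m + j)) (x + n ^ m * (y + n ^ m * z)) \<longleftrightarrow>
    clique_code R n (m + m) (x + n ^ m * y) \<and> clique_code R n (m + j) (y + n ^ m * z) \<and>
    clique_code R n (m + j) (x + n ^ m * z)" (is "?L \<longleftrightarrow> ?A \<and> ?B \<and> ?C")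
proof -
  define P where "P u v \<longleftrightarrow> u < v \<and> R u v" for u v
  have cc: "clique_code R n l w \<longleftrightarrow> (\<forall>t<l. \<forall>s<t. P (digit n s w) (digit n t w))" for l w
    by (simp add: clique_code_def P_def)
  note dg = digit_add_mult[OF assms(1)] digit_add_mult[OF assms(2)]
  show ?thesis
  proof
    assume L: ?L
    have B: ?B using clique_code_parts(2)[OF L assms(1)] .
    have A: ?A unfolding cc dg
    proof (intro allI impI)
      fix t s assume "t < m + m" "s < t"
      then show "P (if s < m then digit n s x else digit n (s - m) y) (if t < m then digit n t x else digit n (t - m) y)"
        using L[unfolded cc dg, rule_format, of t s] by (auto split: if_splits)
    qed
    have C: ?C unfolding cc dg
    proof (intro allI impI)
      fix t s assume ts: "t < m + j" "s < t"
      \<comment> \<open>In xz the digits of z follow x directly, whereas in xyz they come m places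
        later; hence the shift of positions from \<open>m\<close> on.\<close>
      show "P (if s < m then digit n s x else digit n (s - m) z) (if t < m then digit n t x else digit n (t - m) z)"
        using L[unfolded cc dg, rule_format, of "if t < m then t else t + m" "if s < m then s else s + m"] ts
        by (auto split: if_splits)
    qed
    show "?A \<and> ?B \<and> ?C" using A B C by blast
  next
    assume ABC: "?A \<and> ?B \<and> ?C"
    then have A: ?A and B: ?B and C: ?C by auto
    show ?L unfolding cc dg
    proof (intro allI impI)
      fix t s assume ts: "t < m + (m + j)" "s < t"
      show "P (if s < m then digit n s x else if s - m < m then digit n (s - m) y else digit n (s - m - m) z)
         (if t < m then digit n t x else if t - m < m then digit n (t - m) y else digit n (t - m - m) z)"
      proof (cases "t < m + m")
        case True
        then show ?thesis using A[unfolded cc dg, rule_format, of t s] ts by (auto split: if_splits)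
      next
        case False
        show ?thesis
        proof (cases "s < m")
          case True
          then show ?thesis using C[unfolded cc dg, rule_format, of "t - m" s] ts False by (auto split: if_splits)
        next
          case s: False
          then show ?thesis using B[unfolded cc dg, rule_format, of "t - m" "s - m"] ts False by (auto split: if_splits)
        qed
      qed
    qed
  qed
qed

lemma sum_lessThan_mult':
  fixes f :: "nat \<Rightarrow> 'a::comm_monoid_add"
  shows "(\<Sum>x<a * b. f x) = (\<Sum>i<a. \<Sum>q<b. f (i + a * q))"
  using sum_lessThan_mult[of f b a] by (subst sum.swap) (simp add: mult.commute add.commute)

lemma card_cliques_eq_sum:
  assumes "0 < n" "0 < m"
  shows "card (cliques (m + (m + j)) n E) =
    (\<Sum>x<n ^ m. \<Sum>y<n ^ m. \<Sum>z<n ^ j. of_bool (clique_code (adjacent E) n (m + m) (x + n ^ m * y)) *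
       of_bool (clique_code (adjacent E) n (m + j) (y + n ^ m * z)) *
       of_bool (clique_code (adjacent E) n (m + j) (x + n ^ m * z)))"
proof -
  let ?k = "m + (m + j)" and ?c = "clique_code (adjacent E) n"
  have "card (cliques ?k n E) = card {x. x < n ^ ?k \<and> ?c ?k x}" using card_clique_codes[OF assms(1)] by simp
  also have "\<dots> = (\<Sum>x<n ^ ?k. of_bool (?c ?k x))"
    by (simp add: sum.If_cases of_bool_def Int_def)
  also have "\<dots> = (\<Sum>x<n ^ m. \<Sum>y<n ^ m. \<Sum>z<n ^ j. of_bool (?c ?k (x + n ^ m * (y + n ^ m * z))))"
    by (simp only: power_add sum_lessThan_mult')
  also have "\<dots> = (\<Sum>x<n ^ m. \<Sum>y<n ^ m. \<Sum>z<n ^ j. of_bool (?c (m + m) (x + n ^ m * y)) *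
       of_bool (?c (m + j) (y + n ^ m * z)) * of_bool (?c (m + j) (x + n ^ m * z)))"
    using assms(2) by (intro sum.cong refl) (simp add: clique_code_split3 of_bool_conj del: One_nat_def)
  finally show ?thesis .
qed

definition codes :: "nat set set \<Rightarrow> nat \<Rightarrow> nat \<Rightarrow> nat list" where
  "codes E n j = filter (clique_code (adjacent E) n j) [0..<n ^ j]"

lemma length_codes: "0 < n \<Longrightarrow> length (codes E n j) = card (cliques j n E)"
proof -
  assume "0 < n"
  have "length (codes E n j) = card (set (codes E n j))" by (subst distinct_card) (simp_all add: codes_def)
  also have "set (codes E n j) = {x. x < n ^ j \<and> clique_code (adjacent E) n j x}" by (auto simp: codes_def)
  finally show ?thesis using card_clique_codes[OF \<open>0 < n\<close>] by simp
qed

text \<open>Turns a sum over all tuples into one over list positions, padded with zeros to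
  \<open>D\<close> terms, as the summation over a row or column of the square matrix
  requires.\<close>

lemma sum_codes:
  fixes f :: "nat \<Rightarrow> 'a::comm_monoid_add"
  assumes "\<And>x. x < n ^ j \<Longrightarrow> \<not> clique_code (adjacent E) n j x \<Longrightarrow> f x = 0"
    and "length (codes E n j) \<le> D"
  shows "(\<Sum>x<n ^ j. f x) = (\<Sum>i<D. if i < length (codes E n j) then f (codes E n j ! i) else 0)"
proof -
  have "(\<Sum>x<n ^ j. f x) = (\<Sum>x\<in>set (codes E n j). f x)"
    by (rule sum.mono_neutral_right) (use assms(1) in \<open>auto simp: codes_def\<close>)
  also have "\<dots> = sum_list (map f (codes E n j))"
    by (rule sum.distinct_set_conv_list) (simp add: codes_def)
  also have "\<dots> = (\<Sum>i<length (codes E n j). f (codes E n j ! i))"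
    by (simp add: sum_list_sum_nth atLeast0LessThan)
  also have "\<dots> = (\<Sum>i<D. if i < length (codes E n j) then f (codes E n j ! i) else 0)"
    by (rule sum.mono_neutral_cong_left) (use assms(2) in auto)
  finally show ?thesis .
qed

section \<open>The counting program\<close>

abbreviation seq_stmt (infixr ";;" 60) where "p ;; q \<equiv> Then p q"
abbreviation add_expr (infixl "\<oplus>" 65) where "x \<oplus> y \<equiv> Op Add x y"
abbreviation sub_expr (infixl "\<ominus>" 65) where "x \<ominus> y \<equiv> Op Sub x y"
abbreviation mul_expr (infixl "\<otimes>" 70) where "x \<otimes> y \<equiv> Op Mul x y"
abbreviation div_expr (infixl "\<oslash>" 70) where "x \<oslash> y \<equiv> Op Div x y"

text \<open>Truncated subtraction makes \<open>y \<ominus> x\<close> nonzero exactly if x < y, and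
  subtracting twice from 1 normalises it to 0 or 1. Tests as factors replace conditionals
  throughout.\<close>

definition less_expr :: "expr \<Rightarrow> expr \<Rightarrow> expr" where
  "less_expr x y = Num 1 \<ominus> (Num 1 \<ominus> (y \<ominus> x))"

lemma eval_less_expr [simp]: "eval (less_expr x y) s = of_bool (eval x s < eval y s)"
  by (simp add: less_expr_def)

definition eq_expr :: "expr \<Rightarrow> expr \<Rightarrow> expr" where
  "eq_expr x y = Num 1 \<ominus> ((x \<ominus> y) \<oplus> (y \<ominus> x))"

lemma eval_eq_expr [simp]: "eval (eq_expr x y) s = of_bool (eval x s = eval y s)"
  by (simp add: eq_expr_def)

definition mod_expr :: "expr \<Rightarrow> expr \<Rightarrow> expr" where
  "mod_expr x y = x \<ominus> (x \<oslash> y) \<otimes> y"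

lemma eval_mod_expr [simp]: "eval (mod_expr x y) s = eval x s mod eval y s"
  by (simp add: mod_expr_def minus_div_mult_eq_mod)

primrec power_expr :: "expr \<Rightarrow> nat \<Rightarrow> expr" where
  "power_expr x 0 = Num 1"
| "power_expr x (Suc t) = x \<otimes> power_expr x t"

lemma eval_power_expr [simp]: "eval (power_expr x t) s = eval x s ^ t"
  by (induction t) auto

definition prod_expr :: "expr list \<Rightarrow> expr" where
  "prod_expr es = foldr (\<lambda>x y. x \<otimes> y) es (Num 1)"

lemma eval_prod_expr [simp]: "eval (prod_expr es) s = prod_list (map (\<lambda>e. eval e s) es)"
  unfolding prod_expr_def by (induction es) auto

definition sum_expr :: "expr list \<Rightarrow> expr" where
  "sum_expr es = foldr (\<lambda>x y. x \<oplus> y) es (Num 0)"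

lemma eval_sum_expr [simp]: "eval (sum_expr es) s = sum_list (map (\<lambda>e. eval e s) es)"
  unfolding sum_expr_def by (induction es) auto

lemma expr_vars_simps [simp]:
  "expr_vars (less_expr x y) = expr_vars x \<union> expr_vars y"
  "expr_vars (eq_expr x y) = expr_vars x \<union> expr_vars y"
  "expr_vars (mod_expr x y) = expr_vars x \<union> expr_vars y"
  by (auto simp: less_expr_def eq_expr_def mod_expr_def)

lemma expr_vars_power_expr: "expr_vars (power_expr x t) \<subseteq> expr_vars x"
  by (induction t) auto

lemma expr_vars_prod_expr [simp]: "expr_vars (prod_expr es) = (\<Union>e\<in>set es. expr_vars e)"
  unfolding prod_expr_def by (induction es) auto

lemma expr_vars_sum_expr [simp]: "expr_vars (sum_expr es) = (\<Union>e\<in>set es. expr_vars e)"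
  unfolding sum_expr_def by (induction es) auto

text \<open>Register \<open>1\<close> is left out because the simplifier would rewrite its number to \<open>Suc 0\<close>.\<close>

abbreviation (input) "v_n \<equiv> 0 :: nat"
abbreviation (input) "v_K \<equiv> 2 :: nat"
abbreviation (input) "v_D \<equiv> 3 :: nat"
abbreviation (input) "v_P \<equiv> 4 :: nat"
abbreviation (input) "v_F \<equiv> 5 :: nat"
abbreviation (input) "v_Q \<equiv> 6 :: nat"
abbreviation (input) "v_X \<equiv> 7 :: nat"
abbreviation (input) "v_Z \<equiv> 8 :: nat"
abbreviation (input) "v_i \<equiv> 9 :: nat"
abbreviation (input) "v_x \<equiv> 10 :: nat"
abbreviation (input) "v_src \<equiv> 11 :: nat"
abbreviation (input) "v_E \<equiv> 12 :: nat"
abbreviation (input) "v_G \<equiv> 13 :: nat"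
abbreviation (input) "v_acc \<equiv> 14 :: nat"
abbreviation (input) "v_L \<equiv> 15 :: nat"

section \<open>Expressions for codes and for the entries of a pass\<close>

definition digit_expr :: "nat \<Rightarrow> expr \<Rightarrow> expr" where
  "digit_expr t w = mod_expr (w \<oslash> power_expr (Var v_n) t) (Var v_n)"

lemma eval_digit_expr [simp]: "eval (digit_expr t w) s = digit (fst s v_n) t (eval w s)"
  by (simp add: digit_expr_def digit_def)

definition code_expr :: "nat \<Rightarrow> expr \<Rightarrow> expr" where
  "code_expr j w = prod_expr [less_expr (digit_expr s w) (digit_expr t w) \<otimes>
     less_expr (Num 0) (Mem (digit_expr s w \<otimes> Var v_n \<oplus> digit_expr t w)). t \<leftarrow> [0..<j], s \<leftarrow> [0..<t]]"

lemma prod_list_of_bool: "prod_list (map (\<lambda>x. of_bool (P x) :: nat) xs) = of_bool (\<forall>x\<in>set xs. P x)"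
  by (induction xs) auto

lemma eval_code_expr [simp]:
  "eval (code_expr j w) s =
     of_bool (clique_code (\<lambda>u v. 0 < snd s (u * fst s v_n + v)) (fst s v_n) j (eval w s))"
proof -
  let ?P = "\<lambda>(t, s'). digit (fst s v_n) s' (eval w s) < digit (fst s v_n) t (eval w s) \<and>
      0 < snd s (digit (fst s v_n) s' (eval w s) * fst s v_n + digit (fst s v_n) t (eval w s))"
  have "eval (code_expr j w) s = prod_list (map (\<lambda>x. of_bool (?P x)) [(t, s'). t \<leftarrow> [0..<j], s' \<leftarrow> [0..<t]])"
    unfolding code_expr_def eval_prod_expr
    by (intro arg_cong[where f = prod_list]) (simp add: map_concat comp_def of_bool_conj)
  also have "\<dots> = of_bool (clique_code (\<lambda>u v. 0 < snd s (u * fst s v_n + v)) (fst s v_n) j (eval w s))"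
    unfolding prod_list_of_bool clique_code_def by (intro arg_cong[where f = of_bool]) auto
  finally show ?thesis .
qed

lemma expr_vars_digit_expr: "expr_vars (digit_expr t w) \<subseteq> insert v_n (expr_vars w)"
  using expr_vars_power_expr[of "Var v_n" t] by (auto simp: digit_expr_def)

lemma expr_vars_code_expr: "expr_vars (code_expr j w) \<subseteq> insert v_n (expr_vars w)"
  unfolding code_expr_def by (auto dest!: expr_vars_digit_expr[THEN subsetD])

text \<open>The coefficients are constants of the program. A table lookup at a computed index is
  simulated by a sum over all \<open>q < r\<close> with an equality test, whose length is fixed
  because \<open>r\<close> is.\<close>

definition residue_expr :: "nat \<Rightarrow> (nat \<Rightarrow> nat \<Rightarrow> nat \<Rightarrow> int) \<Rightarrow> expr \<Rightarrow> nat \<Rightarrow> nat \<Rightarrow> expr" where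
  "residue_expr r U e i j = sum_expr [eq_expr e (Num q) \<otimes>
     (Num (nat (U q i j)) \<oplus> Num (nat (- U q i j)) \<otimes> (Var v_Q \<ominus> Num 1)). q \<leftarrow> [0..<r]]"

lemma eval_residue_expr:
  assumes "eval e s < r"
  shows "eval (residue_expr r U e i j) s = residue (fst s v_Q) U (eval e s) i j"
proof -
  have "eval (residue_expr r U e i j) s =
    (\<Sum>q<r. of_bool (eval e s = q) * residue (fst s v_Q) U q i j)"
    by (simp add: residue_expr_def residue_def sum_list_sum_nth comp_def atLeast0LessThan)
  also have "\<dots> = (\<Sum>q<r. if q = eval e s then residue (fst s v_Q) U q i j else 0)"
    by (rule sum.cong) auto
  finally show ?thesis using assms by simp
qed

text \<open>\<open>v_x\<close> is a linear index into the target, an array of E by E matrices stored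
  row by row; \<open>h\<close>, \<open>x\<close>, \<open>y\<close> are decoded from it. The source
  matrices have side \<open>w\<close>, the product of E and d.\<close>

definition pass_expr :: "nat \<Rightarrow> nat \<Rightarrow> (nat \<Rightarrow> nat \<Rightarrow> nat \<Rightarrow> int) \<Rightarrow> expr" where
  "pass_expr d r U = (let
       h = Var v_x \<oslash> (Var v_E \<otimes> Var v_E);
       x = mod_expr (Var v_x \<oslash> Var v_E) (Var v_E);
       y = mod_expr (Var v_x) (Var v_E);
       w = Var v_E \<otimes> Num d
     in sum_expr [residue_expr r U (mod_expr h (Num r)) i j \<otimes>
       Mem (Var v_src \<oplus> (((h \<oslash> Num r) \<otimes> w \<oplus> (x \<otimes> Num d \<oplus> Num i)) \<otimes> w \<oplus> (y \<otimes> Num d \<oplus> Num j))).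
       i \<leftarrow> [0..<d], j \<leftarrow> [0..<d]])"

lemma sum_list_frob: "sum_list [f i j * g i j. i \<leftarrow> [0..<d], j \<leftarrow> [0..<d]] = frob d f g"
proof -
  have "sum_list [F i j. i \<leftarrow> is, j \<leftarrow> [0..<d]] = sum_list (map (\<lambda>i. \<Sum>j<d. F i j) is)"
    for F :: "nat \<Rightarrow> nat \<Rightarrow> 'a" and "is"
    by (induction "is") (simp_all add: interv_sum_list_conv_sum_set_nat atLeast0LessThan)
  then show ?thesis by (simp add: frob_def interv_sum_list_conv_sum_set_nat atLeast0LessThan)
qed

lemma eval_pass_expr:
  assumes "0 < r"
  shows "eval (pass_expr d r U) s = (let E = fst s v_E; h = fst s v_x div (E * E); x = fst s v_x div E mod E; y = fst s v_x mod E
    in frob d (residue (fst s v_Q) U (h mod r))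
         (\<lambda>i j. snd s (fst s v_src + (((h div r) * (E * d) + (x * d + i)) * (E * d) + (y * d + j)))))"
  unfolding Let_def sum_list_frob[symmetric] pass_expr_def eval_sum_expr
  by (intro arg_cong[where f = sum_list]) (simp add: map_concat comp_def eval_residue_expr assms)

lemma expr_vars_pass_expr: "expr_vars (pass_expr d r U) \<subseteq> {v_x, v_E, v_src, v_Q}"
  unfolding pass_expr_def residue_expr_def Let_def by auto

text \<open>The matrices have size \<open>d\<^sup>K\<close> for the least \<open>K\<close> such that this is at least \<open>n\<close> to the power \<open>a / b\<close>,
  which is therefore also the order of magnitude of the cutoff for the lists of cliques.\<close>

locale clique_counter =
  fixes m j a b d r N :: nat and U V W :: "nat \<Rightarrow> nat \<Rightarrow> nat \<Rightarrow> int"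
  assumes m: "0 < m" and b: "0 < b" and d: "2 \<le> d" and N: "0 < N" and r: "d\<^sup>2 \<le> r"
    and trilinear: "\<And>f g e. (\<Sum>h<r. frob d (U h) f * frob d (V h) g * frob d (W h) e) =
      int N * (\<Sum>i<d. \<Sum>j<d. \<Sum>l<d. f i j * g j l * e i l)"
begin

section \<open>Sizes, moduli and addresses\<close>

definition levels :: "nat \<Rightarrow> nat" where
  "levels n = (LEAST K. n ^ a \<le> (d ^ K) ^ b)"

definition side :: "nat \<Rightarrow> nat" where "side n = d ^ levels n"
definition block :: "nat \<Rightarrow> nat" where "block n = r ^ levels n"
definition scale :: "nat \<Rightarrow> nat" where "scale n = N ^ levels n"
text \<open>Larger than the scaled number of k-cliques in any graph on n vertices, so the final
  reduction recovers the exact value.\<close>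

definition modulus :: "nat \<Rightarrow> nat" where "modulus n = scale n * n ^ (m + (m + j)) + 1"
text \<open>The first address behind the adjacency matrix and two lists of \<open>side n + 1\<close>
  cells each, one of them a scratch cell.\<close>

definition base :: "nat \<Rightarrow> nat" where "base n = n * n + 2 * side n + 2"

definition coeff_sum :: nat where
  "coeff_sum = (\<Sum>h<r. \<Sum>i<d. \<Sum>j<d. nat \<bar>U h i j\<bar> + nat \<bar>V h i j\<bar> + nat \<bar>W h i j\<bar>)"

text \<open>The added 1 makes the base of the power positive, so that the bound also covers all
  earlier passes.\<close>

definition entry_bound :: "nat \<Rightarrow> nat" where
  "entry_bound n = (d * d * (coeff_sum * modulus n) + 1) ^ levels n"

text \<open>All numbers that the program writes are below this bound.\<close>

definition bound :: "nat \<Rightarrow> nat" where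
  "bound n = a * n + n + n ^ m + n ^ j + side n * side n + scale n + block n + modulus n + levels n
     + base n + 3 * (levels n + 1) * block n + block n * entry_bound n ^ 3 + 2"

lemma r_pos: "0 < r" and d_pos: "0 < d" and r_ge: "d * d \<le> r"
proof -
  show "0 < d" and dr: "d * d \<le> r" using d r by (auto simp: power2_eq_square)
  then show "0 < r" by (metis less_le_trans nat_0_less_mult_iff)
qed

text \<open>Shows that the minimum in \<open>levels\<close> exists, and by n < 2^n that a loop of
  \<open>a * n\<close> rounds is long enough to find it.\<close>

lemma power_le_levels: "n ^ a \<le> (d ^ K) ^ b" if "a * n \<le> K"
proof -
  have "n ^ a \<le> (2 ^ n) ^ a" by (intro power_mono less_imp_le[OF less_exp]) auto
  also have "\<dots> = 2 ^ (a * n)" by (simp add: power_mult[symmetric] mult.commute)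
  also have "\<dots> \<le> 2 ^ K" using that by (intro power_increasing) auto
  also have "\<dots> \<le> d ^ K" using d by (intro power_mono) auto
  also have "\<dots> = (d ^ K) ^ 1" by simp
  also have "\<dots> \<le> (d ^ K) ^ b" using b d by (intro power_increasing) auto
  finally show ?thesis .
qed

lemma levels_le: "levels n \<le> a * n"
  unfolding levels_def by (rule Least_le) (rule power_le_levels[OF order_refl])

lemma power_le_side: "n ^ a \<le> side n ^ b"
  unfolding side_def levels_def by (rule LeastI[of _ "a * n"]) (rule power_le_levels[OF order_refl])

lemma power_less_levels: "K < levels n \<Longrightarrow> (d ^ K) ^ b < n ^ a"
  unfolding levels_def using not_less_Least by (meson not_le)

lemma side_pos: "0 < side n" and block_pos: "0 < block n" and scale_pos: "0 < scale n" and modulus_pos: "0 < modulus n"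
  using d_pos r_pos N by (auto simp: side_def block_def scale_def modulus_def)

lemma side_le_square: "side n \<le> side n * side n"
  using side_pos[of n] by simp

lemma side_square_le_block: "side n * side n \<le> block n"
  unfolding side_def block_def power_mult_distrib[symmetric] using r_ge by (rule power_mono) simp

text \<open>A conditional without branching: the flag \<open>v_F\<close> is 1 as long as the side is
  too small, and \<open>1 + F * (d - 1)\<close> is then \<open>d\<close>, otherwise 1. Once the
  least K is reached, the remaining rounds change nothing but loop variables.\<close>

definition init_body :: stmt where
  "init_body =
     Assign v_F (less_expr (power_expr (Var v_D) b) (power_expr (Var v_n) a)) ;;
     Assign v_D (Var v_D \<otimes> (Num 1 \<oplus> Var v_F \<otimes> Num (d - 1))) ;;
     Assign v_P (Var v_P \<otimes> (Num 1 \<oplus> Var v_F \<otimes> Num (N - 1))) ;;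
     Assign v_G (Var v_G \<otimes> (Num 1 \<oplus> Var v_F \<otimes> Num (r - 1))) ;;
     Assign v_K (Var v_K \<oplus> Var v_F)"

definition init_loop :: stmt where
  "init_loop = For v_i (Num a \<otimes> Var v_n) init_body"

definition init_modulus :: stmt where
  "init_modulus = Assign v_Q (Var v_P \<otimes> power_expr (Var v_n) (m + (m + j)) \<oplus> Num 1)"

definition init :: stmt where
  "init = Assign v_K (Num 0) ;; Assign v_D (Num 1) ;; Assign v_P (Num 1) ;; Assign v_G (Num 1) ;; init_loop ;; init_modulus"

definition init_inv :: "nat \<Rightarrow> (nat \<Rightarrow> nat) \<Rightarrow> nat \<Rightarrow> ram_state \<Rightarrow> bool" where
  "init_inv n M K s \<longleftrightarrow> snd s = M \<and> fst s v_n = n \<and> fst s v_K = K \<and> fst s v_D = d ^ K \<and> fst s v_P = N ^ K \<and> fst s v_G = r ^ K"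

lemma power_le_power_levels:
  "K \<le> levels n \<Longrightarrow> d ^ K \<le> side n" "K \<le> levels n \<Longrightarrow> N ^ K \<le> scale n" "K \<le> levels n \<Longrightarrow> r ^ K \<le> block n"
  unfolding side_def scale_def block_def using d_pos N r_pos by (auto intro!: power_increasing)

lemma bound_ge:
  "a * n \<le> bound n" "n \<le> bound n" "n ^ m \<le> bound n" "n ^ j \<le> bound n" "side n * side n \<le> bound n"
  "side n \<le> bound n" "scale n \<le> bound n" "block n \<le> bound n" "modulus n \<le> bound n" "levels n \<le> bound n"
  "base n + 3 * (levels n + 1) * block n \<le> bound n" "block n * entry_bound n ^ 3 \<le> bound n" "2 \<le> bound n"
proof -
  have "side n * side n \<le> bound n" by (simp add: bound_def)
  then show "side n \<le> bound n" using side_le_square[of n] by (rule order_trans[rotated])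
qed (simp_all add: bound_def)

lemma spec_init:
  assumes "fst s v_n = n"
  shows "spec (bound n) init s (6 + 6 * (a * n))
    (\<lambda>s'. init_inv n (snd s) (levels n) s' \<and> fst s' v_Q = modulus n)"
proof -
  let ?B = "bound n" and ?M = "snd s" and ?I = "\<lambda>i. init_inv n (snd s) (min i (levels n))"
  have loop: "spec ?B init_loop s' (1 + a * n * 6) (init_inv n ?M (levels n))" if s': "init_inv n ?M 0 s'" for s'
    unfolding init_loop_def
  proof (rule spec_For_const[where n = "a * n" and I = ?I and T = 5])
    fix i t assume i: "i < a * n" and I: "?I i t"
    let ?K = "min i (levels n)"
    show "spec ?B init_body (set_var v_i i t) 5 (?I (Suc i))"
    proof (cases "i < levels n")
      case True
      then have lt: "(d ^ i) ^ b < n ^ a" by (rule power_less_levels)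
      have S: "Suc i \<le> levels n" using True by simp
      have "d * d ^ i \<le> ?B" "N * N ^ i \<le> ?B" "r * r ^ i \<le> ?B" "Suc i \<le> ?B"
        using power_le_power_levels[OF S] bound_ge[of n] S by auto
      then show ?thesis using I True lt d_pos N r_pos bound_ge(13)[of n]
        by (simp add: init_body_def spec_def fst_set_var snd_set_var init_inv_def mult.commute)
    next
      case False
      then have "\<not> (d ^ levels n) ^ b < n ^ a" using power_le_side[of n] by (simp add: side_def)
      then show ?thesis using I False bound_ge[of n]
        by (simp add: init_body_def spec_def fst_set_var snd_set_var init_inv_def min_def side_def scale_def block_def)
    qed
  next
    show "eval (Num a \<otimes> Var v_n) s' = a * n" using s' by (simp add: init_inv_def)
    show "?I 0 s'" using s' by simp
    show "init_inv n ?M (levels n) t" if "?I (a * n) t" for t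
      using that levels_le[of n] by (simp add: min_def split: if_splits)
  qed (use bound_ge in auto)
  have fin: "spec ?B init_modulus s' 1
     (\<lambda>s'. init_inv n ?M (levels n) s' \<and> fst s' v_Q = modulus n)" if "init_inv n ?M (levels n) s'" for s'
    unfolding init_modulus_def by (rule spec_Assign)
      (use that bound_ge(9)[of n] in \<open>auto simp: init_inv_def fst_set_var snd_set_var modulus_def scale_def\<close>)
  have "spec ?B (init_loop ;; init_modulus)
      (set_var v_G 1 (set_var v_P 1 (set_var v_D 1 (set_var v_K 0 s)))) (1 + a * n * 6 + 1)
      (\<lambda>s'. init_inv n ?M (levels n) s' \<and> fst s' v_Q = modulus n)"
    by (rule spec_Then[OF loop fin order_refl])
      (use assms in \<open>auto simp: init_inv_def fst_set_var snd_set_var\<close>)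
  then show ?thesis using bound_ge(13)[of n] by (simp add: init_def spec_def)
qed

end

text \<open>The value at each index has to be right in every state that agrees with \<open>s\<close>
  outside the target range and the loop variable. So entries already written cannot influence later
  ones.\<close>

lemma spec_tabulate:
  assumes "eval len s = L" "L \<le> B" "\<And>i. i < L \<Longrightarrow> f i \<le> B"
    and ev: "\<And>i s'. i < L \<Longrightarrow> (\<And>u. u \<noteq> v_x \<Longrightarrow> fst s' u = fst s u) \<Longrightarrow> fst s' v_x = i \<Longrightarrow>
      (\<And>x. x \<notin> {\<beta>..<\<beta> + L} \<Longrightarrow> snd s' x = snd s x) \<Longrightarrow> eval dst s' = \<beta> + i \<and> eval val s' = f i"
  shows "spec B (For v_x len (Write dst val)) s (1 + 2 * L) (\<lambda>s'. (\<forall>u. u \<noteq> v_x \<longrightarrow> fst s' u = fst s u) \<and>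
    (\<forall>x. x \<notin> {\<beta>..<\<beta> + L} \<longrightarrow> snd s' x = snd s x) \<and> (\<forall>i<L. snd s' (\<beta> + i) = f i))"
proof -
  let ?I = "\<lambda>i s'. (\<forall>u. u \<noteq> v_x \<longrightarrow> fst s' u = fst s u) \<and>
    (\<forall>x. x \<notin> {\<beta>..<\<beta> + L} \<longrightarrow> snd s' x = snd s x) \<and> (\<forall>l<i. snd s' (\<beta> + l) = f l)"
  show ?thesis
  proof (rule spec_For_const[where n = L and I = ?I and T = 1])
    fix i s' assume i: "i < L" and I: "?I i s'"
    let ?t = "set_var v_x i s'"
    have e: "eval dst ?t = \<beta> + i" "eval val ?t = f i"
      using ev[OF i, of ?t] I by (auto simp: fst_set_var snd_set_var)
    show "spec B (Write dst val) ?t 1 (?I (Suc i))"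
      by (rule spec_Write) (use I i assms(3)[OF i] in \<open>auto simp: e fst_set_var snd_set_var less_Suc_eq\<close>)
  qed (use assms in auto)
qed

section \<open>Listing the cliques in memory\<close>

definition encodes_graph :: "nat set set \<Rightarrow> nat \<Rightarrow> (nat \<Rightarrow> nat) \<Rightarrow> bool" where
  "encodes_graph E n M \<longleftrightarrow> (\<forall>u<n. \<forall>v<n. M (u * n + v) = of_bool ({u, v} \<in> E))"

lemma index_less: "u < n \<Longrightarrow> v < n \<Longrightarrow> u * n + v < n * (n::nat)"
proof -
  assume "u < n" "v < n"
  then have "u * n + v < u * n + n" "Suc u * n \<le> n * n" using mult_le_mono1[of "Suc u" n n] by auto
  then show ?thesis by simp
qed

lemma encodes_graph_cong:
  assumes "encodes_graph E n M" "\<And>x. x < n * n \<Longrightarrow> M' x = M x"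
  shows "encodes_graph E n M'"
  using assms index_less[of _ n] by (auto simp: encodes_graph_def)

lemma clique_code_memory:
  assumes "encodes_graph E n M" "0 < n"
  shows "clique_code (\<lambda>u v. 0 < M (u * n + v)) n l x = clique_code (adjacent E) n l x"
  using assms by (intro clique_code_cong) (auto simp: encodes_graph_def)

definition count_stmt :: "nat \<Rightarrow> nat \<Rightarrow> stmt" where
  "count_stmt l v = Assign v (Var v \<oplus> code_expr l (Var v_x) \<otimes> less_expr (Var v) (Var v_D))"

text \<open>Every code is written behind the list, and stays there only if the counter is advanced.\<close>

definition enumerate_codes :: "nat \<Rightarrow> expr \<Rightarrow> nat \<Rightarrow> stmt" where
  "enumerate_codes l e v = Assign v (Num 0) ;;
     For v_x (power_expr (Var v_n) l) (Write (e \<oplus> Var v) (Var v_x) ;; count_stmt l v)"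

text \<open>The cell \<open>\<beta> + D\<close> is not protected: when the list is full, every
  further candidate is still written there while the counter stands still. A list therefore occupies
  one cell more than its capacity.\<close>

lemma spec_enumerate_codes:
  assumes "fst s v_n = n" "0 < n" "fst s v_D = D" "v \<noteq> v_x" "v \<noteq> v_D" "v \<noteq> v_n" "n ^ l \<le> B" "D \<le> B"
    and e: "\<And>s'. (\<And>u. u \<noteq> v \<Longrightarrow> u \<noteq> v_x \<Longrightarrow> fst s' u = fst s u) \<Longrightarrow> eval e s' = \<beta>" and "n * n \<le> \<beta>"
    and G: "encodes_graph E n (snd s)"
  shows "spec B (enumerate_codes l e v) s (2 + 3 * n ^ l) (\<lambda>s'. (\<forall>u. u \<noteq> v \<longrightarrow> u \<noteq> v_x \<longrightarrow> fst s' u = fst s u) \<and>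
    (\<forall>x. x < \<beta> \<or> \<beta> + D < x \<longrightarrow> snd s' x = snd s x) \<and> fst s' v = min D (length (codes E n l)) \<and>
    (\<forall>i<fst s' v. snd s' (\<beta> + i) = codes E n l ! i))"
proof -
  let ?C = "clique_code (adjacent E) n l"
  define xs where "xs i = filter ?C [0..<i]" for i
  let ?I = "\<lambda>i s'. (\<forall>u. u \<noteq> v \<longrightarrow> u \<noteq> v_x \<longrightarrow> fst s' u = fst s u) \<and>
    (\<forall>x. x < \<beta> \<or> \<beta> + D < x \<longrightarrow> snd s' x = snd s x) \<and> fst s' v = min D (length (xs i)) \<and>
    (\<forall>l<min D (length (xs i)). snd s' (\<beta> + l) = xs i ! l)"
  have "spec B (For v_x (power_expr (Var v_n) l) (Write (e \<oplus> Var v) (Var v_x) ;; count_stmt l v)) (set_var v 0 s) (1 + n ^ l * 3)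
     (?I (n ^ l))"
  proof (rule spec_For_const[where n = "n ^ l" and I = ?I and T = 2])
    fix i s' assume i: "i < n ^ l" and I: "?I i s'"
    let ?t = "set_var v_x i s'" and ?c = "min D (length (xs i))"
    let ?M = "(snd s')(\<beta> + ?c := i)"
    have et: "eval e ?t = \<beta>" using I by (intro e) (auto simp: fst_set_var)
    have I1: "\<And>u. u \<noteq> v \<Longrightarrow> u \<noteq> v_x \<Longrightarrow> fst s' u = fst s u"
      and I2: "\<And>x. x < \<beta> \<or> \<beta> + D < x \<Longrightarrow> snd s' x = snd s x" and I3: "fst s' v = ?c"
      and I4: "\<And>l. l < ?c \<Longrightarrow> snd s' (\<beta> + l) = xs i ! l" using I by auto
    have n: "fst s' v_n = n" "fst s' v_D = D" using I1[of v_n] I1[of v_D] assms by auto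
    have GM: "encodes_graph E n ?M"
      by (rule encodes_graph_cong[OF G]) (use I2 assms(10) in auto)
    have xs_Suc: "xs (Suc i) = xs i @ (if ?C i then [i] else [])" by (simp add: xs_def)
    let ?c' = "?c + of_bool (?C i) * of_bool (?c < D)"
    have c': "?c' = min D (length (xs (Suc i)))" by (auto simp: xs_Suc)
    show "spec B (Write (e \<oplus> Var v) (Var v_x) ;; count_stmt l v) ?t 2 (?I (Suc i))"
    proof (rule spec_Then[where ?T1.0 = 1 and ?T2.0 = 1 and R = "\<lambda>s''. s'' = (fst ?t, ?M)"])
      show "spec B (Write (e \<oplus> Var v) (Var v_x)) ?t 1 (\<lambda>s''. s'' = (fst ?t, ?M))"
        by (rule spec_Write) (use i assms(4,7) I3 in \<open>auto simp: et fst_set_var snd_set_var\<close>)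
    next
      fix s'' assume s'': "s'' = (fst ?t, ?M)"
      have ev: "eval (Var v \<oplus> code_expr l (Var v_x) \<otimes> less_expr (Var v) (Var v_D)) s'' = ?c'"
        using assms(4-6) I3 n clique_code_memory[OF GM assms(2), of l i]
        by (simp add: s'' fst_set_var snd_set_var)
      show "spec B (count_stmt l v) s'' 1 (?I (Suc i))"
        unfolding count_stmt_def
      proof (rule spec_Assign, unfold ev)
        show "?c' \<le> B" unfolding c' using assms(8) by simp
        have "snd s'' (\<beta> + l') = xs (Suc i) ! l'" if "l' < min D (length (xs (Suc i)))" for l'
        proof (cases "l' < ?c")
          case True
          then show ?thesis using I4[OF True] by (auto simp: s'' xs_Suc nth_append)
        next
          case False
          then have "?C i" "l' = ?c" "l' = length (xs i)" using that by (auto simp: xs_Suc split: if_splits)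
          then show ?thesis by (simp add: s'' xs_Suc)
        qed
        moreover have "snd s'' x = snd s x" if "x < \<beta> \<or> \<beta> + D < x" for x
          using that I2[OF that] by (auto simp: s'')
        moreover have "fst s'' u = fst s u" if "u \<noteq> v" "u \<noteq> v_x" for u
          using that I1[OF that] by (simp add: s'' fst_set_var)
        ultimately show "?I (Suc i) (set_var v ?c' s'')" unfolding c' by (simp add: fst_set_var snd_set_var)
      qed simp
    qed simp
  qed (use assms in \<open>auto simp: fst_set_var snd_set_var xs_def\<close>)
  then have "spec B (enumerate_codes l e v) s (2 + 3 * n ^ l) (?I (n ^ l))"
    unfolding enumerate_codes_def by (intro spec_Assign_Then[where ?T2.0 = "1 + n ^ l * 3"]) auto
  then show ?thesis by (rule spec_weaken) (auto simp: xs_def codes_def)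
qed

lemma residue_le: "1 \<le> Q \<Longrightarrow> residue Q U h i j \<le> nat \<bar>U h i j\<bar> * Q"
proof (cases "0 \<le> U h i j")
  case True
  assume "1 \<le> Q"
  then show ?thesis using True by (simp add: residue_def)
next
  case False
  assume "1 \<le> Q"
  then show ?thesis using False by (simp add: residue_def)
qed

lemma index3_div_mod:
  assumes "x < E" "y < (E::nat)"
  shows "((h * E + x) * E + y) div (E * E) = h" "((h * E + x) * E + y) div E mod E = x" "((h * E + x) * E + y) mod E = y"
proof -
  have 1: "((h * E + x) * E + y) div E = h * E + x" using assms by (simp add: div_mult2_eq)
  show "((h * E + x) * E + y) div (E * E) = h" unfolding div_mult2_eq 1 using assms by simp
  show "((h * E + x) * E + y) div E mod E = x" unfolding 1 using assms by simp
  show "((h * E + x) * E + y) mod E = y" using assms by simp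
qed

lemma index3_less:
  assumes "h < H" "x < E" "y < (E::nat)"
  shows "(h * E + x) * E + y < H * E * E"
proof -
  have "h * E + x < H * E"
  proof -
    have "h * E + x < Suc h * E" using assms by simp
    also have "\<dots> \<le> H * E" using assms by (intro mult_le_mono1) simp
    finally show ?thesis .
  qed
  then have "(h * E + x) * E + y < Suc (h * E + x) * E" "Suc (h * E + x) * E \<le> H * E * E"
    using assms by (auto simp del: mult_Suc intro!: mult_le_mono1) simp
  then show ?thesis by linarith
qed

context clique_counter
begin

section \<open>Tensor passes over the memory\<close>

definition ready :: "nat \<Rightarrow> ram_state \<Rightarrow> bool" where
  "ready n s \<longleftrightarrow> fst s v_n = n \<and> fst s v_K = levels n \<and> fst s v_D = side n \<and> fst s v_P = scale n \<and>
     fst s v_G = block n \<and> fst s v_Q = modulus n"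

definition side_at :: "nat \<Rightarrow> nat \<Rightarrow> nat" where
  "side_at n t = d ^ (levels n - t)"

lemma side_at_Suc: "t < levels n \<Longrightarrow> side_at n t = side_at n (Suc t) * d"
  unfolding side_at_def by (metis Suc_diff_Suc mult.commute power_Suc)

lemma side_at_pos: "0 < side_at n t"
  using d_pos by (simp add: side_at_def)

text \<open>A pass divides the size of a matrix by d * d and multiplies the number of matrices by r,
  which is at least as large. So the data are longest at the end, when they fill a whole
  segment.\<close>

lemma size_at_le_block: "t \<le> levels n \<Longrightarrow> r ^ t * side_at n t * side_at n t \<le> block n"
proof -
  assume t: "t \<le> levels n"
  have "side_at n t * side_at n t \<le> r ^ (levels n - t)"
    unfolding side_at_def power_mult_distrib[symmetric] using r_ge by (rule power_mono) simp
  then have "r ^ t * (side_at n t * side_at n t) \<le> r ^ t * r ^ (levels n - t)" by (rule mult_le_mono2)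
  also have "\<dots> = block n" using t by (simp add: block_def power_add[symmetric])
  finally show ?thesis by (simp add: mult.assoc)
qed

definition bounded_coeffs :: "(nat \<Rightarrow> nat \<Rightarrow> nat \<Rightarrow> int) \<Rightarrow> bool" where
  "bounded_coeffs T \<longleftrightarrow> (\<forall>h<r. \<forall>i<d. \<forall>l<d. nat \<bar>T h i l\<bar> \<le> coeff_sum)"

lemma bounded_coeffs: "bounded_coeffs U" "bounded_coeffs V" "bounded_coeffs W"
proof -
  have *: "nat \<bar>U h i j\<bar> + nat \<bar>V h i j\<bar> + nat \<bar>W h i j\<bar> \<le> coeff_sum" if "h < r" "i < d" "j < d" for h i j
  proof -
    let ?f = "\<lambda>h i j. nat \<bar>U h i j\<bar> + nat \<bar>V h i j\<bar> + nat \<bar>W h i j\<bar>"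
    have "?f h i j \<le> (\<Sum>j<d. ?f h i j)" using that by (intro member_le_sum) auto
    also have "\<dots> \<le> (\<Sum>i<d. \<Sum>j<d. ?f h i j)" using that by (intro member_le_sum[of i _ "\<lambda>i. \<Sum>j<d. ?f h i j"]) auto
    also have "\<dots> \<le> coeff_sum" unfolding coeff_sum_def
      using that by (intro member_le_sum[of h _ "\<lambda>h. \<Sum>i<d. \<Sum>j<d. ?f h i j"]) auto
    finally show ?thesis .
  qed
  show "bounded_coeffs U" "bounded_coeffs V" "bounded_coeffs W"
    unfolding bounded_coeffs_def using * by (meson add_leD1 add_leD2)+
qed

lemma passes_le_entry_bound:
  assumes "bounded_coeffs T" "\<And>x y. A x y \<le> 1" "t \<le> levels n"
  shows "passes d r (residue (modulus n) T) t A h x y \<le> entry_bound n"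
proof -
  let ?g = "coeff_sum * modulus n"
  have "passes d r (residue (modulus n) T) t A h x y \<le> (d * d * ?g) ^ t"
  proof (rule passes_le)
    fix h i j assume hij: "h < r" "i < d" "j < d"
    have "residue (modulus n) T h i j \<le> nat \<bar>T h i j\<bar> * modulus n"
      using modulus_pos[of n] by (intro residue_le) simp
    also have "\<dots> \<le> ?g" using assms(1) hij by (intro mult_le_mono1) (simp add: bounded_coeffs_def)
    finally show "residue (modulus n) T h i j \<le> ?g" .
  qed (use assms(2) r_pos in auto)
  also have "\<dots> \<le> (d * d * ?g + 1) ^ t" by (intro power_mono) auto
  also have "\<dots> \<le> entry_bound n" unfolding entry_bound_def using assms(3) by (intro power_increasing) auto
  finally show ?thesis .
qed

lemma entry_bound_le_bound: "entry_bound n \<le> bound n"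
proof -
  have "1 \<le> entry_bound n" by (simp add: entry_bound_def)
  then have "entry_bound n ^ 1 \<le> entry_bound n ^ 3" by (intro power_increasing) auto
  also have "\<dots> \<le> block n * entry_bound n ^ 3" using block_pos[of n] by simp
  finally show ?thesis using bound_ge(12)[of n] by simp
qed

definition pass_loop :: "(nat \<Rightarrow> nat \<Rightarrow> nat \<Rightarrow> int) \<Rightarrow> stmt" where
  "pass_loop T = For v_x (Var v_L) (Write (Var v_src \<oplus> Var v_G \<oplus> Var v_x) (pass_expr d r T))"

definition pass_stmt :: "(nat \<Rightarrow> nat \<Rightarrow> nat \<Rightarrow> int) \<Rightarrow> stmt" where
  "pass_stmt T = Assign v_E (Var v_E \<oslash> Num d) ;; Assign v_L ((Var v_L \<oslash> Num (d * d)) \<otimes> Num r) ;;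
     pass_loop T ;; Assign v_src (Var v_src \<oplus> Var v_G)"

definition stored :: "(nat \<Rightarrow> nat \<Rightarrow> nat \<Rightarrow> int) \<Rightarrow> (nat \<Rightarrow> nat \<Rightarrow> nat) \<Rightarrow> nat \<Rightarrow> nat \<Rightarrow> nat \<Rightarrow> ram_state \<Rightarrow> bool" where
  "stored T A n \<beta> t s \<longleftrightarrow> fst s v_src = \<beta> \<and> fst s v_E = side_at n t \<and> fst s v_L = r ^ t * side_at n t * side_at n t \<and>
     (\<forall>h<r ^ t. \<forall>x<side_at n t. \<forall>y<side_at n t.
       snd s (\<beta> + ((h * side_at n t + x) * side_at n t + y)) = passes d r (residue (modulus n) T) t A h x y)"

text \<open>A pass reads one segment and writes into the next, so the source stays intact while it
  is being read.\<close>

lemma spec_pass_stmt: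
  assumes c: "ready n s" and t: "t < levels n" and st: "stored T A n \<beta> t s"
    and T: "bounded_coeffs T" and A: "\<And>x y. A x y \<le> 1" and \<beta>: "\<beta> + block n \<le> bound n"
  shows "spec (bound n) (pass_stmt T) s (4 + 2 * block n) (\<lambda>s'.
    (\<forall>u. u \<notin> {v_x, v_src, v_E, v_L} \<longrightarrow> fst s' u = fst s u) \<and>
    (\<forall>x. x \<notin> {\<beta> + block n..<\<beta> + 2 * block n} \<longrightarrow> snd s' x = snd s x) \<and> stored T A n (\<beta> + block n) (Suc t) s')"
proof -
  let ?E = "side_at n (Suc t)" and ?F = "side_at n t" and ?B = "bound n" and ?G = "block n"
  let ?L = "r ^ Suc t * ?E * ?E" and ?a = "passes d r (residue (modulus n) T)"
  have EF: "?F = ?E * d" using side_at_Suc[OF t] .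
  have LG: "?L \<le> ?G" using size_at_le_block[of "Suc t" n] t by simp
  have FG: "r ^ t * ?F * ?F \<le> ?G" using size_at_le_block[of t n] t by simp
  have GB: "?G \<le> ?B" by (rule bound_ge)
  have EB: "?E \<le> ?B"
  proof -
    have "?E \<le> side n" unfolding side_at_def side_def using d_pos by (intro power_increasing) auto
    then show ?thesis using bound_ge(6)[of n] by simp
  qed
  have s: "fst s v_src = \<beta>" "fst s v_E = ?F" "fst s v_L = r ^ t * ?F * ?F" "fst s v_G = ?G" "fst s v_Q = modulus n"
    using c st by (auto simp: ready_def stored_def)
  have mem: "snd s (\<beta> + ((h * ?F + x) * ?F + y)) = ?a t A h x y" if "h < r ^ t" "x < ?F" "y < ?F" for h x y
    using st that by (auto simp: stored_def)
  have dE: "?F div d = ?E" unfolding EF using d_pos by simp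
  have dL: "(r ^ t * ?F * ?F) div (d * d) * r = ?L"
  proof -
    have "r ^ t * ?F * ?F = (r ^ t * ?E * ?E) * (d * d)" unfolding EF by (simp add: algebra_simps)
    then have "(r ^ t * ?F * ?F) div (d * d) = r ^ t * ?E * ?E"
      using d_pos by (simp only: nonzero_mult_div_cancel_right) simp
    then show ?thesis by (simp add: algebra_simps)
  qed
  define s1 where "s1 = set_var v_L ?L (set_var v_E ?E s)"
  define f where "f i = ?a (Suc t) A (i div (?E * ?E)) (i div ?E mod ?E) (i mod ?E)" for i
  have s1: "fst s1 v_E = ?E" "fst s1 v_L = ?L" "fst s1 v_src = \<beta>" "fst s1 v_G = ?G" "fst s1 v_Q = modulus n" "snd s1 = snd s"
    using s by (auto simp: s1_def fst_set_var snd_set_var)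
  have tab: "spec ?B (pass_loop T) s1 (1 + 2 * ?L)
    (\<lambda>s'. (\<forall>u. u \<noteq> v_x \<longrightarrow> fst s' u = fst s1 u) \<and>
      (\<forall>x. x \<notin> {\<beta> + ?G..<\<beta> + ?G + ?L} \<longrightarrow> snd s' x = snd s1 x) \<and> (\<forall>i<?L. snd s' (\<beta> + ?G + i) = f i))"
    unfolding pass_loop_def
  proof (rule spec_tabulate)
    show "eval (Var v_L) s1 = ?L" using s1 by simp
    show "?L \<le> ?B" using LG GB by linarith
    show "f i \<le> ?B" for i
      unfolding f_def using passes_le_entry_bound[OF T A, of "Suc t" n] t entry_bound_le_bound[of n]
      by (meson Suc_leI order_trans)
    fix i s' assume i: "i < ?L" and same: "\<And>u. u \<noteq> v_x \<Longrightarrow> fst s' u = fst s1 u" and x: "fst s' v_x = i"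
      and smem: "\<And>x. x \<notin> {\<beta> + ?G..<\<beta> + ?G + ?L} \<Longrightarrow> snd s' x = snd s1 x"
    have v: "fst s' v_E = ?E" "fst s' v_src = \<beta>" "fst s' v_G = ?G" "fst s' v_Q = modulus n"
      using same[of v_E] same[of v_src] same[of v_G] same[of v_Q] s1 by auto
    let ?h = "i div (?E * ?E)" and ?x = "i div ?E mod ?E" and ?y = "i mod ?E"
    have "?h < r ^ Suc t" using i by (simp add: less_mult_imp_div_less mult.assoc)
    then have h: "?h div r < r ^ t" by (simp add: less_mult_imp_div_less mult.commute)
    have "eval (pass_expr d r T) s' = frob d (residue (modulus n) T (?h mod r))
         (\<lambda>i' j. snd s' (\<beta> + (((?h div r) * (?E * d) + (?x * d + i')) * (?E * d) + (?y * d + j))))"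
      unfolding eval_pass_expr[OF r_pos] Let_def v x ..
    also have "\<dots> = frob d (residue (modulus n) T (?h mod r)) (\<lambda>i' j. ?a t A (?h div r) (?x * d + i') (?y * d + j))"
    proof (rule frob_cong)
      fix i' j assume ij: "i' < d" "j < d"
      have le: "q < ?E \<Longrightarrow> l < d \<Longrightarrow> q * d + l < ?F" for q l
      proof -
        assume "q < ?E" "l < d"
        then have "q * d + l < Suc q * d" "Suc q * d \<le> ?E * d" by (auto simp del: mult_Suc intro!: mult_le_mono1) simp
        then show "q * d + l < ?F" unfolding EF by linarith
      qed
      have xy: "?x < ?E" "?y < ?E" using side_at_pos[of n "Suc t"] by auto
      let ?q = "((?h div r) * ?F + (?x * d + i')) * ?F + (?y * d + j)"
      have "?q < r ^ t * ?F * ?F" using h le xy ij by (intro index3_less) auto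
      \<comment> \<open>The index bound keeps the address inside the source segment, below the range
        that the loop writes.\<close>
      then have "snd s' (\<beta> + ?q) = snd s (\<beta> + ?q)" using smem[of "\<beta> + ?q"] FG s1(6) by auto
      also have "\<dots> = ?a t A (?h div r) (?x * d + i') (?y * d + j)" using h le xy ij by (intro mem) auto
      finally show "snd s' (\<beta> + (((?h div r) * (?E * d) + (?x * d + i')) * (?E * d) + (?y * d + j)))
          = ?a t A (?h div r) (?x * d + i') (?y * d + j)" unfolding EF[symmetric] .
    qed simp
    also have "\<dots> = f i" by (simp add: f_def pass_def)
    finally show "eval (Var v_src \<oplus> Var v_G \<oplus> Var v_x) s' = \<beta> + ?G + i \<and> eval (pass_expr d r T) s' = f i"
      using v x by simp
  qed
  let ?Q = "\<lambda>s'.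
    (\<forall>u. u \<notin> {v_x, v_src, v_E, v_L} \<longrightarrow> fst s' u = fst s u) \<and>
    (\<forall>x. x \<notin> {\<beta> + ?G..<\<beta> + 2 * ?G} \<longrightarrow> snd s' x = snd s x) \<and> stored T A n (\<beta> + ?G) (Suc t) s'"
  have sp: "spec ?B (pass_loop T ;; Assign v_src (Var v_src \<oplus> Var v_G)) s1 (2 + 2 * ?G) ?Q"
  proof (rule spec_Then[OF tab, where ?T2.0 = 1])
    fix s2 assume s2: "(\<forall>u. u \<noteq> v_x \<longrightarrow> fst s2 u = fst s1 u) \<and>
      (\<forall>x. x \<notin> {\<beta> + ?G..<\<beta> + ?G + ?L} \<longrightarrow> snd s2 x = snd s1 x) \<and> (\<forall>i<?L. snd s2 (\<beta> + ?G + i) = f i)"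
    then have v: "fst s2 v_E = ?E" "fst s2 v_L = ?L" "fst s2 v_src = \<beta>" "fst s2 v_G = ?G" using s1 by auto
    have same: "fst s2 u = fst s u" if "u \<notin> {v_x, v_src, v_E, v_L}" for u
      using s2 that by (auto simp: s1_def fst_set_var)
    have m: "snd s2 x = snd s x" if "x \<notin> {\<beta> + ?G..<\<beta> + 2 * ?G}" for x
    proof -
      have "x \<notin> {\<beta> + ?G..<\<beta> + ?G + ?L}" using that LG by auto
      then have "snd s2 x = snd s1 x" using s2 by blast
      then show ?thesis using s1(6) by simp
    qed
    have f: "snd s2 (\<beta> + ?G + ((h * ?E + x) * ?E + y)) = ?a (Suc t) A h x y"
      if "h < r ^ Suc t" "x < ?E" "y < ?E" for h x y
    proof -
      have "snd s2 (\<beta> + ?G + ((h * ?E + x) * ?E + y)) = f ((h * ?E + x) * ?E + y)"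
        using s2 index3_less[OF that] by blast
      then show ?thesis unfolding f_def index3_div_mod[OF that(2,3)] .
    qed
    show "spec ?B (Assign v_src (Var v_src \<oplus> Var v_G)) s2 1 ?Q"
    proof (rule spec_Assign)
      show "eval (Var v_src \<oplus> Var v_G) s2 \<le> ?B" using v \<beta> by simp
      have "stored T A n (\<beta> + ?G) (Suc t) (set_var v_src (\<beta> + ?G) s2)"
        unfolding stored_def using v f by (simp add: fst_set_var snd_set_var)
      moreover have "eval (Var v_src \<oplus> Var v_G) s2 = \<beta> + ?G" using v by simp
      ultimately show "?Q (set_var v_src (eval (Var v_src \<oplus> Var v_G) s2) s2)"
        using same m by (simp add: fst_set_var snd_set_var)
    qed simp
  qed (use LG in simp)
  have eE: "eval (Var v_E \<oslash> Num d) s = ?E" using s dE by simp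
  have eL: "eval ((Var v_L \<oslash> Num (d * d)) \<otimes> Num r) (set_var v_E ?E s) = ?L"
    unfolding dL[symmetric] using s by (simp add: fst_set_var)
  show ?thesis unfolding pass_stmt_def
  proof (rule spec_Assign_Then[where ?T2.0 = "3 + 2 * ?G"], unfold eE)
    show "spec ?B (Assign v_L ((Var v_L \<oslash> Num (d * d)) \<otimes> Num r) ;; pass_loop T ;; Assign v_src (Var v_src \<oplus> Var v_G))
      (set_var v_E ?E s) (3 + 2 * ?G) ?Q"
      by (rule spec_Assign_Then[where ?T2.0 = "2 + 2 * ?G"], unfold eL)
        (use LG GB in linarith, rule sp[unfolded s1_def], simp)
  qed (use EB in auto)
qed


text \<open>The memory behind the adjacency matrix and the two lists is divided into segments of length
  \<open>block n\<close>.  Each of the three transforms uses \<open>levels n + 1\<close> of them, one for the input and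
  one for the result of every pass.\<close>

definition offset :: "nat \<Rightarrow> nat \<Rightarrow> nat" where
  "offset n q = base n + q * block n"

lemma offset_mono: "q \<le> q' \<Longrightarrow> offset n q \<le> offset n q'"
  by (simp add: offset_def)

lemma offset_Suc: "offset n (Suc q) = offset n q + block n"
  by (simp add: offset_def)

lemma offset_le_bound:
  assumes "q \<le> 3 * (levels n + 1)"
  shows "offset n q \<le> bound n"
  unfolding offset_def using bound_ge(11)[of n] mult_le_mono1[OF assms, of "block n"] by linarith

definition fill_loop :: "expr \<Rightarrow> stmt" where
  "fill_loop entry = For v_x (Var v_D \<otimes> Var v_D) (Write (Var v_src \<oplus> Var v_x) entry)"

definition transform :: "nat \<Rightarrow> expr \<Rightarrow> (nat \<Rightarrow> nat \<Rightarrow> nat \<Rightarrow> int) \<Rightarrow> stmt" where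
  "transform slot entry T =
    Assign v_src (Var v_n \<otimes> Var v_n \<oplus> Num 2 \<otimes> Var v_D \<oplus> Num 2 \<oplus> Num slot \<otimes> (Var v_K \<oplus> Num 1) \<otimes> Var v_G) ;;
    fill_loop entry ;; Assign v_E (Var v_D) ;; Assign v_L (Var v_D \<otimes> Var v_D) ;; For v_i (Var v_K) (pass_stmt T)"

abbreviation same_vars :: "nat set \<Rightarrow> ram_state \<Rightarrow> ram_state \<Rightarrow> bool" where
  "same_vars S s s' \<equiv> (\<forall>u. u \<notin> S \<longrightarrow> fst s' u = fst s u)"

lemma ready_cong: "ready n s \<Longrightarrow> same_vars S s s' \<Longrightarrow> S \<inter> {v_n, v_K, v_D, v_P, v_G, v_Q} = {} \<Longrightarrow> ready n s'"
  by (auto simp: ready_def)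

text \<open>The entry expression is required to depend only on memory below \<open>base n\<close>,
  that is on the graph and the lists; it is therefore insensitive to what the transforms leave
  behind.\<close>

lemma spec_transform:
  assumes rd: "ready n s" and slot: "slot \<le> 2" and T: "bounded_coeffs T" and A: "\<And>x y. A x y \<le> 1"
    and entry: "\<And>i s'. i < side n * side n \<Longrightarrow> same_vars {v_x, v_src} s s' \<Longrightarrow> (\<And>x. x < base n \<Longrightarrow> snd s' x = snd s x) \<Longrightarrow>
      fst s' v_x = i \<Longrightarrow> eval entry s' = A (i div side n) (i mod side n)"
  shows "spec (bound n) (transform slot entry T) s (5 + 2 * block n + levels n * (5 + 2 * block n)) (\<lambda>s'.
    same_vars {v_x, v_i, v_src, v_E, v_L} s s' \<and>
    (\<forall>x. x \<notin> {offset n (slot * (levels n + 1))..<offset n ((slot + 1) * (levels n + 1))} \<longrightarrow> snd s' x = snd s x) \<and>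
    (\<forall>h<block n. snd s' (offset n (slot * (levels n + 1) + levels n) + h) =
      passes d r (residue (modulus n) T) (levels n) A h 0 0))"
proof -
  let ?L = "levels n" and ?B = "bound n" and ?D = "side n" and ?G = "block n"
  let ?q = "slot * (?L + 1)" let ?\<beta> = "offset n ?q" let ?end = "offset n ((slot + 1) * (?L + 1))"
  have q3: "?q + ?L + 1 \<le> 3 * (?L + 1)"
  proof -
    have "(slot + 1) * (?L + 1) \<le> 3 * (?L + 1)" using slot by (intro mult_le_mono1) simp
    then show ?thesis by simp
  qed
  have endq: "(slot + 1) * (?L + 1) = ?q + ?L + 1" by simp
  have base_le: "base n \<le> ?\<beta>" by (simp add: offset_def)
  have DG: "?D * ?D \<le> ?G" by (rule side_square_le_block)
  have \<beta>G: "?\<beta> + ?G \<le> ?end" unfolding offset_Suc[symmetric] endq by (intro offset_mono) simp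
  define s1 where "s1 = set_var v_src ?\<beta> s"
  have s: "fst s v_n = n" "fst s v_K = ?L" "fst s v_D = ?D" "fst s v_G = ?G" using rd by (auto simp: ready_def)
  have e1: "eval (Var v_n \<otimes> Var v_n \<oplus> Num 2 \<otimes> Var v_D \<oplus> Num 2 \<oplus> Num slot \<otimes> (Var v_K \<oplus> Num 1) \<otimes> Var v_G) s = ?\<beta>"
    using s by (simp add: offset_def base_def)
  let ?R = "\<lambda>s'. (\<forall>u. u \<noteq> v_x \<longrightarrow> fst s' u = fst s1 u) \<and>
    (\<forall>x. x \<notin> {?\<beta>..<?\<beta> + ?D * ?D} \<longrightarrow> snd s' x = snd s1 x) \<and>
    (\<forall>i<?D * ?D. snd s' (?\<beta> + i) = A (i div ?D) (i mod ?D))"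
  have fill: "spec ?B (fill_loop entry) s1 (1 + 2 * (?D * ?D)) ?R"
    unfolding fill_loop_def
  proof (rule spec_tabulate)
    show "A (i div ?D) (i mod ?D) \<le> ?B" for i using A[of "i div ?D" "i mod ?D"] bound_ge(13)[of n] by linarith
    fix i s' assume i: "i < ?D * ?D" and v: "\<And>u. u \<noteq> v_x \<Longrightarrow> fst s' u = fst s1 u" and x: "fst s' v_x = i"
      and mem: "\<And>x. x \<notin> {?\<beta>..<?\<beta> + ?D * ?D} \<Longrightarrow> snd s' x = snd s1 x"
    have "eval entry s' = A (i div ?D) (i mod ?D)"
    proof (rule entry[OF i _ _ x])
      show "same_vars {v_x, v_src} s s'" using v by (auto simp: s1_def fst_set_var)
      show "snd s' x = snd s x" if "x < base n" for x
        using mem[of x] base_le that by (auto simp: s1_def snd_set_var)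
    qed
    moreover have "fst s' v_src = ?\<beta>" using v[of v_src] by (simp add: s1_def fst_set_var)
    ultimately show "eval (Var v_src \<oplus> Var v_x) s' = ?\<beta> + i \<and> eval entry s' = A (i div ?D) (i mod ?D)"
      using x by simp
  qed (use s bound_ge(5)[of n] in \<open>auto simp: s1_def fst_set_var\<close>)
  let ?I = "\<lambda>t s'. same_vars {v_x, v_i, v_src, v_E, v_L} s s' \<and> (\<forall>x. x \<notin> {?\<beta>..<?end} \<longrightarrow> snd s' x = snd s x) \<and>
      stored T A n (offset n (?q + t)) t s'"
  let ?loop = "For v_i (Var v_K) (pass_stmt T)"
  have loop: "spec ?B ?loop s3 (1 + ?L * (1 + (4 + 2 * ?G))) (?I ?L)"
    if s3: "?I 0 s3" for s3
  proof (rule spec_For_const[where n = ?L and I = ?I and T = "4 + 2 * ?G"])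
    fix t s' assume t: "t < ?L" and I: "?I t s'"
    let ?t = "set_var v_i t s'"
    have o: "offset n (?q + t) + ?G = offset n (?q + Suc t)" by (simp add: offset_def)
    let ?Q = "\<lambda>s''. same_vars {v_x, v_src, v_E, v_L} ?t s'' \<and>
      (\<forall>x. x \<notin> {offset n (?q + t) + ?G..<offset n (?q + t) + 2 * ?G} \<longrightarrow> snd s'' x = snd ?t x) \<and>
      stored T A n (offset n (?q + t) + ?G) (Suc t) s''"
    have "spec ?B (pass_stmt T) ?t (4 + 2 * ?G) ?Q"
    proof (rule spec_pass_stmt[OF _ t _ T A])
      show "ready n ?t" using I by (intro ready_cong[OF rd, of "{v_x, v_i, v_src, v_E, v_L}"]) (auto simp: fst_set_var)
      show "stored T A n (offset n (?q + t)) t ?t" using I by (simp add: stored_def fst_set_var snd_set_var)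
      show "offset n (?q + t) + ?G \<le> ?B" unfolding o using t q3 by (intro offset_le_bound) simp
    qed
    then show "spec ?B (pass_stmt T) ?t (4 + 2 * ?G) (?I (Suc t))"
    proof (rule spec_weaken)
      fix s'' assume S: "?Q s''"
      have "offset n (?q + t) + 2 * ?G = offset n (?q + t + 2)" by (simp add: offset_def)
      also have "\<dots> \<le> ?end" using t unfolding endq by (intro offset_mono) simp
      finally have e: "offset n (?q + t) + 2 * ?G \<le> ?end" .
      have f: "?\<beta> \<le> offset n (?q + t) + ?G" unfolding o by (intro offset_mono) simp
      have "snd s'' x = snd s x" if "x \<notin> {?\<beta>..<?end}" for x
      proof -
        have "x \<notin> {offset n (?q + t) + ?G..<offset n (?q + t) + 2 * ?G}" using that e f by auto
        then have "snd s'' x = snd ?t x" using S by blast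
        then show ?thesis using I that by (simp add: snd_set_var)
      qed
      then show "?I (Suc t) s''" using S I unfolding o by (auto simp: fst_set_var)
    qed simp
  next
    show "eval (Var v_K) s3 = ?L" using s3 s by simp
  qed (use s3 bound_ge(10) in auto)
  have tail: "spec ?B (Assign v_E (Var v_D) ;; Assign v_L (Var v_D \<otimes> Var v_D) ;; ?loop)
      s2 (3 + ?L * (1 + (4 + 2 * ?G))) (?I ?L)"
    if s2: "?R s2" for s2
  proof -
    define s3 where "s3 = set_var v_L (?D * ?D) (set_var v_E ?D s2)"
    have D: "fst s2 v_D = ?D" using s2 s by (simp add: s1_def fst_set_var)
    have "same_vars {v_x, v_i, v_src, v_E, v_L} s s3" using s2 by (simp add: s3_def s1_def fst_set_var)
    moreover have "snd s3 x = snd s x" if "x \<notin> {?\<beta>..<?end}" for x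
    proof -
      have "x \<notin> {?\<beta>..<?\<beta> + ?D * ?D}" using that \<beta>G DG by auto
      then have "snd s2 x = snd s1 x" using s2 by blast
      then show ?thesis by (simp add: s3_def s1_def snd_set_var)
    qed
    moreover have "stored T A n (offset n (?q + 0)) 0 s3"
    proof -
      have "snd s3 (?\<beta> + ((h * ?D + x) * ?D + y)) = A x y" if "h < 1" "x < ?D" "y < ?D" for h x y
      proof -
        have "x * ?D + y < ?D * ?D" using that by (intro index_less) auto
        then have "snd s2 (?\<beta> + (x * ?D + y)) = A ((x * ?D + y) div ?D) ((x * ?D + y) mod ?D)" using s2 by blast
        then show ?thesis using that by (simp add: s3_def snd_set_var)
      qed
      moreover have "fst s3 v_src = ?\<beta>" using s2 by (simp add: s3_def s1_def fst_set_var)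
      moreover have "side_at n 0 = ?D" by (simp add: side_at_def side_def)
      ultimately show ?thesis by (simp add: stored_def s3_def fst_set_var)
    qed
    ultimately have I0: "?I 0 s3" by blast
    have e: "eval (Var v_D) s2 = ?D" "eval (Var v_D \<otimes> Var v_D) (set_var v_E ?D s2) = ?D * ?D"
      using D by (auto simp: fst_set_var)
    show ?thesis
    proof (rule spec_Assign_Then[where ?T2.0 = "2 + ?L * (1 + (4 + 2 * ?G))"], unfold e(1))
      show "spec ?B (Assign v_L (Var v_D \<otimes> Var v_D) ;; ?loop) (set_var v_E ?D s2)
        (2 + ?L * (1 + (4 + 2 * ?G))) (?I ?L)"
        by (rule spec_Assign_Then[where ?T2.0 = "1 + ?L * (1 + (4 + 2 * ?G))"], unfold e(2))
          (rule bound_ge(5), rule loop[OF I0, unfolded s3_def], simp)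
    qed (use bound_ge(6) in auto)
  qed
  have "spec ?B (transform slot entry T) s (5 + 2 * ?G + ?L * (5 + 2 * ?G)) (?I ?L)"
    unfolding transform_def
  proof (rule spec_Assign_Then[where ?T2.0 = "4 + 2 * ?G + ?L * (5 + 2 * ?G)"], unfold e1)
    show "?\<beta> \<le> ?B" using q3 by (intro offset_le_bound) simp
    show "spec ?B (fill_loop entry ;; Assign v_E (Var v_D) ;; Assign v_L (Var v_D \<otimes> Var v_D) ;; ?loop) (set_var v_src ?\<beta> s) (4 + 2 * ?G + ?L * (5 + 2 * ?G)) (?I ?L)"
      by (rule spec_Then[OF fill[unfolded s1_def] tail[unfolded s1_def]]) (use DG in auto)
  qed simp
  then show ?thesis
  proof (rule spec_weaken)
    fix s' assume I: "?I ?L s'"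
    have "snd s' (offset n (?q + ?L) + h) = passes d r (residue (modulus n) T) ?L A h 0 0" if "h < ?G" for h
    proof -
      have 1: "side_at n ?L = 1" by (simp add: side_at_def)
      have "h < r ^ ?L" using that by (simp add: block_def)
      then have "snd s' (offset n (?q + ?L) + ((h * 1 + 0) * 1 + 0)) = passes d r (residue (modulus n) T) ?L A h 0 0"
        using I unfolding stored_def 1 by blast
      then show ?thesis by simp
    qed
    then show "same_vars {v_x, v_i, v_src, v_E, v_L} s s' \<and> (\<forall>x. x \<notin> {?\<beta>..<?end} \<longrightarrow> snd s' x = snd s x) \<and>
      (\<forall>h<?G. snd s' (offset n (?q + ?L) + h) = passes d r (residue (modulus n) T) ?L A h 0 0)"
      using I by blast
  qed simp
qed

section \<open>Combining the three transforms\<close>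

definition result_expr :: "nat \<Rightarrow> expr" where
  "result_expr slot = Mem (Var v_n \<otimes> Var v_n \<oplus> Num 2 \<otimes> Var v_D \<oplus> Num 2 \<oplus>
     (Num slot \<otimes> (Var v_K \<oplus> Num 1) \<oplus> Var v_K) \<otimes> Var v_G \<oplus> Var v_x)"

lemma eval_result_expr: "ready n s \<Longrightarrow> eval (result_expr slot) s = snd s (offset n (slot * (levels n + 1) + levels n) + fst s v_x)"
  by (simp add: result_expr_def ready_def offset_def base_def)

definition acc_stmt :: stmt where
  "acc_stmt = Assign v_acc (Var v_acc \<oplus> result_expr 0 \<otimes> result_expr 1 \<otimes> result_expr 2)"

text \<open>The only reduction of the whole computation. The division undoes the factor N^K that
  clearing denominators has introduced.\<close>

definition output_stmt :: stmt where
  "output_stmt = Assign v_n (mod_expr (Var v_acc) (Var v_Q) \<oslash> Var v_P)"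

definition combine :: stmt where
  "combine = Assign v_acc (Num 0) ;; For v_x (Var v_G) acc_stmt ;; output_stmt"

lemma spec_combine:
  assumes rd: "ready n s"
    and f: "\<And>slot h. slot \<le> 2 \<Longrightarrow> h < block n \<Longrightarrow> snd s (offset n (slot * (levels n + 1) + levels n) + h) = f slot h"
    and fb: "\<And>slot h. f slot h \<le> entry_bound n"
  shows "spec (bound n) combine s (3 + 2 * block n)
    (\<lambda>s'. fst s' v_n = (\<Sum>h<block n. f 0 h * f 1 h * f 2 h) mod modulus n div scale n)"
proof -
  let ?B = "bound n" and ?S = "\<lambda>i. \<Sum>h<i. f 0 h * f 1 h * f 2 h" and ?G = "block n"
  have S: "?S i \<le> ?B" if "i \<le> ?G" for i
  proof -
    have "?S i \<le> (\<Sum>h<i. entry_bound n * entry_bound n * entry_bound n)"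
      by (intro sum_mono mult_le_mono fb)
    also have "\<dots> = i * entry_bound n ^ 3" by (simp add: power3_eq_cube)
    also have "\<dots> \<le> ?G * entry_bound n ^ 3" using that by (rule mult_le_mono1)
    finally show ?thesis using bound_ge(12)[of n] by linarith
  qed
  let ?I = "\<lambda>i s'. same_vars {v_x, v_acc} s s' \<and> snd s' = snd s \<and> fst s' v_acc = ?S i"
  have loop: "spec ?B (For v_x (Var v_G) acc_stmt)
    s1 (1 + ?G * (1 + 1)) (?I ?G)" if s1: "?I 0 s1" for s1
  proof (rule spec_For_const[where n = ?G and I = ?I and T = 1])
    fix i s' assume i: "i < ?G" and I: "?I i s'"
    let ?t = "set_var v_x i s'"
    have "ready n ?t" using I by (intro ready_cong[OF rd, of "{v_x, v_acc}"]) (auto simp: fst_set_var)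
    then have "eval (result_expr slot) ?t = f slot i" if "slot \<le> 2" for slot
      using f[OF that i] I by (simp add: eval_result_expr fst_set_var snd_set_var)
    then have "eval (Var v_acc \<oplus> result_expr 0 \<otimes> result_expr 1 \<otimes> result_expr 2) ?t = ?S (Suc i)"
      using I by (simp add: fst_set_var)
    then show "spec ?B acc_stmt ?t 1 (?I (Suc i))"
      unfolding acc_stmt_def using S[of "Suc i"] i I by (intro spec_Assign) (auto simp: fst_set_var snd_set_var)
  next
    show "eval (Var v_G) s1 = ?G" using s1 rd by (simp add: ready_def)
  qed (use s1 bound_ge in auto)
  have "spec ?B (For v_x (Var v_G) acc_stmt ;; output_stmt) (set_var v_acc 0 s) (2 + 2 * ?G)
    (\<lambda>s'. fst s' v_n = ?S ?G mod modulus n div scale n)"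
  proof (rule spec_Then[OF loop, where ?T2.0 = 1])
    fix s' assume I: "?I ?G s'"
    then have e: "eval (mod_expr (Var v_acc) (Var v_Q) \<oslash> Var v_P) s' = ?S ?G mod modulus n div scale n"
      using rd by (simp add: ready_def)
    show "spec ?B output_stmt s' 1 (\<lambda>s'. fst s' v_n = ?S ?G mod modulus n div scale n)"
      unfolding output_stmt_def
    proof (rule spec_Assign, unfold e)
      have "?S ?G mod modulus n div scale n \<le> ?S ?G" by (meson div_le_dividend mod_less_eq_dividend order_trans)
      then show "?S ?G mod modulus n div scale n \<le> ?B" using S[of ?G] by simp
    qed (auto simp: fst_set_var)
  qed (auto simp: fst_set_var snd_set_var)
  then show ?thesis unfolding combine_def by (intro spec_Assign_Then[where ?T2.0 = "2 + 2 * ?G"]) auto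
qed

section \<open>The complete program\<close>

definition row_expr :: expr where "row_expr = Var v_x \<oslash> Var v_D"
definition col_expr :: expr where "col_expr = mod_expr (Var v_x) (Var v_D)"
definition X_expr :: "expr \<Rightarrow> expr" where "X_expr e = Mem (Var v_n \<otimes> Var v_n \<oplus> e)"
definition Z_expr :: "expr \<Rightarrow> expr" where "Z_expr e = Mem (Var v_n \<otimes> Var v_n \<oplus> Var v_D \<oplus> Num 1 \<oplus> e)"

text \<open>Memory is read even at positions past the end of a list; the comparison factors
  annihilate whatever is found there.\<close>

definition entry_XX :: expr where
  "entry_XX = less_expr row_expr (Var v_X) \<otimes> less_expr col_expr (Var v_X) \<otimes>
     code_expr (m + m) (X_expr row_expr \<oplus> power_expr (Var v_n) m \<otimes> X_expr col_expr)"

definition entry_XZ :: expr where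
  "entry_XZ = less_expr row_expr (Var v_X) \<otimes> less_expr col_expr (Var v_Z) \<otimes>
     code_expr (m + j) (X_expr row_expr \<oplus> power_expr (Var v_n) m \<otimes> Z_expr col_expr)"

definition main_stmt :: stmt where
  "main_stmt = init ;; enumerate_codes m (Var v_n \<otimes> Var v_n) v_X ;;
     enumerate_codes j (Var v_n \<otimes> Var v_n \<oplus> Var v_D \<oplus> Num 1) v_Z ;;
     transform 0 entry_XX U ;; transform 1 entry_XZ V ;; transform 2 entry_XZ W ;; combine"

definition code_matrix :: "nat set set \<Rightarrow> nat \<Rightarrow> nat \<Rightarrow> nat \<Rightarrow> nat \<Rightarrow> nat" where
  "code_matrix E n l x y = of_bool (x < min (side n) (length (codes E n m)) \<and> y < min (side n) (length (codes E n l)) \<and>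
     clique_code (adjacent E) n (m + l) (codes E n m ! x + n ^ m * codes E n l ! y))"

definition transformed :: "nat set set \<Rightarrow> nat \<Rightarrow> nat \<Rightarrow> nat \<Rightarrow> nat" where
  "transformed E n slot h = (case slot of 0 \<Rightarrow> passes d r (residue (modulus n) U) (levels n) (code_matrix E n m) h 0 0
     | Suc 0 \<Rightarrow> passes d r (residue (modulus n) V) (levels n) (code_matrix E n j) h 0 0
     | _ \<Rightarrow> passes d r (residue (modulus n) W) (levels n) (code_matrix E n j) h 0 0)"

lemma code_matrix_le_1: "code_matrix E n l x y \<le> 1"
  by (simp add: code_matrix_def)

lemma transformed_le: "transformed E n slot h \<le> entry_bound n"
  unfolding transformed_def using passes_le_entry_bound[OF _ code_matrix_le_1 order_refl] bounded_coeffs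
  by (auto split: nat.split)

definition listed :: "nat set set \<Rightarrow> nat \<Rightarrow> ram_state \<Rightarrow> bool" where
  "listed E n s \<longleftrightarrow> encodes_graph E n (snd s) \<and>
     fst s v_X = min (side n) (length (codes E n m)) \<and> (\<forall>i<fst s v_X. snd s (n * n + i) = codes E n m ! i) \<and>
     fst s v_Z = min (side n) (length (codes E n j)) \<and> (\<forall>i<fst s v_Z. snd s (n * n + side n + 1 + i) = codes E n j ! i)"

lemma listed_cong:
  assumes "listed E n s" "\<And>x. x < base n \<Longrightarrow> snd s' x = snd s x" "fst s' v_X = fst s v_X" "fst s' v_Z = fst s v_Z"
  shows "listed E n s'"
proof -
  have 1: "encodes_graph E n (snd s')"
    by (rule encodes_graph_cong[of E n "snd s"]) (use assms in \<open>auto simp: listed_def base_def\<close>)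
  have 2: "snd s' (n * n + i) = snd s (n * n + i)" if "i < fst s v_X" for i
    using assms that by (auto simp: listed_def base_def)
  have 3: "snd s' (n * n + side n + 1 + i) = snd s (n * n + side n + 1 + i)" if "i < fst s v_Z" for i
    using assms that by (auto simp: listed_def base_def)
  show ?thesis using 1 2 3 assms(1,3,4) by (simp add: listed_def)
qed

lemma eval_entry:
  assumes "ready n s" "listed E n s" "0 < n"
  shows "eval entry_XX s = code_matrix E n m (fst s v_x div side n) (fst s v_x mod side n)"
    and "eval entry_XZ s = code_matrix E n j (fst s v_x div side n) (fst s v_x mod side n)"
proof -
  have g: "encodes_graph E n (snd s)" using assms(2) by (simp add: listed_def)
  have s: "fst s v_n = n" "fst s v_D = side n" using assms(1) by (auto simp: ready_def)
  show "eval entry_XX s = code_matrix E n m (fst s v_x div side n) (fst s v_x mod side n)"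
    using assms(2) unfolding entry_XX_def
    by (simp add: s clique_code_memory[OF g assms(3)] row_expr_def col_expr_def X_expr_def code_matrix_def listed_def)
  show "eval entry_XZ s = code_matrix E n j (fst s v_x div side n) (fst s v_x mod side n)"
    using assms(2) unfolding entry_XZ_def
    by (simp add: s clique_code_memory[OF g assms(3)] row_expr_def col_expr_def X_expr_def Z_expr_def code_matrix_def listed_def add.assoc)
qed

definition answer :: "nat set set \<Rightarrow> nat \<Rightarrow> nat" where
  "answer E n = (\<Sum>h<block n. transformed E n 0 h * transformed E n 1 h * transformed E n 2 h) mod modulus n div scale n"

definition num_steps :: "nat \<Rightarrow> nat" where
  "num_steps n = 28 + 6 * (a * n) + 3 * n ^ m + 3 * n ^ j + 8 * block n + 3 * (levels n * (5 + 2 * block n))"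


definition prepared :: "nat set set \<Rightarrow> nat \<Rightarrow> nat \<Rightarrow> ram_state \<Rightarrow> bool" where
  "prepared E n q s \<longleftrightarrow> ready n s \<and> listed E n s \<and>
     (\<forall>slot<q. \<forall>h<block n. snd s (offset n (slot * (levels n + 1) + levels n) + h) = transformed E n slot h)"

text \<open>Different slots use disjoint segments, all from \<open>base n\<close> on. So a transform
  preserves the graph, the lists and the results of earlier slots.\<close>

lemma spec_transform_prepared:
  assumes P: "prepared E n q s" and "0 < n" "q \<le> 2" and T: "bounded_coeffs T" and A: "\<And>x y. A x y \<le> 1"
    and entry: "\<And>s'. ready n s' \<Longrightarrow> listed E n s' \<Longrightarrow> eval entry s' = A (fst s' v_x div side n) (fst s' v_x mod side n)"
    and tr: "\<And>h. transformed E n q h = passes d r (residue (modulus n) T) (levels n) A h 0 0"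
  shows "spec (bound n) (transform q entry T) s (5 + 2 * block n + levels n * (5 + 2 * block n)) (prepared E n (Suc q))"
proof -
  let ?L = "levels n" and ?S = "{v_x, v_i, v_src, v_E, v_L}"
  have rd: "ready n s" and li: "listed E n s" using P by (auto simp: prepared_def)
  let ?Q = "\<lambda>s'. same_vars ?S s s' \<and>
    (\<forall>x. x \<notin> {offset n (q * (?L + 1))..<offset n ((q + 1) * (?L + 1))} \<longrightarrow> snd s' x = snd s x) \<and>
    (\<forall>h<block n. snd s' (offset n (q * (?L + 1) + ?L) + h) =
      passes d r (residue (modulus n) T) ?L A h 0 0)"
  have "spec (bound n) (transform q entry T) s (5 + 2 * block n + ?L * (5 + 2 * block n)) ?Q"
  proof (rule spec_transform[OF rd assms(3) T A])
    fix i s' assume i: "i < side n * side n" and sv: "same_vars {v_x, v_src} s s'"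
      and mem: "\<And>x. x < base n \<Longrightarrow> snd s' x = snd s x" and x: "fst s' v_x = i"
    have "ready n s'" by (rule ready_cong[OF rd sv]) auto
    moreover have "listed E n s'" by (rule listed_cong[OF li mem]) (use sv in auto)
    ultimately show "eval entry s' = A (i div side n) (i mod side n)" using entry x by blast
  qed
  then show ?thesis
  proof (rule spec_weaken)
    fix s' assume H: "?Q s'"
    have sv: "same_vars ?S s s'" using H by blast
    have "ready n s'" by (rule ready_cong[OF rd sv]) auto
    moreover have "listed E n s'"
    proof (rule listed_cong[OF li])
      fix x assume "x < base n"
      then have "x \<notin> {offset n (q * (?L + 1))..<offset n ((q + 1) * (?L + 1))}" by (auto simp: offset_def)
      then show "snd s' x = snd s x" using H by blast
    qed (use sv in auto)
    moreover have "snd s' (offset n (slot * (?L + 1) + ?L) + h) = transformed E n slot h"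
      if "slot < Suc q" "h < block n" for slot h
    proof (cases "slot = q")
      case True
      show ?thesis unfolding True tr using H that(2) by blast
    next
      case False
      then have "slot * (?L + 1) + ?L + 1 \<le> q * (?L + 1)"
        using that(1) mult_le_mono1[of "Suc slot" q "?L + 1"] by simp
      then have "offset n (Suc (slot * (?L + 1) + ?L)) \<le> offset n (q * (?L + 1))" by (intro offset_mono) simp
      then have "offset n (slot * (?L + 1) + ?L) + h \<notin> {offset n (q * (?L + 1))..<offset n ((q + 1) * (?L + 1))}"
        using that(2) by (simp add: offset_Suc)
      then have "snd s' (offset n (slot * (?L + 1) + ?L) + h) = snd s (offset n (slot * (?L + 1) + ?L) + h)"
        using H by blast
      then show ?thesis using P that False by (simp add: prepared_def)
    qed
    ultimately show "prepared E n (Suc q) s'" unfolding prepared_def by blast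
  qed simp
qed

lemma spec_main_stmt:
  assumes "fst s v_n = n" "0 < n" and G: "encodes_graph E n (snd s)"
  shows "spec (bound n) main_stmt s (num_steps n) (\<lambda>s'. fst s' v_n = answer E n)"
proof -
  let ?B = "bound n" and ?D = "side n" and ?X = "codes E n m" and ?Z = "codes E n j"
  let ?Q = "\<lambda>s'. fst s' v_n = answer E n"
  let ?e1 = "enumerate_codes m (Var v_n \<otimes> Var v_n) v_X"
  let ?e2 = "enumerate_codes j (Var v_n \<otimes> Var v_n \<oplus> Var v_D \<oplus> Num 1) v_Z"
  let ?c2 = "transform 2 entry_XZ W ;; combine" let ?c1 = "transform 1 entry_XZ V ;; ?c2"
  let ?c0 = "transform 0 entry_XX U ;; ?c1"
  let ?t = "5 + 2 * block n + levels n * (5 + 2 * block n)"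
  have one: "prepared E n 1 = prepared E n (Suc 0)" and two: "prepared E n 2 = prepared E n (Suc 1)"
    and three: "prepared E n 3 = prepared E n (Suc 2)" by (simp_all add: numeral_eq_Suc)
  have p3: "spec ?B combine s' (3 + 2 * block n) ?Q" if "prepared E n 3 s'" for s'
    unfolding answer_def by (rule spec_combine) (use that transformed_le in \<open>auto simp: prepared_def\<close>)
  have p2: "spec ?B ?c2 s' (?t + (3 + 2 * block n)) ?Q"
    if "prepared E n 2 s'" for s'
  proof (rule spec_Then[OF _ p3 order_refl])
    show "spec ?B (transform 2 entry_XZ W) s' ?t (prepared E n 3)"
      unfolding three
      by (rule spec_transform_prepared[where A = "code_matrix E n j"])
        (use that assms(2) bounded_coeffs eval_entry code_matrix_le_1 in \<open>auto simp: numeral_2_eq_2 transformed_def\<close>)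
  qed
  have p1: "spec ?B ?c1 s'
    (?t + (?t + (3 + 2 * block n))) ?Q"
    if "prepared E n 1 s'" for s'
  proof (rule spec_Then[OF _ p2 order_refl])
    show "spec ?B (transform 1 entry_XZ V) s' ?t (prepared E n 2)"
      unfolding two
      by (rule spec_transform_prepared[where A = "code_matrix E n j"])
        (use that assms(2) bounded_coeffs eval_entry code_matrix_le_1 in \<open>auto simp: transformed_def\<close>)
  qed
  have p0: "spec ?B ?c0 s'
    (?t + (?t + (?t + (3 + 2 * block n)))) ?Q"
    if "prepared E n 0 s'" for s'
  proof (rule spec_Then[OF _ p1 order_refl])
    show "spec ?B (transform 0 entry_XX U) s' ?t (prepared E n 1)"
      unfolding one
      by (rule spec_transform_prepared[where A = "code_matrix E n m"])
        (use that assms(2) bounded_coeffs eval_entry code_matrix_le_1 in \<open>auto simp: transformed_def\<close>)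
  qed
  have e2: "spec ?B ?e2 s' (2 + 3 * n ^ j) (prepared E n 0)"
    if s': "ready n s'" "encodes_graph E n (snd s')" "fst s' v_X = min ?D (length ?X)"
      "\<forall>i<fst s' v_X. snd s' (n * n + i) = ?X ! i" for s'
  proof -
    let ?\<beta> = "n * n + ?D + 1"
    let ?H = "\<lambda>s''. (\<forall>u. u \<noteq> v_Z \<longrightarrow> u \<noteq> v_x \<longrightarrow> fst s'' u = fst s' u) \<and>
    (\<forall>x. x < ?\<beta> \<or> ?\<beta> + ?D < x \<longrightarrow> snd s'' x = snd s' x) \<and> fst s'' v_Z = min ?D (length ?Z) \<and>
    (\<forall>i<fst s'' v_Z. snd s'' (?\<beta> + i) = ?Z ! i)"
    have "spec ?B ?e2 s' (2 + 3 * n ^ j) ?H"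
      by (rule spec_enumerate_codes) (use s' assms(2) bound_ge in \<open>auto simp: ready_def\<close>)
    then show ?thesis
    proof (rule spec_weaken)
      fix s'' assume H: "?H s''"
      have "ready n s''" using H by (intro ready_cong[OF s'(1), of "{v_Z, v_x}"]) auto
      moreover have "encodes_graph E n (snd s'')" by (rule encodes_graph_cong[OF s'(2)]) (use H in auto)
      moreover have "snd s'' (n * n + i) = ?X ! i" if "i < fst s'' v_X" for i
      proof -
        have "fst s'' v_X = fst s' v_X" using H by auto
        then have "i < fst s' v_X" "i < ?D" using that s'(3) by auto
        then show ?thesis using H s'(4) by auto
      qed
      ultimately show "prepared E n 0 s''" using H s'(3) by (simp add: prepared_def listed_def)
    qed simp
  qed
  let ?P = "\<lambda>s'. ready n s' \<and> encodes_graph E n (snd s') \<and> fst s' v_X = min ?D (length ?X) \<and>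
      (\<forall>i<fst s' v_X. snd s' (n * n + i) = ?X ! i)"
  have e1: "spec ?B ?e1 s' (2 + 3 * n ^ m) ?P"
    if s': "ready n s'" "encodes_graph E n (snd s')" for s'
  proof -
    let ?H = "\<lambda>s''. (\<forall>u. u \<noteq> v_X \<longrightarrow> u \<noteq> v_x \<longrightarrow> fst s'' u = fst s' u) \<and>
    (\<forall>x. x < n * n \<or> n * n + ?D < x \<longrightarrow> snd s'' x = snd s' x) \<and> fst s'' v_X = min ?D (length ?X) \<and>
    (\<forall>i<fst s'' v_X. snd s'' (n * n + i) = ?X ! i)"
    have "spec ?B ?e1 s' (2 + 3 * n ^ m) ?H"
      by (rule spec_enumerate_codes) (use s' assms(2) bound_ge in \<open>auto simp: ready_def\<close>)
    then show ?thesis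
    proof (rule spec_weaken)
      fix s'' assume H: "?H s''"
      have "ready n s''" using H by (intro ready_cong[OF s'(1), of "{v_X, v_x}"]) auto
      moreover have "encodes_graph E n (snd s'')" by (rule encodes_graph_cong[OF s'(2)]) (use H in auto)
      ultimately show "?P s''" using H by blast
    qed simp
  qed
  have i: "spec ?B init s (6 + 6 * (a * n)) (\<lambda>s'. ready n s' \<and> encodes_graph E n (snd s'))"
    by (rule spec_weaken[OF spec_init[OF assms(1)]])
      (use G in \<open>auto simp: init_inv_def ready_def side_def scale_def block_def\<close>)
  show ?thesis unfolding main_stmt_def
  proof (rule spec_Then[OF i])
    fix s' assume s': "ready n s' \<and> encodes_graph E n (snd s')"
    show "spec ?B (?e1 ;; ?e2 ;; ?c0) s'
      (2 + 3 * n ^ m + (2 + 3 * n ^ j + (?t + (?t + (?t + (3 + 2 * block n)))))) ?Q"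
    proof (rule spec_Then[OF e1 _ order_refl])
      fix s'' assume s'': "?P s''"
      show "spec ?B (?e2 ;; ?c0) s''
        (2 + 3 * n ^ j + (?t + (?t + (?t + (3 + 2 * block n))))) ?Q"
        by (rule spec_Then[OF e2 p0 order_refl]) (use s'' in auto)
    qed (use s' in auto)
  next
    show "6 + 6 * (a * n) + (2 + 3 * n ^ m + (2 + 3 * n ^ j + (?t + (?t + (?t + (3 + 2 * block n)))))) \<le> num_steps n"
      by (simp add: num_steps_def)
  qed
qed

text \<open>A tuple with a part that is not a clique contributes 0 to the sum over all codes. Each
  of the three sums can thus be restricted to the corresponding list, provided that the cutoff has
  not truncated it.\<close>

lemma tri_code_matrix:
  assumes "0 < n" and X: "length (codes E n m) \<le> side n" and Z: "length (codes E n j) \<le> side n"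
  shows "tri (side n) (code_matrix E n m) (code_matrix E n j) (code_matrix E n j) = card (cliques (m + (m + j)) n E)"
proof -
  let ?X = "codes E n m" and ?Z = "codes E n j" and ?D = "side n"
  let ?c = "clique_code (adjacent E) n"
  let ?F = "\<lambda>x y z. of_bool (?c (m + m) (x + n ^ m * y)) * of_bool (?c (m + j) (y + n ^ m * z)) *
       of_bool (?c (m + j) (x + n ^ m * z)) :: nat"
  have "card (cliques (m + (m + j)) n E) = (\<Sum>x<n ^ m. \<Sum>y<n ^ m. \<Sum>z<n ^ j. ?F x y z)"
    by (rule card_cliques_eq_sum[OF assms(1) m])
  also have "\<dots> = (\<Sum>x<?D. if x < length ?X then (\<Sum>y<n ^ m. \<Sum>z<n ^ j. ?F (?X ! x) y z) else 0)"
  proof (rule sum_codes[OF _ X])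
    fix x assume "x < n ^ m" "\<not> ?c m x"
    then have "\<not> ?c (m + m) (x + n ^ m * y)" for y using clique_code_parts(1) by blast
    then show "(\<Sum>y<n ^ m. \<Sum>z<n ^ j. ?F x y z) = 0" by simp
  qed
  also have "\<dots> = (\<Sum>x<?D. if x < length ?X then (\<Sum>y<?D. if y < length ?X then
      (\<Sum>z<?D. if z < length ?Z then ?F (?X ! x) (?X ! y) (?Z ! z) else 0) else 0) else 0)"
  proof (rule sum.cong[OF refl], rule if_cong[OF refl _ refl])
    fix x
    have "(\<Sum>y<n ^ m. \<Sum>z<n ^ j. ?F (?X ! x) y z) = (\<Sum>y<?D. if y < length ?X then (\<Sum>z<n ^ j. ?F (?X ! x) (?X ! y) z) else 0)"
    proof (rule sum_codes[OF _ X])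
      fix y assume "y < n ^ m" "\<not> ?c m y"
      then have "\<not> ?c (m + j) (y + n ^ m * z)" for z using clique_code_parts(1) by blast
      then show "(\<Sum>z<n ^ j. ?F (?X ! x) y z) = 0" by simp
    qed
    also have "\<dots> = (\<Sum>y<?D. if y < length ?X then
      (\<Sum>z<?D. if z < length ?Z then ?F (?X ! x) (?X ! y) (?Z ! z) else 0) else 0)"
    proof (rule sum.cong[OF refl])
      fix y
      have "(\<Sum>z<n ^ j. ?F (?X ! x) (?X ! y) z) = (\<Sum>z<?D. if z < length ?Z then ?F (?X ! x) (?X ! y) (?Z ! z) else 0)"
        if y: "y < length ?X"
      proof (rule sum_codes[OF _ Z])
        fix z assume z: "z < n ^ j" "\<not> ?c j z"
        have "?X ! y \<in> set ?X" using y by simp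
        then have "?X ! y < n ^ m" by (simp add: codes_def)
        then have "\<not> ?c (m + j) (?X ! y + n ^ m * z)" using z(2) clique_code_parts(2) by blast
        then show "?F (?X ! x) (?X ! y) z = 0" by simp
      qed
      then show "(if y < length ?X then (\<Sum>z<n ^ j. ?F (?X ! x) (?X ! y) z) else 0) = (if y < length ?X then
        (\<Sum>z<?D. if z < length ?Z then ?F (?X ! x) (?X ! y) (?Z ! z) else 0) else 0)" by simp
    qed
    finally show "(\<Sum>y<n ^ m. \<Sum>z<n ^ j. ?F (?X ! x) y z) = (\<Sum>y<?D. if y < length ?X then
      (\<Sum>z<?D. if z < length ?Z then ?F (?X ! x) (?X ! y) (?Z ! z) else 0) else 0)" .
  qed
  also have "\<dots> = (\<Sum>x<?D. \<Sum>y<?D. \<Sum>z<?D. code_matrix E n m x y * code_matrix E n j y z * code_matrix E n j x z)"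
  proof (rule sum.cong[OF refl])
    fix x
    show "(if x < length ?X then (\<Sum>y<?D. if y < length ?X then
      (\<Sum>z<?D. if z < length ?Z then ?F (?X ! x) (?X ! y) (?Z ! z) else 0) else 0) else 0) =
      (\<Sum>y<?D. \<Sum>z<?D. code_matrix E n m x y * code_matrix E n j y z * code_matrix E n j x z)"
    proof (cases "x < length ?X")
      case True
      have "(if y < length ?X then (\<Sum>z<?D. if z < length ?Z then ?F (?X ! x) (?X ! y) (?Z ! z) else 0) else 0) =
        (\<Sum>z<?D. code_matrix E n m x y * code_matrix E n j y z * code_matrix E n j x z)" for y
      proof (cases "y < length ?X")
        case y: True
        have "(if z < length ?Z then ?F (?X ! x) (?X ! y) (?Z ! z) else 0) =
          code_matrix E n m x y * code_matrix E n j y z * code_matrix E n j x z" for z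
          using True y X Z by (simp add: code_matrix_def min_absorb2)
        then show ?thesis using y by simp
      qed (simp add: code_matrix_def)
      then show ?thesis using True by simp
    qed (simp add: code_matrix_def)
  qed
  finally show ?thesis by (simp add: tri_def)
qed

lemma card_cliques_le: "card (cliques l n E) \<le> n ^ l"
proof (cases "l \<le> n")
  case True
  have "card (cliques l n E) \<le> card {S. S \<subseteq> {..<n} \<and> card S = l}"
    by (rule card_mono) (auto simp: cliques_def intro: finite_subset[of _ "Pow {..<n}"])
  also have "\<dots> = n choose l" by (simp add: n_subsets)
  also have "\<dots> \<le> n ^ l" using True by (rule binomial_le_pow)
  finally show ?thesis .
next
  case False
  have "S \<notin> cliques l n E" for S
    using False card_mono[of "{..<n}" S] by (auto simp: cliques_def)
  then have "cliques l n E = {}" by blast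
  then show ?thesis by simp
qed

text \<open>The accumulated sum is only congruent to the scaled count, because negative coefficients
  were replaced. The scaled count is below the modulus, so the remainder equals it.\<close>

lemma answer_eq:
  assumes "0 < n" "length (codes E n m) \<le> side n" "length (codes E n j) \<le> side n"
  shows "answer E n = card (cliques (m + (m + j)) n E)"
proof -
  let ?c = "card (cliques (m + (m + j)) n E)" and ?Q = "modulus n" and ?L = "levels n"
  let ?A = "\<lambda>x y. int (code_matrix E n m x y)" and ?B = "\<lambda>x y. int (code_matrix E n j x y)"
  define S where "S = (\<Sum>h<block n. transformed E n 0 h * transformed E n 1 h * transformed E n 2 h)"
  have Q: "1 \<le> ?Q" using modulus_pos[of n] by simp
  have "int ?Q dvd int S - (\<Sum>h<r ^ ?L. passes d r U ?L ?A h 0 0 * passes d r V ?L ?B h 0 0 * passes d r W ?L ?B h 0 0)"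
    unfolding S_def block_def of_nat_sum of_nat_mult
    by (intro dvd_diff_sum dvd_diff_mult) (simp_all add: transformed_def numeral_2_eq_2 passes_residue_cong[OF Q])
  also have "(\<Sum>h<r ^ ?L. passes d r U ?L ?A h 0 0 * passes d r V ?L ?B h 0 0 * passes d r W ?L ?B h 0 0)
    = int N ^ ?L * tri (d ^ ?L) ?A ?B ?B" by (rule sum_passes[OF trilinear])
  also have "tri (d ^ ?L) ?A ?B ?B = int (tri (side n) (code_matrix E n m) (code_matrix E n j) (code_matrix E n j))"
    by (simp add: tri_def side_def)
  also have "int N ^ ?L * \<dots> = int (scale n * ?c)"
    unfolding tri_code_matrix[OF assms] by (simp add: scale_def)
  finally have "int S mod int ?Q = int (scale n * ?c) mod int ?Q" by (simp only: mod_eq_dvd_iff)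
  then have "S mod ?Q = (scale n * ?c) mod ?Q" by (metis of_nat_eq_iff zmod_int)
  also have "\<dots> = scale n * ?c"
  proof (rule mod_less)
    have "scale n * ?c \<le> scale n * n ^ (m + (m + j))" by (rule mult_le_mono2[OF card_cliques_le])
    then show "scale n * ?c < ?Q" unfolding modulus_def by linarith
  qed
  finally have "S mod ?Q div scale n = ?c" using scale_pos[of n] by simp
  then show ?thesis by (simp add: answer_def S_def)
qed

end

section \<open>Running time and failure probability\<close>

text \<open>For \<open>q = 1\<close> this is polynomial growth. Powers of polynomial quantities with
  exponent \<open>levels n\<close> need \<open>q = 2\<close>; their bit length is still
  polylogarithmic.\<close>

definition log_poly :: "nat \<Rightarrow> (nat \<Rightarrow> nat) \<Rightarrow> bool" where
  "log_poly q f \<longleftrightarrow> (\<exists>c. \<forall>n\<ge>1. f n \<le> 2 ^ (c * bits n ^ q))"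

lemma bits_pos: "1 \<le> n \<Longrightarrow> 1 \<le> bits n"
  using bits_mono[of 1 n] by (simp add: bits_simps)

lemma less_power_bits: "n < 2 ^ bits n"
  using bits_le_iff[of n "bits n"] by simp

lemma log_poly_const: "log_poly q (\<lambda>_. c)"
  unfolding log_poly_def
proof (intro exI[of _ c] allI impI)
  fix n :: nat assume "1 \<le> n"
  then have "1 \<le> bits n ^ q" using bits_pos by simp
  have "c \<le> 2 ^ c" using less_exp[of c] by simp
  also have "\<dots> \<le> 2 ^ (c * bits n ^ q)" using \<open>1 \<le> bits n ^ q\<close> by (intro power_increasing) auto
  finally show "c \<le> 2 ^ (c * bits n ^ q)" .
qed

lemma log_poly_mult: "log_poly q f \<Longrightarrow> log_poly q g \<Longrightarrow> log_poly q (\<lambda>n. f n * g n)"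
proof -
  assume "log_poly q f" "log_poly q g"
  then obtain c c' where "\<And>n. n \<ge> 1 \<Longrightarrow> f n \<le> 2 ^ (c * bits n ^ q)" "\<And>n. n \<ge> 1 \<Longrightarrow> g n \<le> 2 ^ (c' * bits n ^ q)"
    unfolding log_poly_def by blast
  then have "f n * g n \<le> 2 ^ ((c + c') * bits n ^ q)" if "n \<ge> 1" for n
    using mult_le_mono[of "f n" "2 ^ (c * bits n ^ q)" "g n" "2 ^ (c' * bits n ^ q)"] that
    by (simp add: distrib_right power_add)
  then show ?thesis unfolding log_poly_def by blast
qed

lemma log_poly_mono: "log_poly q g \<Longrightarrow> (\<And>n. 1 \<le> n \<Longrightarrow> f n \<le> g n) \<Longrightarrow> log_poly q f"
  unfolding log_poly_def by (meson order_trans)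

lemma log_poly_add: "log_poly q f \<Longrightarrow> log_poly q g \<Longrightarrow> log_poly q (\<lambda>n. f n + g n)"
proof -
  assume "log_poly q f" "log_poly q g"
  then obtain c c' where c: "\<And>n. n \<ge> 1 \<Longrightarrow> f n \<le> 2 ^ (c * bits n ^ q)" "\<And>n. n \<ge> 1 \<Longrightarrow> g n \<le> 2 ^ (c' * bits n ^ q)"
    unfolding log_poly_def by blast
  have "f n + g n \<le> 2 ^ ((c + c' + 1) * bits n ^ q)" if n: "n \<ge> 1" for n
  proof -
    have "f n + g n \<le> 2 ^ ((c + c') * bits n ^ q) + 2 ^ ((c + c') * bits n ^ q)"
      by (intro add_mono order_trans[OF c(1)[OF n]] order_trans[OF c(2)[OF n]] power_increasing mult_le_mono1) auto
    also have "\<dots> = 2 ^ ((c + c') * bits n ^ q + 1)" by simp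
    also have "\<dots> \<le> 2 ^ ((c + c' + 1) * bits n ^ q)"
      using bits_pos[OF n] by (intro power_increasing) (auto simp: distrib_right)
    finally show ?thesis .
  qed
  then show ?thesis unfolding log_poly_def by blast
qed

lemma log_poly_power: "log_poly q f \<Longrightarrow> log_poly q (\<lambda>n. f n ^ e)"
  by (induction e) (simp_all add: log_poly_const log_poly_mult)

lemma log_poly_ident: "log_poly 1 (\<lambda>n. n)"
  unfolding log_poly_def using less_power_bits by (intro exI[of _ 1]) (simp add: less_imp_le)

lemma log_poly_1_2: "log_poly 1 f \<Longrightarrow> log_poly 2 f"
proof -
  assume "log_poly 1 f"
  then obtain c where c: "\<And>n. n \<ge> 1 \<Longrightarrow> f n \<le> 2 ^ (c * bits n)" unfolding log_poly_def by auto
  have "f n \<le> 2 ^ (c * bits n ^ 2)" if "n \<ge> 1" for n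
  proof -
    have "(2 :: nat) ^ (c * bits n) \<le> 2 ^ (c * bits n ^ 2)"
      using bits_pos[OF that] by (intro power_increasing mult_le_mono2) (auto simp: power2_eq_square)
    then show ?thesis using c[OF that] by linarith
  qed
  then show ?thesis unfolding log_poly_def by blast
qed

text \<open>From 2^(bits n - 1) \<le> n and ln 2 \<ge> 1/2 the bit length is at most 2 ln n + 1, and
  1 \<le> ln n for n \<ge> 3.\<close>

lemma bits_le_ln: "3 \<le> n \<Longrightarrow> real (bits n) \<le> 3 * ln (real n)"
proof -
  assume n: "3 \<le> n"
  have "\<not> bits n \<le> bits n - 1" using bits_pos[of n] n by linarith
  then have "2 ^ (bits n - 1) \<le> n" unfolding bits_le_iff by linarith
  then have "(2::real) ^ (bits n - 1) \<le> real n" by (metis of_nat_le_iff of_nat_numeral of_nat_power)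
  then have "ln ((2::real) ^ (bits n - 1)) \<le> ln (real n)" using n by (subst ln_le_cancel_iff) auto
  then have "real (bits n - 1) * ln 2 \<le> ln (real n)" by (simp add: ln_realpow)
  moreover have "real (bits n - 1) * (1 / 2) \<le> real (bits n - 1) * ln 2"
  proof (rule mult_left_mono)
    have "ln (exp (1 / 2)) \<le> ln (2::real)" using exp_half_le2 by (subst ln_le_cancel_iff) auto
    then show "1 / 2 \<le> ln (2::real)" by simp
  qed simp
  moreover have "1 \<le> ln (real n)"
  proof -
    have "exp 1 \<le> real n" using exp_le n by linarith
    then show ?thesis using ln_ge_iff[of "real n" 1] n by simp
  qed
  moreover have "real (bits n) = real (bits n - 1) + 1" using bits_pos[of n] n by simp
  ultimately show ?thesis by linarith
qed

lemma encodes_graph_input: "encodes_graph E n (snd (graph_input n E))"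
  unfolding encodes_graph_def
proof (intro allI impI)
  fix u v assume uv: "u < n" "v < n"
  then have "(u * n + v) div n = u" "(u * n + v) mod n = v" by auto
  then show "snd (graph_input n E) (u * n + v) = of_bool ({u, v} \<in> E)"
    using index_less[OF uv] by (simp add: graph_input_def)
qed

context clique_counter
begin

section \<open>Bit lengths of the numbers in the program\<close>

lemma levels_le_bits: "levels n \<le> a * bits n"
proof -
  have "n ^ a \<le> (2 ^ bits n) ^ a" using less_power_bits[of n] by (intro power_mono) auto
  also have "\<dots> = 2 ^ (a * bits n)" by (simp add: power_mult[symmetric] mult.commute)
  also have "\<dots> \<le> d ^ (a * bits n)" using d by (intro power_mono) auto
  also have "\<dots> = (d ^ (a * bits n)) ^ 1" by simp
  also have "\<dots> \<le> (d ^ (a * bits n)) ^ b" using b d by (intro power_increasing) auto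
  finally show ?thesis unfolding levels_def by (rule Least_le)
qed

text \<open>The exponent \<open>levels n\<close> is logarithmic, which costs one more factor
  \<open>bits n\<close>.\<close>

lemma log_poly_power_levels:
  assumes "log_poly q f" "\<And>n. 1 \<le> f n"
  shows "log_poly (Suc q) (\<lambda>n. f n ^ levels n)"
proof -
  obtain c where c: "\<And>n. n \<ge> 1 \<Longrightarrow> f n \<le> 2 ^ (c * bits n ^ q)" using assms(1) unfolding log_poly_def by blast
  have "f n ^ levels n \<le> 2 ^ (c * a * bits n ^ Suc q)" if "n \<ge> 1" for n
  proof -
    have "f n ^ levels n \<le> f n ^ (a * bits n)" using assms(2) levels_le_bits by (intro power_increasing) auto
    also have "\<dots> \<le> (2 ^ (c * bits n ^ q)) ^ (a * bits n)" using c[OF that] by (intro power_mono) auto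
    also have "\<dots> = 2 ^ (c * a * bits n ^ Suc q)" by (simp add: power_mult[symmetric] algebra_simps)
    finally show ?thesis .
  qed
  then show ?thesis unfolding log_poly_def by blast
qed

lemma log_poly_const_levels: "1 \<le> x \<Longrightarrow> log_poly 1 (\<lambda>n. x ^ levels n)"
  using log_poly_power_levels[OF log_poly_const, of x 0] by simp

lemma log_poly_bound: "log_poly 2 bound"
proof -
  have side: "log_poly 1 side" unfolding side_def[abs_def] using d_pos by (intro log_poly_const_levels) simp
  have block: "log_poly 1 block" unfolding block_def[abs_def] using r_pos by (intro log_poly_const_levels) simp
  have scale: "log_poly 1 scale" unfolding scale_def[abs_def] using N by (intro log_poly_const_levels) simp
  have modulus: "log_poly 1 modulus" unfolding modulus_def[abs_def]
    by (intro log_poly_add log_poly_mult log_poly_power log_poly_const log_poly_ident scale)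
  have levels: "log_poly 1 levels"
    by (rule log_poly_mono[OF log_poly_mult[OF log_poly_const[of 1 a] log_poly_ident]]) (rule levels_le)
  have base: "log_poly 1 base" unfolding base_def[abs_def]
    by (intro log_poly_add log_poly_mult log_poly_const log_poly_ident side)
  have "log_poly 1 (\<lambda>n. d * d * (coeff_sum * modulus n) + 1)"
    by (intro log_poly_add log_poly_mult log_poly_const modulus)
  then have entry: "log_poly 2 entry_bound" unfolding entry_bound_def[abs_def] Suc_1[symmetric]
    by (rule log_poly_power_levels) simp
  show ?thesis unfolding bound_def[abs_def]
    by (intro log_poly_add log_poly_mult[of 2] log_poly_power[of 2] entry log_poly_const log_poly_ident[THEN log_poly_1_2]
      side[THEN log_poly_1_2] block[THEN log_poly_1_2] scale[THEN log_poly_1_2] modulus[THEN log_poly_1_2]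
      levels[THEN log_poly_1_2] base[THEN log_poly_1_2])
qed

lemma bits_bound_le: "\<exists>c. \<forall>n\<ge>1. bits (bound n) \<le> c * bits n ^ 2"
proof -
  obtain c where c: "\<And>n. n \<ge> 1 \<Longrightarrow> bound n \<le> 2 ^ (c * bits n ^ 2)" using log_poly_bound unfolding log_poly_def by blast
  have "bits (bound n) \<le> (c + 1) * bits n ^ 2" if n: "n \<ge> 1" for n
  proof -
    have "bound n < 2 ^ (c * bits n ^ 2 + 1)" using c[OF n] by (simp add: le_less_trans)
    then have "bits (bound n) \<le> c * bits n ^ 2 + 1" by (simp only: bits_le_iff)
    also have "\<dots> \<le> (c + 1) * bits n ^ 2" using bits_pos[OF n] by (simp add: distrib_right)
    finally show ?thesis .
  qed
  then show ?thesis by blast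
qed

lemma stmt_vars_main_stmt: "stmt_vars main_stmt \<subseteq> {..<16}"
proof -
  have p: "v \<in> expr_vars (power_expr (Var u) t) \<Longrightarrow> v = u" for u v t
    using expr_vars_power_expr[of "Var u" t] by auto
  have c: "v \<in> expr_vars (code_expr l w) \<Longrightarrow> v = v_n \<or> v \<in> expr_vars w" for v l w
    using expr_vars_code_expr[of l w] by auto
  have q: "v \<in> expr_vars (pass_expr d r T) \<Longrightarrow> v \<in> {v_x, v_E, v_src, v_Q}" for v T
    using expr_vars_pass_expr[of d r T] by blast
  have i: "stmt_vars init \<subseteq> {..<16}" unfolding init_def init_loop_def init_body_def init_modulus_def
    by (auto dest!: p)
  have e: "stmt_vars (enumerate_codes l w v) \<subseteq> {..<16}" if "expr_vars w \<subseteq> {..<16}" "v < 16" for l w v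
    unfolding enumerate_codes_def count_stmt_def using that by (auto dest!: p c)
  have "stmt_vars (pass_stmt T) \<subseteq> {..<16}" for T unfolding pass_stmt_def pass_loop_def by (auto dest!: q)
  then have t: "stmt_vars (transform s w T) \<subseteq> {..<16}" if "expr_vars w \<subseteq> {..<16}" for s w T
    unfolding transform_def fill_loop_def using that by auto
  have x: "expr_vars entry_XX \<subseteq> {..<16}" "expr_vars entry_XZ \<subseteq> {..<16}"
    unfolding entry_XX_def entry_XZ_def row_expr_def col_expr_def X_expr_def Z_expr_def
    by (auto dest!: p c)
  have k: "stmt_vars combine \<subseteq> {..<16}" 
    unfolding combine_def acc_stmt_def output_stmt_def result_expr_def by auto
  show ?thesis unfolding main_stmt_def using i e t x k by auto
qed

definition machine :: program where
  "machine = compile 16 main_stmt"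

lemma state_below_graph_input: "n \<le> B \<Longrightarrow> 2 \<le> B \<Longrightarrow> state_below B (graph_input n E)"
  by (auto simp: state_below_def graph_input_def)

lemma machine_correct:
  assumes "0 < n"
  shows "runs_in_time machine (graph_input n E) (stmt_weight main_stmt * num_steps n * bits (bound n))"
    and "output_pmf machine (graph_input n E) = return_pmf (answer E n)"
proof -
  let ?s = "graph_input n E"
  have sp: "spec (bound n) main_stmt ?s (num_steps n) (\<lambda>s'. fst s' v_n = answer E n)"
    by (rule spec_main_stmt[OF _ assms encodes_graph_input]) (simp add: graph_input_def)
  have sb: "state_below (bound n) ?s" using bound_ge by (intro state_below_graph_input)
  have wb: "writes_below (bound n) main_stmt ?s" using sp by (simp add: spec_def)
  note cc = compile_correct[OF stmt_vars_main_stmt _ sb bound_ge(13) wb]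
  show "output_pmf machine ?s = return_pmf (answer E n)"
    unfolding machine_def using cc(2) sp by (simp add: spec_def)
  have "stmt_weight main_stmt * steps main_stmt ?s * bits (bound n) \<le> stmt_weight main_stmt * num_steps n * bits (bound n)"
    using sp by (intro mult_le_mono) (auto simp: spec_def)
  then show "runs_in_time machine ?s (stmt_weight main_stmt * num_steps n * bits (bound n))"
    unfolding machine_def using cc(1) unfolding runs_in_time_def by (fastforce intro: order_trans)
qed

lemma machine_halts: "\<exists>t. runs_in_time machine s t" if "state_below B s"
proof -
  obtain B' where "writes_below B' main_stmt s" using ex_writes_below by blast
  then have "writes_below (max (max B B') 2) main_stmt s" by (rule writes_below_mono) simp
  moreover have "state_below (max (max B B') 2) s" using that by (auto simp: state_below_def max_def intro: order_trans)
  ultimately show ?thesis unfolding machine_def using compile_correct(1)[OF stmt_vars_main_stmt] by fastforce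
qed

text \<open>For \<open>n = 0\<close> only termination matters, and every nest of counting loops terminates.\<close>

definition run_time :: "nat \<Rightarrow> nat" where
  "run_time n = (if n = 0 then (SOME t. runs_in_time machine (graph_input 0 {}) t)
     else stmt_weight main_stmt * num_steps n * bits (bound n))"

lemma machine_runs_in_time:
  assumes "E \<subseteq> all_edges n"
  shows "runs_in_time machine (graph_input n E) (run_time n)"
proof (cases "n = 0")
  case True
  have "all_edges 0 = {}" by (auto simp: all_edges_def)
  then have "E = {}" using assms True by simp
  moreover have "\<exists>t. runs_in_time machine (graph_input 0 {}) t"
    by (rule machine_halts[of 2]) (rule state_below_graph_input, auto)
  ultimately show ?thesis using True someI_ex[of "runs_in_time machine (graph_input 0 {})"] by (simp add: run_time_def)
qed (simp add: run_time_def machine_correct)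

text \<open>The program tosses no coins, so success is an event of the random graph alone. By
  \<open>answer_eq\<close> it can fail only if one of the two lists was cut off, and a union bound
  remains.\<close>

lemma failure_le:
  assumes "0 < n"
  shows "1 - clique_count_success machine (m + (m + j)) n p \<le>
     measure (erdos_renyi n p) {E. real (side n) < real (card (cliques m n E))} +
     measure (erdos_renyi n p) {E. real (side n) < real (card (cliques j n E))}"
    and "clique_count_success machine (m + (m + j)) n p \<le> 1"
proof -
  let ?k = "m + (m + j)" and ?M = "erdos_renyi n p"
  let ?G = "{E. answer E n = card (cliques ?k n E)}"
  let ?X = "{E. real (side n) < real (card (cliques m n E))}" and ?Z = "{E. real (side n) < real (card (cliques j n E))}"
  have "clique_count_success machine ?k n p =
    pmf (bind_pmf ?M (\<lambda>E. return_pmf (answer E n = card (cliques ?k n E)))) True"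
    unfolding clique_count_success_def machine_correct(2)[OF assms] by simp
  also have "\<dots> = pmf (map_pmf (\<lambda>E. answer E n = card (cliques ?k n E)) ?M) True"
    by (simp add: map_pmf_def)
  also have "\<dots> = measure ?M ?G" by (simp add: pmf_map vimage_def)
  finally have s: "clique_count_success machine ?k n p = measure ?M ?G" .
  show "clique_count_success machine ?k n p \<le> 1" unfolding s by simp
  have "1 - measure ?M ?G = measure ?M (- ?G)"
    using measure_pmf.prob_compl[of ?G ?M] by (simp add: Compl_eq_Diff_UNIV)
  also have "\<dots> \<le> measure ?M (?X \<union> ?Z)"
  proof (rule measure_pmf.finite_measure_mono)
    show "- ?G \<subseteq> ?X \<union> ?Z"
    proof
      fix E assume "E \<in> - ?G"
      then have "\<not> (length (codes E n m) \<le> side n \<and> length (codes E n j) \<le> side n)"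
        using answer_eq[OF assms, of E] by auto
      then show "E \<in> ?X \<union> ?Z" unfolding length_codes[OF assms] by auto
    qed
  qed simp
  also have "\<dots> \<le> measure ?M ?X + measure ?M ?Z" by (rule measure_Un_le) auto
  finally show "1 - clique_count_success machine ?k n p \<le> measure ?M ?X + measure ?M ?Z" unfolding s .
qed

section \<open>Growth of the matrices and of the running time\<close>

lemma side_ge:
  assumes "1 \<le> n"
  shows "real n powr (real a / real b) \<le> real (side n)"
proof -
  have "real n ^ a \<le> real (side n) ^ b" using power_le_side[of n] by (metis of_nat_le_iff of_nat_power)
  then have "(real n ^ a) powr (1 / real b) \<le> (real (side n) ^ b) powr (1 / real b)" by (intro powr_mono2) auto
  moreover have "(real n ^ a) powr (1 / real b) = real n powr (real a / real b)"
    using assms by (simp add: powr_realpow[symmetric] powr_powr)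
  moreover have "(real (side n) ^ b) powr (1 / real b) = real (side n)"
    using side_pos[of n] b by (simp add: powr_realpow[symmetric] powr_powr)
  ultimately show ?thesis by simp
qed

text \<open>By minimality of the level, the preceding power of d is below n to the power a/b;
  rounding up to a power of d loses at most the factor d.\<close>

lemma side_le:
  assumes "1 \<le> n"
  shows "real (side n) \<le> real d * real n powr (real a / real b)"
proof (cases "levels n")
  case 0
  have "1 \<le> real n powr (real a / real b)" using assms by (simp add: ge_one_powr_ge_zero)
  moreover have "1 \<le> real d" using d_pos by simp
  ultimately have "1 * 1 \<le> real d * real n powr (real a / real b)" by (intro mult_mono) auto
  then show ?thesis using 0 by (simp add: side_def)
next
  case (Suc K)
  have "(d ^ K) ^ b < n ^ a" using power_less_levels[of K n] Suc by simp
  then have "(real d ^ K) ^ b \<le> real n ^ a" by (metis less_imp_le of_nat_le_iff of_nat_power)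
  then have "((real d ^ K) ^ b) powr (1 / real b) \<le> (real n ^ a) powr (1 / real b)" by (intro powr_mono2) auto
  moreover have "(real n ^ a) powr (1 / real b) = real n powr (real a / real b)"
    using assms by (simp add: powr_realpow[symmetric] powr_powr)
  moreover have "((real d ^ K) ^ b) powr (1 / real b) = real d ^ K"
  proof -
    have "0 < real d ^ K" using d_pos by simp
    then have "((real d ^ K) ^ b) powr (1 / real b) = (real d ^ K) powr (real b * (1 / real b))"
      unfolding powr_powr[symmetric] by (subst powr_realpow) auto
    then show ?thesis using b d_pos by simp
  qed
  ultimately have "real d ^ K \<le> real n powr (real a / real b)" by simp
  then show ?thesis using Suc by (simp add: side_def mult_left_mono)
qed

lemma block_le:
  assumes "1 \<le> n" and \<tau>: "real r \<le> real d powr \<tau>" "0 \<le> \<tau>"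
  shows "real (block n) \<le> real d powr \<tau> * real n powr (real a / real b * \<tau>)"
proof -
  have "real (block n) \<le> (real d powr \<tau>) ^ levels n" unfolding block_def using \<tau>(1) by (simp add: power_mono)
  also have "\<dots> = real (side n) powr \<tau>"
    using d_pos by (simp add: side_def powr_realpow[symmetric] powr_powr mult.commute)
  also have "\<dots> \<le> (real d * real n powr (real a / real b)) powr \<tau>"
    using side_le[OF assms(1)] \<tau>(2) by (intro powr_mono2) auto
  also have "\<dots> = real d powr \<tau> * real n powr (real a / real b * \<tau>)"
    by (simp add: powr_mult powr_powr)
  finally show ?thesis .
qed

lemma run_time_soft_O:
  assumes \<tau>: "real r \<le> real d powr \<tau>" "0 \<le> \<tau>" and e: "real a / real b * \<tau> \<le> e" "real m \<le> e" "real j \<le> e" "1 \<le> e"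
  shows "(\<lambda>n. real (run_time n)) \<in> soft_O (\<lambda>n. real n powr e)"
proof -
  obtain c where c: "\<And>n. n \<ge> 1 \<Longrightarrow> bits (bound n) \<le> c * bits n ^ 2" using bits_bound_le by blast
  define C where "C = real d powr \<tau>"
  \<comment> \<open>Here 34 = 28 + 3 + 3 collects the constant and the two enumeration terms of
    \<open>num_steps\<close>; the last summand belongs to the passes, which are repeated
    \<open>levels n\<close> times.\<close>
  define C1 where "C1 = 34 + 6 * real a + 8 * C + 3 * real a * (5 + 2 * C)"
  define w where "w = real (stmt_weight main_stmt)"
  have C: "0 \<le> C" by (simp add: C_def)
  \<comment> \<open>Of the three logarithms one comes from \<open>levels n\<close> and two from the
    bit length of \<open>bound n\<close>. The factor 27 is the cube of the constant in
    \<open>bits_le_ln\<close>.\<close>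
  have "norm (real (run_time n)) \<le> (w * C1 * c * 27) * norm (real n powr e * ln (real n) ^ 3)" if n: "3 \<le> n" for n
  proof -
    let ?X = "real n powr e" and ?l = "real (bits n)"
    have n1: "1 \<le> real n" "1 \<le> n" using n by auto
    have X: "1 \<le> ?X" using n1 e(4) by (simp add: ge_one_powr_ge_zero)
    have l: "1 \<le> ?l" using bits_pos[OF n1(2)] by simp
    have pw: "real n ^ i \<le> ?X" if "real i \<le> e" for i
    proof -
      have "real n powr real i \<le> ?X" using that n1 by (intro powr_mono) auto
      then show ?thesis using n1 by (simp add: powr_realpow)
    qed
    have G: "real (block n) \<le> C * ?X"
    proof -
      have "real n powr (real a / real b * \<tau>) \<le> ?X" using e(1) n1 by (intro powr_mono) auto
      then have "C * real n powr (real a / real b * \<tau>) \<le> C * ?X" using C by (rule mult_left_mono)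
      then show ?thesis using block_le[OF n1(2) \<tau>] by (simp add: C_def)
    qed
    have L: "real (levels n) \<le> real a * ?l" using levels_le_bits[of n] by (metis of_nat_le_iff of_nat_mult)
    have "real (num_steps n) = 28 + 6 * (real a * real n) + 3 * real n ^ m + 3 * real n ^ j + 8 * real (block n)
      + 3 * (real (levels n) * (5 + 2 * real (block n)))" by (simp add: num_steps_def)
    also have "\<dots> \<le> 28 * ?X + 6 * (real a * ?X) + 3 * ?X + 3 * ?X + 8 * (C * ?X) + 3 * ((real a * ?l) * (5 * ?X + 2 * (C * ?X)))"
      using X pw[of 1] pw[of m] pw[of j] e G L by (intro add_mono mult_mono mult_left_mono) auto
    also have "\<dots> = ?X * (34 + 6 * real a + 8 * C) + ?X * (3 * real a * (5 + 2 * C)) * ?l"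
      by (simp add: algebra_simps)
    also have "\<dots> \<le> ?X * (34 + 6 * real a + 8 * C) * ?l + ?X * (3 * real a * (5 + 2 * C)) * ?l"
    proof -
      have "0 \<le> ?X * (34 + 6 * real a + 8 * C)" using C by simp
      then have "?X * (34 + 6 * real a + 8 * C) * 1 \<le> ?X * (34 + 6 * real a + 8 * C) * ?l"
        using l by (intro mult_left_mono)
      then show ?thesis by simp
    qed
    also have "\<dots> = ?X * C1 * ?l" by (simp add: C1_def algebra_simps)
    finally have S: "real (num_steps n) \<le> ?X * C1 * ?l" .
    have B: "real (bits (bound n)) \<le> real c * ?l ^ 2" using c[OF n1(2)] by (metis of_nat_le_iff of_nat_mult of_nat_power)
    have C1: "0 \<le> C1" using C by (simp add: C1_def)
    have ln: "0 \<le> ln (real n)" using n1 by simp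
    have "real (run_time n) = w * real (num_steps n) * real (bits (bound n))"
      using n by (simp add: run_time_def w_def)
    also have "\<dots> \<le> w * (?X * C1 * ?l) * (real c * ?l ^ 2)"
      using S B C1 by (intro mult_mono mult_left_mono) (auto simp: w_def)
    also have "\<dots> = w * ?X * C1 * real c * ?l ^ 3" by (simp add: power2_eq_square power3_eq_cube)
    also have "\<dots> \<le> w * ?X * C1 * real c * (3 * ln (real n)) ^ 3"
      using bits_le_ln[OF n] C1 by (intro mult_left_mono power_mono) (auto simp: w_def)
    also have "\<dots> = (w * C1 * c * 27) * (?X * ln (real n) ^ 3)" by (simp add: power_mult_distrib)
    finally show ?thesis using ln by simp
  qed
  then have "(\<lambda>n. real (run_time n)) \<in> O(\<lambda>n. real n powr e * ln (real n) ^ 3)"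
    by (intro bigoI[of _ "w * C1 * c * 27"] eventually_sequentiallyI[of 3]) auto
  then show ?thesis unfolding soft_O_def by blast
qed

end

theorem theorem5p4:
  fixes k :: nat and \<alpha> :: real and c :: "nat \<Rightarrow> real"
  assumes "k > 2"
    and "0 < \<alpha>" and "\<alpha> \<le> 2 / (real k - 1)"
    and "\<And>n. 0 \<le> c n \<and> c n \<le> 1"
    and "c \<in> \<Theta>(\<lambda>n. real n powr (-\<alpha>))"
  shows "\<exists>(P::program) (T::nat \<Rightarrow> nat).
    (\<forall>n. \<forall>E \<subseteq> all_edges n. runs_in_time P (graph_input n E) (T n)) \<and>
    (\<lambda>n. real (T n)) \<in> soft_O (\<lambda>n. real n powr
       (mm_omega * real (nat \<lceil>real k / 3\<rceil>) + mm_omega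
        - mm_omega * \<alpha> * real (nat \<lceil>real k / 3\<rceil> choose 2))) \<and>
    superpoly_small (\<lambda>n. 1 - clique_count_success P k n (c n))"
proof -
  define m where "m = nat \<lceil>real k / 3\<rceil>"
  define j where "j = k - 2 * m"
  have m3: "real k / 3 \<le> real m" "3 * real m \<le> real k + 2"
  proof -
    show "real k / 3 \<le> real m" unfolding m_def by linarith
    have "\<lceil>real k / 3\<rceil> = (int k + 2) div 3"
      by (rule ceiling_unique) (linarith, linarith)
    then have "3 * int m \<le> int k + 2" unfolding m_def by linarith
    then show "3 * real m \<le> real k + 2" by linarith
  qed
  \<comment> \<open>\<open>j\<close> may be 0, for example for \<open>k = 4\<close>; the third list
    then consists of the code of the empty clique.\<close>
  have m: "1 \<le> m" "2 * m \<le> k" "j \<le> m" and k: "k = m + (m + j)"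
    using m3 assms(1) unfolding j_def by linarith+
  define \<mu> where "\<mu> = clique_exponent \<alpha> m"
  \<comment> \<open>The upper bound on \<alpha> meets m - 1 \<le> (k - 1) / 3 here. The result is
    below 1, as monotonicity of the clique exponent requires.\<close>
  have am: "\<alpha> * (real m - 1) \<le> 2 / 3"
  proof -
    have "\<alpha> * (real m - 1) \<le> 2 / (real k - 1) * ((real k - 1) / 3)"
      using m(1) m3(2) assms(1-3) by (intro mult_mono) auto
    also have "\<dots> = 2 / 3" using assms(1) by (simp add: field_simps)
    finally show ?thesis .
  qed
  have \<mu>: "2 * real m / 3 \<le> \<mu>"
  proof -
    have "\<alpha> * (real m - 1) * (real m / 2) \<le> 2 / 3 * (real m / 2)" using am by (rule mult_right_mono) simp
    then show ?thesis unfolding \<mu>_def clique_exponent_def choose_2_real by (simp add: field_simps)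
  qed
  have w: "2 \<le> mm_omega" by (rule mm_omega_ge_2)
  define e where "e = mm_omega * (\<mu> + 1)"
  have e_eq: "mm_omega * real m + mm_omega - mm_omega * \<alpha> * real (m choose 2) = e"
    unfolding e_def \<mu>_def clique_exponent_def by (simp add: algebra_simps)
  \<comment> \<open>Solves (\<mu> + 1/2) (\<omega> + \<epsilon>) = \<omega> (\<mu> + 1): a cutoff
    exponent up to \<mu> + 1/2 leaves exactly this loss in \<omega>.\<close>
  define \<epsilon> where "\<epsilon> = mm_omega / (2 * \<mu> + 1)"
  have \<mu>0: "0 < \<mu>" using \<mu> m(1) by linarith
  have \<epsilon>: "0 < \<epsilon>" using w \<mu>0 by (simp add: \<epsilon>_def)
  obtain d r N :: nat and U V W :: "nat \<Rightarrow> nat \<Rightarrow> nat \<Rightarrow> int" where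
    fast: "d \<ge> 2" "N > 0" "d\<^sup>2 \<le> r" "real r \<le> real d powr (mm_omega + \<epsilon>)"
    "\<And>f g e. (\<Sum>h<r. frob d (U h) f * frob d (V h) g * frob d (W h) e) =
      int N * (\<Sum>i<d. \<Sum>j<d. \<Sum>l<d. f i j * g j l * e i l)"
    by (rule ex_fast_trilinear[OF \<epsilon>]) blast
  \<comment> \<open>The cutoff exponent must exceed \<mu> by a fixed amount and be rational, so that
    the machine can compare integer powers. Between \<mu> + 1/4 and \<mu> + 1/2 there is always a
    multiple of 1/8.\<close>
  define a where "a = nat \<lceil>8 * \<mu> + 2\<rceil>"
  have a: "\<mu> + 1 / 4 \<le> real a / real 8" "real a / real 8 \<le> \<mu> + 1 / 2"
    unfolding a_def using \<mu>0 by (simp_all, linarith+)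
  interpret cc: clique_counter m j a 8 d r N U V W
    by unfold_locales (use fast m in auto)
  have "\<forall>n. \<forall>E \<subseteq> all_edges n. runs_in_time cc.machine (graph_input n E) (cc.run_time n)"
    using cc.machine_runs_in_time by blast
  moreover have "(\<lambda>n. real (cc.run_time n)) \<in> soft_O (\<lambda>n. real n powr e)"
  proof (rule cc.run_time_soft_O[OF fast(4)])
    have "real a / real 8 * (mm_omega + \<epsilon>) \<le> (\<mu> + 1 / 2) * (mm_omega + \<epsilon>)"
      using a(2) w \<epsilon> by (intro mult_right_mono) auto
    also have "\<dots> = e" using \<mu>0 unfolding e_def \<epsilon>_def by (simp add: field_simps)
    finally show "real a / real 8 * (mm_omega + \<epsilon>) \<le> e" .
    \<comment> \<open>With \<mu> \<ge> 2m/3 the left side is at least 4m/3 + 2, which covers the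
      enumeration of all m-tuples and j-tuples.\<close>
    have "2 * (\<mu> + 1) \<le> e" unfolding e_def using w \<mu>0 by (intro mult_right_mono) auto
    moreover have "1 \<le> real m" "real j \<le> real m" using m by auto
    ultimately show "real m \<le> e" "real j \<le> e" "1 \<le> e" using \<mu> by auto
  qed (use w \<epsilon> in auto)
  moreover have "superpoly_small (\<lambda>n. 1 - clique_count_success cc.machine k n (c n))"
  proof (rule superpoly_small_mono)
    let ?p = "\<lambda>l n. measure (erdos_renyi n (c n)) {E. real (cc.side n) < real (card (cliques l n E))}"
    \<comment> \<open>Both lists are covered at once, since the exponent for
      \<open>l \<le> m\<close> is at most \<mu>; the margin 1/4 drives the decay.\<close>
    have many: "superpoly_small (?p l)" if l: "l \<le> m" for l
    proof (rule many_cliques_superpoly_small)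
      have "\<alpha> * (real l - 1) \<le> \<alpha> * (real m - 1)" using l assms(2) by (intro mult_left_mono) auto
      then show "\<alpha> * (real l - 1) \<le> 1" using am by linarith
      have "clique_exponent \<alpha> l \<le> \<mu>" unfolding \<mu>_def using l assms(2) am by (intro clique_exponent_mono) auto
      then have le: "clique_exponent \<alpha> l + 1 / 4 \<le> real a / real 8" using a(1) by linarith
      show "\<forall>\<^sub>F n in sequentially. real n powr (clique_exponent \<alpha> l + 1 / 4) \<le> real (cc.side n)"
        using eventually_ge_at_top[of 1]
      proof eventually_elim
        case (elim n)
        have "real n powr (clique_exponent \<alpha> l + 1 / 4) \<le> real n powr (real a / real 8)"
          using elim le by (intro powr_mono) auto
        then show ?case using cc.side_ge[OF elim] by linarith
      qed
    qed (use assms in \<open>auto simp: bigtheta_def\<close>)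
    show "superpoly_small (\<lambda>n. ?p m n + ?p j n)" using m(3) by (intro superpoly_small_add many) auto
    show "\<forall>\<^sub>F n in sequentially. \<bar>1 - clique_count_success cc.machine k n (c n)\<bar> \<le> \<bar>?p m n + ?p j n\<bar>"
      using eventually_gt_at_top[of 0]
    proof eventually_elim
      case (elim n)
      show ?case using cc.failure_le[OF elim, of "c n"] unfolding k by simp
    qed
  qed
  ultimately show ?thesis unfolding m_def[symmetric] e_eq by blast
qed

end
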